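(* Suppose $0<\eta<\frac{2\varepsilon}{M_x^2}$, and let $(f^t,g^t,h^t)_{t\in\mathbb{N}_0}$ be the iterates of the modified Sinkhorn algorithm with step size $\eta$ started from $(f^0,g^0,h^0)\in\mathcal{C}_\diamond(\mathcal{U})\times\mathcal{C}_\diamond(\mathcal{U};\mathbb{R}^{d_x})\times\mathcal{C}(\mathcal{X}\times\mathcal{Y})$. Let $(\bar f,\bar g,\bar h)\in\mathcal{C}_\diamond(\mathcal{U})\times\mathcal{C}_\diamond(\mathcal{U};\mathbb{R}^{d_x})\times\mathcal{C}(\mathcal{X}\times\mathcal{Y})$ be the dual potentials, $\bar D:=D(\bar f,\bar g,\bar h)$ and $D_0:=D(f^0,g^0,h^0)$. Then there exists $\tau^\star>0$ such that $$\bar D-D(f^t,g^t,h^t)\le(1+\tau^\star)^{-t}(\bar D-D_0)\quad\text{for all }t\in\mathbb{N}_0,$$ and, furthermore, as $t\to\infty$, $$\|f^t-\bar f\|_{L^2(\mu)}^2+\|g^t-\bar g\|_{L^2(\mu)}^2+\|h^t-\bar h\|_{L^2(\nu)}^2=O\big((1+\tau^\star)^{-t}\big).$$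
   Context: Setting. Let $(X,Y)$ be a random vector in $\mathbb{R}^{d_x}\times\mathbb{R}^{d_y}$ with law $\nu$; let $\mathcal{X}$, $\mathcal{Y}$ be the supports of $X$, $Y$. Let $\mu$ be a Borel probability measure on $\mathbb{R}^{d_y}$ with support $\mathcal{U}$. Assume $\mathcal{U},\mathcal{X},\mathcal{Y}$ are compact, $\mathbb{E}[X]=0$ and $\Sigma_X:=\mathbb{E}[XX^\top]$ is invertible. Fix $\varepsilon>0$; $c(u,y):=\|u-y\|^2/2$; $M_x:=\sup_{x\in\mathcal{X}}\|x\|$. The dual objective is $$D(f,g,h):=\int f\,d\mu+\int h\,d\nu-\varepsilon\left(\int e^{(f(u)+\langle g(u),x\rangle+h(x,y)-c(u,y))/\varepsilon}\,d(\mu\otimes\nu)(u,x,y)-1\right).$$ Spaces. $\mathcal{C}_\diamond(\mathcal{U})$ (resp. $\mathcal{C}_\diamond(\mathcal{U};\mathbb{R}^{d_x})$) is the set of continuous $f:\mathcal{U}\to\mathbb{R}$ (resp. $g:\mathcal{U}\to\mathbb{R}^{d_x}$) with $\int f\,d\mu=0$ (resp. $\int g\,d\mu=0$). $\|g\|_{L^2(\mu)}^2=\int\|g\|^2d\mu$. Dual potentials. These are maximizers of $D$ over $L^1(\mu)\times L^1(\mu;\mathbb{R}^{d_x})\times L^1(\nu)$. It is known that there is a unique triple $(\bar f,\bar g,\bar h)\in\mathcal{C}_\diamond(\mathcal{U})\times\mathcal{C}_\diamond(\mathcal{U};\mathbb{R}^{d_x})\times\mathcal{C}(\mathcal{X}\times\mathcal{Y})$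 of dual potentials satisfying, for all $u\in\mathcal{U}$ and all $(x,y)\in\mathcal{X}\times\mathcal{Y}$: $\bar f(u)=-\varepsilon\log\int e^{(\langle\bar g(u),x\rangle+\bar h(x,y)-c(u,y))/\varepsilon}d\nu(x,y)$; $\int x\,e^{(\langle\bar g(u),x\rangle+\bar h(x,y)-c(u,y))/\varepsilon}d\nu(x,y)=0$; $\bar h(x,y)=-\varepsilon\log\int e^{(\bar f(u)+\langle\bar g(u),x\rangle-c(u,y))/\varepsilon}d\mu(u)$. "The dual potentials" means this triple. Modified Sinkhorn algorithm with step size $\eta>0$. Given $(f^t,g^t,h^t)$: (1) $\tilde h^{t+1}(x,y)=-\varepsilon\log\int e^{(f^t(u)+\langle g^t(u),x\rangle-c(u,y))/\varepsilon}d\mu(u)$ and then $\tilde f^{t+1}(u)=-\varepsilon\log\int e^{(\langle g^t(u),x\rangle+\tilde h^{t+1}(x,y)-c(u,y))/\varepsilon}d\nu(x,y)$; (2) $\tilde g^{t+1}=g^t-\eta\,d_g^t$ with $d_g^t(u)=e^{\tilde f^{t+1}(u)/\varepsilon}\int x\,e^{(\langle g^t(u),x\rangle+\tilde h^{t+1}(x,y)-c(u,y))/\varepsilon}d\nu(x,y)$; (3) $f^{t+1}=\tilde f^{t+1}-\int\tilde f^{t+1}d\mu$, $g^{t+1}=\tilde g^{t+1}-\int\tilde g^{t+1}d\mu$, $h^{t+1}(x,y)=\tilde h^{t+1}(x,y)+\int\tilde f^{t+1}d\mu+\langle\int\tilde g^{t+1}d\mu,x\rangle$. *)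

theory Defs
  imports "HOL-Probability.Probability"
begin

text \<open>
  Throughout, \<open>\<mu>\<close> is the reference measure on the space of \<open>u\<close>, and \<open>\<nu>\<close> is the law of the pair
  \<open>(X, Y)\<close>, i.e. a measure on the product space. Functions on \<open>supp \<mu>\<close> and on
  \<open>supp X \<times> supp Y\<close> are represented by total functions of which only the values on these
  sets matter; therefore all integrals are restricted to these (full measure) sets.
\<close>

definition msupport :: "'a::topological_space measure \<Rightarrow> 'a set" where
  "msupport M = {x. \<forall>S. open S \<longrightarrow> x \<in> S \<longrightarrow> emeasure M S > 0}"

definition suppX :: "((real^'m) \<times> (real^'n)) measure \<Rightarrow> (real^'m) set" where
  "suppX \<nu> = msupport (distr \<nu> borel fst)"

definition suppY :: "((real^'m) \<times> (real^'n)) measure \<Rightarrow> (real^'n) set" where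
  "suppY \<nu> = msupport (distr \<nu> borel snd)"

text \<open>The domain of \<open>h\<close> is the product of the two marginal supports, which may be larger than the
  support of \<open>\<nu>\<close>.\<close>

definition suppXY :: "((real^'m) \<times> (real^'n)) measure \<Rightarrow> ((real^'m) \<times> (real^'n)) set" where
  "suppXY \<nu> = suppX \<nu> \<times> suppY \<nu>"

definition second_moment_X :: "((real^'m) \<times> (real^'n)) measure \<Rightarrow> real^'m^'m" where
  "second_moment_X \<nu> = (\<chi> i j. LINT z|\<nu>. fst z $ i * fst z $ j)"

definition M_X :: "((real^'m) \<times> (real^'n)) measure \<Rightarrow> real" where
  "M_X \<nu> = (SUP x\<in>suppX \<nu>. norm x)"

definition cost :: "real^'n \<Rightarrow> real^'n \<Rightarrow> real" where
  "cost u y = (norm (u - y))\<^sup>2 / 2"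

text \<open>The exponential need not be integrable for \<open>L\<^sup>1\<close> arguments, in which case the dual objective
  is \<open>-\<infinity>\<close>. A Bochner integral would instead be \<open>0\<close> there.\<close>

definition dual_objective ::
  "(real^'n) measure \<Rightarrow> ((real^'m) \<times> (real^'n)) measure \<Rightarrow> real \<Rightarrow>
   (real^'n \<Rightarrow> real) \<Rightarrow> (real^'n \<Rightarrow> real^'m) \<Rightarrow> ((real^'m) \<times> (real^'n) \<Rightarrow> real) \<Rightarrow> ereal" where
  "dual_objective \<mu> \<nu> \<epsilon> f g h =
     ereal ((LINT u:msupport \<mu>|\<mu>. f u) + (LINT (x, y):suppXY \<nu>|\<nu>. h (x, y)))
     - ereal \<epsilon> * (enn2ereal
         (\<integral>\<^sup>+(u, x, y)\<in>msupport \<mu> \<times> suppXY \<nu>.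
            ennreal (exp ((f u + g u \<bullet> x + h (x, y) - cost u y) / \<epsilon>)) \<partial>(\<mu> \<Otimes>\<^sub>M \<nu>)) - 1)"

definition in_L1 ::
  "(real^'n) measure \<Rightarrow> ((real^'m) \<times> (real^'n)) measure \<Rightarrow>
   (real^'n \<Rightarrow> real) \<Rightarrow> (real^'n \<Rightarrow> real^'m) \<Rightarrow> ((real^'m) \<times> (real^'n) \<Rightarrow> real) \<Rightarrow> bool" where
  "in_L1 \<mu> \<nu> f g h \<longleftrightarrow>
     set_integrable \<mu> (msupport \<mu>) f \<and> set_integrable \<mu> (msupport \<mu>) g \<and>
     set_integrable \<nu> (suppXY \<nu>) h"

definition continuous_centred ::
  "(real^'n) measure \<Rightarrow> (real^'n \<Rightarrow> 'b::euclidean_space) \<Rightarrow> bool" where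
  "continuous_centred \<mu> f \<longleftrightarrow>
     continuous_on (msupport \<mu>) f \<and> (LINT u:msupport \<mu>|\<mu>. f u) = 0"

definition admissible ::
  "(real^'n) measure \<Rightarrow> ((real^'m) \<times> (real^'n)) measure \<Rightarrow>
   (real^'n \<Rightarrow> real) \<Rightarrow> (real^'n \<Rightarrow> real^'m) \<Rightarrow> ((real^'m) \<times> (real^'n) \<Rightarrow> real) \<Rightarrow> bool" where
  "admissible \<mu> \<nu> f g h \<longleftrightarrow>
     continuous_centred \<mu> f \<and> continuous_centred \<mu> g \<and> continuous_on (suppXY \<nu>) h"

definition h_update ::
  "(real^'n) measure \<Rightarrow> real \<Rightarrow> (real^'n \<Rightarrow> real) \<Rightarrow> (real^'n \<Rightarrow> real^'m) \<Rightarrow>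
   (real^'m) \<times> (real^'n) \<Rightarrow> real" where
  "h_update \<mu> \<epsilon> f g = (\<lambda>(x, y).
     - \<epsilon> * ln (LINT u:msupport \<mu>|\<mu>. exp ((f u + g u \<bullet> x - cost u y) / \<epsilon>)))"

definition f_update ::
  "((real^'m) \<times> (real^'n)) measure \<Rightarrow> real \<Rightarrow> (real^'n \<Rightarrow> real^'m) \<Rightarrow> ((real^'m) \<times> (real^'n) \<Rightarrow> real) \<Rightarrow>
   real^'n \<Rightarrow> real" where
  "f_update \<nu> \<epsilon> g h u =
     - \<epsilon> * ln (LINT (x, y):suppXY \<nu>|\<nu>. exp ((g u \<bullet> x + h (x, y) - cost u y) / \<epsilon>))"

definition x_moment ::
  "((real^'m) \<times> (real^'n)) measure \<Rightarrow> real \<Rightarrow> (real^'n \<Rightarrow> real^'m) \<Rightarrow> ((real^'m) \<times> (real^'n) \<Rightarrow> real) \<Rightarrow>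
   real^'n \<Rightarrow> real^'m" where
  "x_moment \<nu> \<epsilon> g h u =
     (LINT (x, y):suppXY \<nu>|\<nu>. exp ((g u \<bullet> x + h (x, y) - cost u y) / \<epsilon>) *\<^sub>R x)"

definition dual_maximizer ::
  "(real^'n) measure \<Rightarrow> ((real^'m) \<times> (real^'n)) measure \<Rightarrow> real \<Rightarrow>
   (real^'n \<Rightarrow> real) \<Rightarrow> (real^'n \<Rightarrow> real^'m) \<Rightarrow> ((real^'m) \<times> (real^'n) \<Rightarrow> real) \<Rightarrow> bool" where
  "dual_maximizer \<mu> \<nu> \<epsilon> f g h \<longleftrightarrow> in_L1 \<mu> \<nu> f g h \<and>
     (\<forall>f' g' h'. in_L1 \<mu> \<nu> f' g' h' \<longrightarrow>
        dual_objective \<mu> \<nu> \<epsilon> f' g' h' \<le> dual_objective \<mu> \<nu> \<epsilon> f g h)"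

text \<open>The unique (on the supports) normalised continuous maximizers that satisfy the Schroedinger
  system everywhere on the supports.\<close>

definition dual_potentials ::
  "(real^'n) measure \<Rightarrow> ((real^'m) \<times> (real^'n)) measure \<Rightarrow> real \<Rightarrow>
   (real^'n \<Rightarrow> real) \<Rightarrow> (real^'n \<Rightarrow> real^'m) \<Rightarrow> ((real^'m) \<times> (real^'n) \<Rightarrow> real) \<Rightarrow> bool" where
  "dual_potentials \<mu> \<nu> \<epsilon> f g h \<longleftrightarrow>
     admissible \<mu> \<nu> f g h \<and> dual_maximizer \<mu> \<nu> \<epsilon> f g h \<and>
     (\<forall>u\<in>msupport \<mu>. f u = f_update \<nu> \<epsilon> g h u) \<and>
     (\<forall>u\<in>msupport \<mu>. x_moment \<nu> \<epsilon> g h u = 0) \<and>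
     (\<forall>z\<in>suppXY \<nu>. h z = h_update \<mu> \<epsilon> f g z)"

definition sinkhorn_step ::
  "(real^'n) measure \<Rightarrow> ((real^'m) \<times> (real^'n)) measure \<Rightarrow> real \<Rightarrow> real \<Rightarrow>
   (real^'n \<Rightarrow> real) \<times> (real^'n \<Rightarrow> real^'m) \<times> ((real^'m) \<times> (real^'n) \<Rightarrow> real) \<Rightarrow>
   (real^'n \<Rightarrow> real) \<times> (real^'n \<Rightarrow> real^'m) \<times> ((real^'m) \<times> (real^'n) \<Rightarrow> real)" where
  "sinkhorn_step \<mu> \<nu> \<epsilon> \<eta> = (\<lambda>(f, g, h).
     let h' = h_update \<mu> \<epsilon> f g;
         f' = f_update \<nu> \<epsilon> g h';
         d = (\<lambda>u. exp (f' u / \<epsilon>) *\<^sub>R x_moment \<nu> \<epsilon> g h' u);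
         g' = (\<lambda>u. g u - \<eta> *\<^sub>R d u);
         a = (LINT u:msupport \<mu>|\<mu>. f' u);
         b = (LINT u:msupport \<mu>|\<mu>. g' u)
     in (\<lambda>u. f' u - a, \<lambda>u. g' u - b, \<lambda>(x, y). h' (x, y) + a + b \<bullet> x))"

definition L2_norm_sq :: "'a measure \<Rightarrow> 'a set \<Rightarrow> ('a \<Rightarrow> 'b::euclidean_space) \<Rightarrow> real" where
  "L2_norm_sq M A f = (LINT x:A|M. (norm (f x))\<^sup>2)"

end

theory Submission
  imports Defs
begin

text \<open>
  Up to constants, strong concavity of the dual objective on bounded sets, modulo the gauge freedom
  removed by centring, gives a Polyak--Lojasiewicz inequality: after the updates of \<open>h\<close> and \<open>f\<close>,
  the optimality gap is at most \<open>\<parallel>d\<parallel>\<^sup>2 + \<parallel>1 - m\<parallel>\<^sup>2\<close>, where \<open>d\<close> is the gradient in \<open>g\<close> and \<open>m\<close>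
  the mass of the coupling over \<open>(x, y)\<close>; moreover \<open>\<parallel>1 - m\<parallel>\<close> is controlled by the change of \<open>f\<close>.
  Both terms are paid for by the increase of the objective in one iteration: the change of \<open>f\<close> by
  the exact maximization in \<open>f\<close>, and \<open>\<parallel>d\<parallel>\<^sup>2\<close> by the gradient step, through Hoeffding's lemma.
  The constants are uniform because the iterates stay bounded. Indeed \<open>g \<bullet> d\<close> grows linearly in
  \<open>|g|\<close>, so a gradient step shortens large vectors \<open>g u\<close> by a fixed amount, while the recentring
  vectors tend to zero since the increments of the objective are summable.
\<close>

section \<open>Bounded measurable functions\<close>

text \<open>All constants come from one number \<open>B\<close> that bounds the exponents: on
  [-B, B] the exponential has convexity modulus exp (- B), so without a uniform \<open>B\<close>
  strong concavity yields no rate. The exact updates of \<open>f\<close> and \<open>h\<close> are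
  bounded once \<open>g\<close> is, but \<open>g\<close> moves by gradient steps followed by
  recentring, and nothing in the algorithm caps it. Monotonicity of the objective only controls the
  integral of the updated \<open>h\<close> from below, never its values. Together with the pointwise
  upper bound on \<open>h\<close> that centring gives, this is enough: a large \<open>g u\<close>
  forces the updated \<open>f u\<close> to be very negative (coercivity of the second moment of X),
  and a very negative \<open>f u\<close> forces a large inner product of \<open>g u\<close> with the
  gradient (Jensen). To avoid a circle, every fact used before \<open>g\<close> is known to be
  bounded works with bounds that may depend on the iterate.

  The gap is measured at the intermediate triple before the gradient step, where the mass over each
  \<open>u\<close> is exactly one; the gradient step then only raises the objective.\<close>

lemma exp_mult_diff_ge:
  fixes y :: real
  assumes "y \<ge> 0"
  shows "exp y * (y - 1) \<ge> y\<^sup>2 / 2 - 1"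
proof -
  have "exp 0 * (0 - 1) - (0\<^sup>2 / 2 - 1) \<le> exp y * (y - 1) - (y\<^sup>2 / 2 - 1)"
  proof (rule DERIV_nonneg_imp_nondecreasing[OF assms])
    fix x :: real assume x: "0 \<le> x" "x \<le> y"
    have "((\<lambda>x. exp x * (x - 1) - (x\<^sup>2 / 2 - 1)) has_real_derivative x * (exp x - 1)) (at x)"
      by (auto intro!: derivative_eq_intros simp: algebra_simps)
    moreover have "x * (exp x - 1) \<ge> 0" using x by simp
    ultimately show "\<exists>d. ((\<lambda>x. exp x * (x - 1) - (x\<^sup>2 / 2 - 1)) has_real_derivative d) (at x) \<and> 0 \<le> d"
      by blast
  qed
  then show ?thesis by simp
qed

text \<open>exp (- B) bounds the second derivative from below between \<open>a\<close> and
  \<open>b\<close>. For a <= b this is the quadratic Taylor bound scaled by exp a; for b < a that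
  bound fails, and exp b is factored out instead, which is where \<open>exp_mult_diff_ge\<close>
  enters.\<close>

lemma exp_strongly_convex:
  fixes a b B :: real
  assumes "\<bar>a\<bar> \<le> B" "\<bar>b\<bar> \<le> B"
  shows "exp b - exp a \<ge> exp a * (b - a) + exp (- B) / 2 * (b - a)\<^sup>2"
proof (cases "a \<le> b")
  case True
  have "exp a * (1 + (b - a) + (b - a)\<^sup>2 / 2) \<le> exp a * exp (b - a)"
    using exp_lower_Taylor_quadratic[of "b - a"] True by (intro mult_left_mono) auto
  moreover have "exp (- B) * ((b - a)\<^sup>2 / 2) \<le> exp a * ((b - a)\<^sup>2 / 2)"
    using assms by (intro mult_right_mono) auto
  ultimately show ?thesis
    by (simp add: algebra_simps flip: exp_add)
next
  case False
  have "exp b * ((a - b)\<^sup>2 / 2 - 1) \<le> exp b * (exp (a - b) * (a - b - 1))"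
    using exp_mult_diff_ge[of "a - b"] False by (intro mult_left_mono) auto
  also have "\<dots> = exp a * (a - b - 1)"
    using exp_add[of b "a - b"] by (simp add: mult.assoc [symmetric])
  finally have "exp b * ((a - b)\<^sup>2 / 2 - 1) \<le> exp a * (a - b - 1)" .
  moreover have "exp (- B) * ((a - b)\<^sup>2 / 2) \<le> exp b * ((a - b)\<^sup>2 / 2)"
    using assms by (intro mult_right_mono) auto
  ultimately show ?thesis
    by (simp add: algebra_simps power2_commute)
qed

lemma exp_minus_one_sq_le:
  fixes x B :: real
  assumes "\<bar>x\<bar> \<le> B"
  shows "(exp x - 1)\<^sup>2 \<le> exp (2 * B) * x\<^sup>2"
proof -
  have "\<bar>exp x - 1\<bar> \<le> exp B * \<bar>x\<bar>"
  proof (cases "x \<ge> 0")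
    case True
    have "exp x * (1 + - x) \<le> exp x * exp (- x)"
      by (intro mult_left_mono exp_ge_add_one_self) auto
    then have "exp x - 1 \<le> exp x * x"
      by (simp add: algebra_simps flip: exp_add)
    also have "\<dots> \<le> exp B * x"
      using assms True by (intro mult_right_mono) auto
    finally show ?thesis using True by simp
  next
    case False
    have "1 - exp x \<le> - x" using exp_ge_add_one_self[of x] by linarith
    also have "1 * (- x) \<le> exp B * (- x)"
      using assms False by (intro mult_right_mono) auto
    finally show ?thesis using False by simp
  qed
  then have "\<bar>exp x - 1\<bar>\<^sup>2 \<le> (exp B * \<bar>x\<bar>)\<^sup>2"
    by (rule power_mono) simp
  then show ?thesis
    by (simp add: power_mult_distrib exp_double)
qed

text \<open>Completing the square. Below, \<open>x\<close> is the unknown distance to the optimum,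
  which the quadratic loss absorbs, so that only the gradient \<open>y\<close> remains.\<close>

lemma young_inner:
  fixes x y :: "'b::real_inner"
  assumes "\<gamma> > 0"
  shows "- (x \<bullet> y) - \<gamma> * (norm x)\<^sup>2 \<le> (norm y)\<^sup>2 / (4 * \<gamma>)"
proof -
  have "0 \<le> (norm ((2 * \<gamma>) *\<^sub>R x + y))\<^sup>2 / (4 * \<gamma>)" using assms by simp
  also have "(norm ((2 * \<gamma>) *\<^sub>R x + y))\<^sup>2 = 4 * \<gamma>\<^sup>2 * (norm x)\<^sup>2 + 4 * \<gamma> * (x \<bullet> y) + (norm y)\<^sup>2"
    unfolding power2_norm_eq_inner by (simp add: algebra_simps inner_commute power2_eq_square)
  also have "\<dots> / (4 * \<gamma>) = \<gamma> * (norm x)\<^sup>2 + x \<bullet> y + (norm y)\<^sup>2 / (4 * \<gamma>)"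
    using assms by (simp add: field_simps power2_eq_square)
  finally show ?thesis by simp
qed

text \<open>The bound is required at every point of the space, not almost everywhere: the
  inequalities between exponents are pointwise, and sections in one variable must inherit the
  bound.\<close>

definition bdmeas :: "'a measure \<Rightarrow> ('a \<Rightarrow> 'b::euclidean_space) \<Rightarrow> bool" where
  "bdmeas M f \<longleftrightarrow> f \<in> borel_measurable M \<and> (\<exists>B. \<forall>x\<in>space M. norm (f x) \<le> B)"

lemma bdmeasI:
  "f \<in> borel_measurable M \<Longrightarrow> (\<And>x. x \<in> space M \<Longrightarrow> norm (f x) \<le> B) \<Longrightarrow> bdmeas M f"
  by (auto simp: bdmeas_def)

lemma bdmeas_measurable: "bdmeas M f \<Longrightarrow> f \<in> borel_measurable M"
  by (simp add: bdmeas_def)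

lemma bdmeas_bound:
  assumes "bdmeas M f"
  obtains B where "B \<ge> 0" "\<And>x. x \<in> space M \<Longrightarrow> norm (f x) \<le> B"
proof -
  obtain B where "\<forall>x\<in>space M. norm (f x) \<le> B"
    using assms by (auto simp: bdmeas_def)
  then show ?thesis
    by (intro that[of "max B 0"]) (auto intro: order_trans)
qed

lemma bdmeas_integrable: "finite_measure M \<Longrightarrow> bdmeas M f \<Longrightarrow> integrable M f"
  unfolding bdmeas_def by (auto intro: finite_measure.integrable_const_bound)

lemma bdmeas_const: "bdmeas M (\<lambda>_. a)"
  by (rule bdmeasI) auto

lemma bdmeas_add: "bdmeas M f \<Longrightarrow> bdmeas M g \<Longrightarrow> bdmeas M (\<lambda>x. f x + g x)"
  unfolding bdmeas_def by (auto intro!: exI norm_triangle_mono)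

lemma bdmeas_uminus: "bdmeas M f \<Longrightarrow> bdmeas M (\<lambda>x. - f x)"
  by (auto simp: bdmeas_def)

lemma bdmeas_diff: "bdmeas M f \<Longrightarrow> bdmeas M g \<Longrightarrow> bdmeas M (\<lambda>x. f x - g x)"
  using bdmeas_add[OF _ bdmeas_uminus] by fastforce

lemma bdmeas_scaleR:
  assumes f: "bdmeas M f" and g: "bdmeas M g"
  shows "bdmeas M (\<lambda>x. f x *\<^sub>R g x)"
proof -
  obtain A where A: "A \<ge> 0" "\<And>x. x \<in> space M \<Longrightarrow> norm (f x) \<le> A" using bdmeas_bound[OF f] by blast
  obtain B where B: "B \<ge> 0" "\<And>x. x \<in> space M \<Longrightarrow> norm (g x) \<le> B" using bdmeas_bound[OF g] by blast
  show ?thesis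
    using f g A B by (intro bdmeasI[where B="A * B"]) (auto simp: bdmeas_def intro!: mult_mono)
qed

lemma bdmeas_mult: "bdmeas M f \<Longrightarrow> bdmeas M g \<Longrightarrow> bdmeas M (\<lambda>x. f x * g x :: real)"
  using bdmeas_scaleR[of M f g] by simp

lemma bdmeas_power2: "bdmeas M f \<Longrightarrow> bdmeas M (\<lambda>x. (f x)\<^sup>2 :: real)"
  by (simp add: power2_eq_square bdmeas_mult)

lemma bdmeas_norm: "bdmeas M f \<Longrightarrow> bdmeas M (\<lambda>x. norm (f x))"
  by (auto simp: bdmeas_def)

lemma bdmeas_abs: "bdmeas M f \<Longrightarrow> bdmeas M (\<lambda>x. \<bar>f x :: real\<bar>)"
  using bdmeas_norm[of M f] by simp

lemma bdmeas_inner: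
  assumes f: "bdmeas M f" and g: "bdmeas M g"
  shows "bdmeas M (\<lambda>x. f x \<bullet> g x)"
proof -
  obtain A where A: "A \<ge> 0" "\<And>x. x \<in> space M \<Longrightarrow> norm (f x) \<le> A" using bdmeas_bound[OF f] by blast
  obtain B where B: "B \<ge> 0" "\<And>x. x \<in> space M \<Longrightarrow> norm (g x) \<le> B" using bdmeas_bound[OF g] by blast
  show ?thesis
  proof (rule bdmeasI[where B="A * B"])
    show "(\<lambda>x. f x \<bullet> g x) \<in> borel_measurable M"
      using f g by (auto simp: bdmeas_def)
    show "norm (f x \<bullet> g x) \<le> A * B" if "x \<in> space M" for x
      using A B that by (intro order_trans[OF Cauchy_Schwarz_ineq2[of "f x" "g x", folded real_norm_def]] mult_mono) auto
  qed
qed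

lemma bdmeas_exp:
  assumes "bdmeas M f"
  shows "bdmeas M (\<lambda>x. exp (f x :: real))"
proof -
  obtain B where "\<And>x. x \<in> space M \<Longrightarrow> norm (f x) \<le> B"
    using bdmeas_bound[OF assms] by blast
  then show ?thesis
    using assms by (intro bdmeasI[where B="exp B"]) (auto simp: bdmeas_def abs_le_iff)
qed

lemma bdmeas_ln:
  fixes f :: "_ \<Rightarrow> real"
  assumes "bdmeas M f" and \<delta>: "\<delta> > 0" "\<And>x. x \<in> space M \<Longrightarrow> f x \<ge> \<delta>"
  shows "bdmeas M (\<lambda>x. ln (f x))"
proof -
  obtain B where B: "B \<ge> 0" "\<And>x. x \<in> space M \<Longrightarrow> norm (f x) \<le> B" using bdmeas_bound[OF assms(1)] by blast
  show ?thesis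
  proof (rule bdmeasI[where B="\<bar>ln \<delta>\<bar> + \<bar>ln B\<bar>"])
    show "(\<lambda>x. ln (f x)) \<in> borel_measurable M"
      using assms(1) by (auto simp: bdmeas_def)
    fix x assume x: "x \<in> space M"
    have "0 < f x" "f x \<le> B" using \<delta>(1) \<delta>(2)[OF x] B(2)[OF x] by auto
    then have "ln \<delta> \<le> ln (f x)" "ln (f x) \<le> ln B"
      using \<delta>(1) \<delta>(2)[OF x] by auto
    then show "norm (ln (f x)) \<le> \<bar>ln \<delta>\<bar> + \<bar>ln B\<bar>" by auto
  qed
qed

lemma bdmeas_fst: "bdmeas M f \<Longrightarrow> bdmeas (M \<Otimes>\<^sub>M N) (\<lambda>p. f (fst p))"
  by (auto simp: bdmeas_def space_pair_measure)

lemma bdmeas_snd: "bdmeas N f \<Longrightarrow> bdmeas (M \<Otimes>\<^sub>M N) (\<lambda>p. f (snd p))"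
  by (auto simp: bdmeas_def space_pair_measure)

lemmas bdmeas_intros = bdmeas_const bdmeas_add bdmeas_uminus bdmeas_diff bdmeas_scaleR bdmeas_mult
  bdmeas_power2 bdmeas_norm bdmeas_abs bdmeas_inner bdmeas_exp bdmeas_fst bdmeas_snd

section \<open>Fubini for bounded measurable functions\<close>

context pair_prob_space
begin

lemma bdmeas_section_snd:
  "bdmeas (M1 \<Otimes>\<^sub>M M2) k \<Longrightarrow> u \<in> space M1 \<Longrightarrow> bdmeas M2 (\<lambda>z. k (u, z))"
  by (auto simp: bdmeas_def space_pair_measure)

lemma bdmeas_section_fst:
  "bdmeas (M1 \<Otimes>\<^sub>M M2) k \<Longrightarrow> z \<in> space M2 \<Longrightarrow> bdmeas M1 (\<lambda>u. k (u, z))"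
  by (auto simp: bdmeas_def space_pair_measure)

lemma integrable1: "bdmeas M1 f \<Longrightarrow> integrable M1 f"
  by (rule bdmeas_integrable) unfold_locales

lemma integrable2: "bdmeas M2 f \<Longrightarrow> integrable M2 f"
  by (rule bdmeas_integrable) unfold_locales

lemma integrable12: "bdmeas (M1 \<Otimes>\<^sub>M M2) f \<Longrightarrow> integrable (M1 \<Otimes>\<^sub>M M2) f"
  by (rule bdmeas_integrable) unfold_locales

lemma integral_pair_fst:
  "bdmeas (M1 \<Otimes>\<^sub>M M2) k \<Longrightarrow> (\<integral>p. k p \<partial>(M1 \<Otimes>\<^sub>M M2)) = (\<integral>u. (\<integral>z. k (u, z) \<partial>M2) \<partial>M1)"
  by (rule integral_fst'[symmetric]) (rule integrable12)

lemma integral_pair_snd: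
  "bdmeas (M1 \<Otimes>\<^sub>M M2) k \<Longrightarrow> (\<integral>p. k p \<partial>(M1 \<Otimes>\<^sub>M M2)) = (\<integral>z. (\<integral>u. k (u, z) \<partial>M1) \<partial>M2)"
  using integral_snd[of "\<lambda>u z. k (u, z)"] integrable12[of k] by simp

lemma bdmeas_integral_snd:
  assumes k: "bdmeas (M1 \<Otimes>\<^sub>M M2) k"
  shows "bdmeas M1 (\<lambda>u. \<integral>z. k (u, z) \<partial>M2)"
proof -
  obtain B where B: "B \<ge> 0" "\<And>p. p \<in> space (M1 \<Otimes>\<^sub>M M2) \<Longrightarrow> norm (k p) \<le> B"
    using bdmeas_bound[OF k] by blast
  have [measurable]: "k \<in> borel_measurable (M1 \<Otimes>\<^sub>M M2)" by (rule bdmeas_measurable[OF assms])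
  show ?thesis
  proof (rule bdmeasI[where B=B])
    show "(\<lambda>u. \<integral>z. k (u, z) \<partial>M2) \<in> borel_measurable M1" by measurable
    fix u assume u: "u \<in> space M1"
    have "norm (\<integral>z. k (u, z) \<partial>M2) \<le> (\<integral>z. norm (k (u, z)) \<partial>M2)" by (rule integral_norm_bound)
    also have "\<dots> \<le> (\<integral>z. B \<partial>M2)"
      using B u by (intro integral_mono integrable2 bdmeas_norm bdmeas_section_snd[OF assms] bdmeas_const)
        (auto simp: space_pair_measure)
    finally show "norm (\<integral>z. k (u, z) \<partial>M2) \<le> B" by (simp add: M2.prob_space)
  qed
qed

lemma bdmeas_integral_fst:
  assumes k: "bdmeas (M1 \<Otimes>\<^sub>M M2) k"
  shows "bdmeas M2 (\<lambda>z. \<integral>u. k (u, z) \<partial>M1)"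
proof -
  obtain B where B: "B \<ge> 0" "\<And>p. p \<in> space (M1 \<Otimes>\<^sub>M M2) \<Longrightarrow> norm (k p) \<le> B"
    using bdmeas_bound[OF k] by blast
  have [measurable]: "k \<in> borel_measurable (M1 \<Otimes>\<^sub>M M2)" by (rule bdmeas_measurable[OF assms])
  show ?thesis
  proof (rule bdmeasI[where B=B])
    show "(\<lambda>z. \<integral>u. k (u, z) \<partial>M1) \<in> borel_measurable M2" by measurable
    fix z assume z: "z \<in> space M2"
    have "norm (\<integral>u. k (u, z) \<partial>M1) \<le> (\<integral>u. norm (k (u, z)) \<partial>M1)" by (rule integral_norm_bound)
    also have "\<dots> \<le> (\<integral>u. B \<partial>M1)"
      using B z by (intro integral_mono integrable1 bdmeas_norm bdmeas_section_fst[OF assms] bdmeas_const)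
        (auto simp: space_pair_measure)
    finally show "norm (\<integral>u. k (u, z) \<partial>M1) \<le> B" by (simp add: M1.prob_space)
  qed
qed

end

lemma (in prob_space) expectation_square_le:
  fixes f :: "_ \<Rightarrow> real"
  assumes "bdmeas M f"
  shows "(expectation f)\<^sup>2 \<le> expectation (\<lambda>x. (f x)\<^sup>2)"
proof -
  have "variance f = expectation (\<lambda>x. (f x)\<^sup>2) - (expectation f)\<^sup>2"
    by (rule variance_eq) (auto intro!: bdmeas_integrable bdmeas_intros assms finite_measure_axioms)
  moreover have "variance f \<ge> 0" by simp
  ultimately show ?thesis by simp
qed

lemma (in prob_space) exp_expectation_le:
  fixes f :: "_ \<Rightarrow> real"
  assumes "bdmeas M f"
  shows "exp (expectation f) \<le> expectation (\<lambda>x. exp (f x))"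
proof -
  have "exp (expectation f) = expectation (\<lambda>x. exp (expectation f) * (1 + (f x - expectation f)))"
    using bdmeas_integrable[OF finite_measure_axioms assms] by (simp add: prob_space)
  also have "\<dots> \<le> expectation (\<lambda>x. exp (f x))"
  proof (intro integral_mono bdmeas_integrable finite_measure_axioms bdmeas_intros assms)
    fix x
    have "exp (expectation f) * (1 + (f x - expectation f)) \<le> exp (expectation f) * exp (f x - expectation f)"
      by (intro mult_left_mono exp_ge_add_one_self) simp
    then show "exp (expectation f) * (1 + (f x - expectation f)) \<le> exp (f x)"
      by (simp flip: exp_add)
  qed
  finally show ?thesis .
qed

section \<open>Strong concavity of the dual objective\<close>

text \<open>The regularization parameter is normalized to \<open>1\<close>: potentials and cost are divided by \<open>\<epsilon>\<close>,
  and the step size becomes \<open>\<eta> / \<epsilon>\<close>.\<close>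

locale vector_sinkhorn = pair_prob_space \<mu> \<nu>
  for \<mu> :: "'u measure" and \<nu> :: "'z measure" +
  fixes X :: "'z \<Rightarrow> 'x::euclidean_space" and c :: "'u \<times> 'z \<Rightarrow> real" and M lam C :: real
  assumes X_measurable: "X \<in> borel_measurable \<nu>"
    and X_bound: "\<And>z. z \<in> space \<nu> \<Longrightarrow> norm (X z) \<le> M"
    and X_mean: "(\<integral>z. X z \<partial>\<nu>) = 0"
    and X_coercive: "\<And>v. lam * (norm v)\<^sup>2 \<le> (\<integral>z. (v \<bullet> X z)\<^sup>2 \<partial>\<nu>)"
    and lam_pos: "lam > 0" and M_pos: "M > 0"
    and c_measurable: "c \<in> borel_measurable (\<mu> \<Otimes>\<^sub>M \<nu>)"
    and c_bound: "\<And>p. p \<in> space (\<mu> \<Otimes>\<^sub>M \<nu>) \<Longrightarrow> \<bar>c p\<bar> \<le> C"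
begin

definition "\<phi> f g h p = f (fst p) + g (fst p) \<bullet> X (snd p) + h (snd p) - c p"

definition "K f g h p = exp (\<phi> f g h p)"

text \<open>The dual objective divided by the regularization parameter, in rescaled potentials;
  \<open>dual_objective_eq\<close> makes the link.\<close>

definition "J f g h = (\<integral>u. f u \<partial>\<mu>) + (\<integral>z. h z \<partial>\<nu>) - ((\<integral>p. K f g h p \<partial>(\<mu> \<Otimes>\<^sub>M \<nu>)) - 1)"

lemma bdmeas_X: "bdmeas \<nu> X"
  using X_measurable X_bound by (rule bdmeasI)

lemma bdmeas_c: "bdmeas (\<mu> \<Otimes>\<^sub>M \<nu>) c"
  using c_measurable c_bound by (intro bdmeasI) auto

lemma C_nonneg: "C \<ge> 0"
proof -
  obtain p where "p \<in> space (\<mu> \<Otimes>\<^sub>M \<nu>)" using P.not_empty by blast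
  then show ?thesis using c_bound[of p] by linarith
qed

lemmas bd = bdmeas_intros bdmeas_X bdmeas_c

lemma bdmeas_\<phi>: "bdmeas \<mu> f \<Longrightarrow> bdmeas \<mu> g \<Longrightarrow> bdmeas \<nu> h \<Longrightarrow> bdmeas (\<mu> \<Otimes>\<^sub>M \<nu>) (\<phi> f g h)"
  unfolding \<phi>_def by (intro bd)

lemma bdmeas_K: "bdmeas \<mu> f \<Longrightarrow> bdmeas \<mu> g \<Longrightarrow> bdmeas \<nu> h \<Longrightarrow> bdmeas (\<mu> \<Otimes>\<^sub>M \<nu>) (K f g h)"
  unfolding K_def by (intro bd bdmeas_\<phi>)

text \<open>Fubini, conditioning each term on the variable its coefficient depends on. For
  \<open>k = 1 - K\<close> the three inner integrals are the partial gradients of \<open>J\<close>,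
  and the identity describes its first-order term.\<close>

lemma integral_linear_mult:
  assumes [intro]: "bdmeas \<mu> a" "bdmeas \<mu> b" "bdmeas \<nu> e" and k[intro]: "bdmeas (\<mu> \<Otimes>\<^sub>M \<nu>) k"
  shows "(\<integral>p. (a (fst p) + b (fst p) \<bullet> X (snd p) + e (snd p)) * k p \<partial>(\<mu> \<Otimes>\<^sub>M \<nu>)) =
    (\<integral>u. a u * (\<integral>z. k (u, z) \<partial>\<nu>) \<partial>\<mu>) + (\<integral>u. b u \<bullet> (\<integral>z. k (u, z) *\<^sub>R X z \<partial>\<nu>) \<partial>\<mu>)
    + (\<integral>z. e z * (\<integral>u. k (u, z) \<partial>\<mu>) \<partial>\<nu>)"
proof -
  have "(\<integral>p. (a (fst p) + b (fst p) \<bullet> X (snd p) + e (snd p)) * k p \<partial>(\<mu> \<Otimes>\<^sub>M \<nu>)) =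
    (\<integral>p. a (fst p) * k p + b (fst p) \<bullet> (k p *\<^sub>R X (snd p)) + e (snd p) * k p \<partial>(\<mu> \<Otimes>\<^sub>M \<nu>))"
    by (intro Bochner_Integration.integral_cong) (auto simp: algebra_simps)
  also have "\<dots> = (\<integral>p. a (fst p) * k p \<partial>(\<mu> \<Otimes>\<^sub>M \<nu>)) + (\<integral>p. b (fst p) \<bullet> (k p *\<^sub>R X (snd p)) \<partial>(\<mu> \<Otimes>\<^sub>M \<nu>))
     + (\<integral>p. e (snd p) * k p \<partial>(\<mu> \<Otimes>\<^sub>M \<nu>))"
    by (subst Bochner_Integration.integral_add, (intro integrable12 bd assms)+)+ simp
  also have "(\<integral>p. a (fst p) * k p \<partial>(\<mu> \<Otimes>\<^sub>M \<nu>)) = (\<integral>u. a u * (\<integral>z. k (u, z) \<partial>\<nu>) \<partial>\<mu>)"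
    by (subst integral_pair_fst) (auto intro!: bd assms)
  also have "(\<integral>p. b (fst p) \<bullet> (k p *\<^sub>R X (snd p)) \<partial>(\<mu> \<Otimes>\<^sub>M \<nu>)) = (\<integral>u. b u \<bullet> (\<integral>z. k (u, z) *\<^sub>R X z \<partial>\<nu>) \<partial>\<mu>)"
    by (subst integral_pair_fst, intro bd assms, rule Bochner_Integration.integral_cong)
       (auto intro!: integral_inner_right integrable2 bd bdmeas_section_snd[OF k] simp del: inner_scaleR_right)
  also have "(\<integral>p. e (snd p) * k p \<partial>(\<mu> \<Otimes>\<^sub>M \<nu>)) = (\<integral>z. e z * (\<integral>u. k (u, z) \<partial>\<mu>) \<partial>\<nu>)"
    by (subst integral_pair_snd) (auto intro!: bd assms)
  finally show ?thesis .
qed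

lemma integral_linear:
  assumes "bdmeas \<mu> a" "bdmeas \<mu> b" "bdmeas \<nu> e"
  shows "(\<integral>p. a (fst p) + b (fst p) \<bullet> X (snd p) + e (snd p) \<partial>(\<mu> \<Otimes>\<^sub>M \<nu>)) = (\<integral>u. a u \<partial>\<mu>) + (\<integral>z. e z \<partial>\<nu>)"
  using integral_linear_mult[OF assms, of "\<lambda>_. 1"]
  by (simp add: bdmeas_const X_mean M1.prob_space M2.prob_space)

lemma \<phi>_diff:
  "\<phi> f1 g1 h1 p - \<phi> f0 g0 h0 p = (f1 (fst p) - f0 (fst p)) + (g1 (fst p) - g0 (fst p)) \<bullet> X (snd p) + (h1 (snd p) - h0 (snd p))"
  by (simp add: \<phi>_def algebra_simps)

text \<open>\<open>exp_strongly_convex\<close> is integrated pointwise. The gradients are those at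
  the base point \<open>(f0, g0, h0)\<close>, which is always chosen below so that some of them
  vanish by a marginal condition.\<close>

lemma J_strongly_concave:
  assumes 0: "bdmeas \<mu> f0" "bdmeas \<mu> g0" "bdmeas \<nu> h0" and 1: "bdmeas \<mu> f1" "bdmeas \<mu> g1" "bdmeas \<nu> h1"
    and B0: "\<And>p. p \<in> space (\<mu> \<Otimes>\<^sub>M \<nu>) \<Longrightarrow> \<bar>\<phi> f0 g0 h0 p\<bar> \<le> B"
    and B1: "\<And>p. p \<in> space (\<mu> \<Otimes>\<^sub>M \<nu>) \<Longrightarrow> \<bar>\<phi> f1 g1 h1 p\<bar> \<le> B"
  shows "J f1 g1 h1 - J f0 g0 h0 \<le>
     (\<integral>u. (f1 u - f0 u) * (1 - (\<integral>z. K f0 g0 h0 (u, z) \<partial>\<nu>)) \<partial>\<mu>)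
     - (\<integral>u. (g1 u - g0 u) \<bullet> (\<integral>z. K f0 g0 h0 (u, z) *\<^sub>R X z \<partial>\<nu>) \<partial>\<mu>)
     + (\<integral>z. (h1 z - h0 z) * (1 - (\<integral>u. K f0 g0 h0 (u, z) \<partial>\<mu>)) \<partial>\<nu>)
     - exp (- B) / 2 * (\<integral>p. (\<phi> f1 g1 h1 p - \<phi> f0 g0 h0 p)\<^sup>2 \<partial>(\<mu> \<Otimes>\<^sub>M \<nu>))"
proof -
  note K0 = bdmeas_K[OF 0] and K1 = bdmeas_K[OF 1] and ph0 = bdmeas_\<phi>[OF 0] and ph1 = bdmeas_\<phi>[OF 1]
  let ?k = "\<lambda>p. 1 - K f0 g0 h0 p"
  have k: "bdmeas (\<mu> \<Otimes>\<^sub>M \<nu>) ?k" by (intro bd K0)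
  \<comment> \<open>Mean zero of \<open>X\<close> is what makes the linear part of \<open>J\<close>,
    which has no term in \<open>g\<close>, agree with the integral of the exponent.\<close>
  have "(\<integral>p. (\<phi> f1 g1 h1 p - \<phi> f0 g0 h0 p) \<partial>(\<mu> \<Otimes>\<^sub>M \<nu>)) = (\<integral>u. f1 u - f0 u \<partial>\<mu>) + (\<integral>z. h1 z - h0 z \<partial>\<nu>)"
    unfolding \<phi>_diff by (intro integral_linear bd assms)
  also have "\<dots> = (\<integral>u. f1 u \<partial>\<mu>) - (\<integral>u. f0 u \<partial>\<mu>) + ((\<integral>z. h1 z \<partial>\<nu>) - (\<integral>z. h0 z \<partial>\<nu>))"
    using 0 1 by (simp add: integrable1 integrable2)
  finally have "J f1 g1 h1 - J f0 g0 h0 = (\<integral>p. (\<phi> f1 g1 h1 p - \<phi> f0 g0 h0 p) \<partial>(\<mu> \<Otimes>\<^sub>M \<nu>))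
     - ((\<integral>p. K f1 g1 h1 p \<partial>(\<mu> \<Otimes>\<^sub>M \<nu>)) - (\<integral>p. K f0 g0 h0 p \<partial>(\<mu> \<Otimes>\<^sub>M \<nu>)))"
    by (simp add: J_def)
  also have "\<dots> = (\<integral>p. (\<phi> f1 g1 h1 p - \<phi> f0 g0 h0 p) - (K f1 g1 h1 p - K f0 g0 h0 p) \<partial>(\<mu> \<Otimes>\<^sub>M \<nu>))"
    using integrable12[OF K0] integrable12[OF K1] integrable12[OF ph0] integrable12[OF ph1] by simp
  also have "\<dots> \<le> (\<integral>p. (\<phi> f1 g1 h1 p - \<phi> f0 g0 h0 p) * ?k p - exp (- B) / 2 * (\<phi> f1 g1 h1 p - \<phi> f0 g0 h0 p)\<^sup>2 \<partial>(\<mu> \<Otimes>\<^sub>M \<nu>))"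
  proof (intro integral_mono integrable12 bd K0 K1 ph0 ph1)
    fix p assume "p \<in> space (\<mu> \<Otimes>\<^sub>M \<nu>)"
    from exp_strongly_convex[OF B0[OF this] B1[OF this]]
    show "(\<phi> f1 g1 h1 p - \<phi> f0 g0 h0 p) - (K f1 g1 h1 p - K f0 g0 h0 p)
      \<le> (\<phi> f1 g1 h1 p - \<phi> f0 g0 h0 p) * ?k p - exp (- B) / 2 * (\<phi> f1 g1 h1 p - \<phi> f0 g0 h0 p)\<^sup>2"
      unfolding K_def by (simp add: algebra_simps)
  qed
  also have "\<dots> = (\<integral>p. (\<phi> f1 g1 h1 p - \<phi> f0 g0 h0 p) * ?k p \<partial>(\<mu> \<Otimes>\<^sub>M \<nu>))
     - (\<integral>p. exp (- B) / 2 * (\<phi> f1 g1 h1 p - \<phi> f0 g0 h0 p)\<^sup>2 \<partial>(\<mu> \<Otimes>\<^sub>M \<nu>))"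
    by (intro Bochner_Integration.integral_diff integrable12 bd K0 ph0 ph1)
  also have "(\<integral>p. (\<phi> f1 g1 h1 p - \<phi> f0 g0 h0 p) * ?k p \<partial>(\<mu> \<Otimes>\<^sub>M \<nu>)) =
      (\<integral>u. (f1 u - f0 u) * (\<integral>z. ?k (u, z) \<partial>\<nu>) \<partial>\<mu>)
     + (\<integral>u. (g1 u - g0 u) \<bullet> (\<integral>z. ?k (u, z) *\<^sub>R X z \<partial>\<nu>) \<partial>\<mu>)
     + (\<integral>z. (h1 z - h0 z) * (\<integral>u. ?k (u, z) \<partial>\<mu>) \<partial>\<nu>)"
    unfolding \<phi>_diff by (intro integral_linear_mult bd assms K0)
  also have "(\<integral>u. (f1 u - f0 u) * (\<integral>z. ?k (u, z) \<partial>\<nu>) \<partial>\<mu>) = (\<integral>u. (f1 u - f0 u) * (1 - (\<integral>z. K f0 g0 h0 (u, z) \<partial>\<nu>)) \<partial>\<mu>)"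
    by (intro Bochner_Integration.integral_cong refl)
       (simp add: integrable2 bdmeas_section_snd[OF K0] M2.prob_space)
  also have "(\<integral>u. (g1 u - g0 u) \<bullet> (\<integral>z. ?k (u, z) *\<^sub>R X z \<partial>\<nu>) \<partial>\<mu>) = (\<integral>u. - ((g1 u - g0 u) \<bullet> (\<integral>z. K f0 g0 h0 (u, z) *\<^sub>R X z \<partial>\<nu>)) \<partial>\<mu>)"
  proof (intro Bochner_Integration.integral_cong refl)
    fix u assume u: "u \<in> space \<mu>"
    have "(\<integral>z. ?k (u, z) *\<^sub>R X z \<partial>\<nu>) = (\<integral>z. X z - K f0 g0 h0 (u, z) *\<^sub>R X z \<partial>\<nu>)"
      by (simp add: algebra_simps)
    also have "\<dots> = (\<integral>z. X z \<partial>\<nu>) - (\<integral>z. K f0 g0 h0 (u, z) *\<^sub>R X z \<partial>\<nu>)"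
      using u by (intro Bochner_Integration.integral_diff integrable2 bd bdmeas_section_snd[OF K0])
    finally show "(g1 u - g0 u) \<bullet> (\<integral>z. ?k (u, z) *\<^sub>R X z \<partial>\<nu>) = - ((g1 u - g0 u) \<bullet> (\<integral>z. K f0 g0 h0 (u, z) *\<^sub>R X z \<partial>\<nu>))"
      by (simp add: X_mean)
  qed
  also have "(\<integral>z. (h1 z - h0 z) * (\<integral>u. ?k (u, z) \<partial>\<mu>) \<partial>\<nu>) = (\<integral>z. (h1 z - h0 z) * (1 - (\<integral>u. K f0 g0 h0 (u, z) \<partial>\<mu>)) \<partial>\<nu>)"
    by (intro Bochner_Integration.integral_cong refl)
       (simp add: integrable1 bdmeas_section_fst[OF K0] M1.prob_space)
  finally show ?thesis by simp
qed

text \<open>The three summands are pairwise orthogonal: \<open>a\<close> and \<open>e\<close>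
  because \<open>a\<close> is centred, \<open>a\<close> and b . X because \<open>X\<close> has mean
  zero, b . X and \<open>e\<close> because \<open>b\<close> is centred. Coercivity then bounds the
  middle square. Without centring the left side could vanish along the gauge directions.\<close>

lemma integral_linear_square_ge:
  assumes a: "bdmeas \<mu> a" "(\<integral>u. a u \<partial>\<mu>) = 0" and b: "bdmeas \<mu> b" "(\<integral>u. b u \<partial>\<mu>) = 0" and e: "bdmeas \<nu> e"
  shows "(\<integral>p. (a (fst p) + b (fst p) \<bullet> X (snd p) + e (snd p))\<^sup>2 \<partial>(\<mu> \<Otimes>\<^sub>M \<nu>)) \<ge>
    (\<integral>u. (a u)\<^sup>2 \<partial>\<mu>) + lam * (\<integral>u. (norm (b u))\<^sup>2 \<partial>\<mu>) + (\<integral>z. (e z)\<^sup>2 \<partial>\<nu>)"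
proof -
  let ?k = "\<lambda>p. a (fst p) + b (fst p) \<bullet> X (snd p) + e (snd p)"
  have k: "bdmeas (\<mu> \<Otimes>\<^sub>M \<nu>) ?k" by (intro bd a b e)
  have kz: "(\<integral>z. ?k (u, z) \<partial>\<nu>) = a u + (\<integral>z. e z \<partial>\<nu>)" for u
    using integrable2[OF bdmeas_X] integrable2[OF e] by (simp add: X_mean M2.prob_space)
  have ku: "(\<integral>u. ?k (u, z) \<partial>\<mu>) = e z" for z
    using integrable1[OF a(1)] integrable1[OF b(1)] by (simp add: a b M1.prob_space)
  let ?w = "\<integral>z. e z *\<^sub>R X z \<partial>\<nu>"
  have kX: "b u \<bullet> (\<integral>z. ?k (u, z) *\<^sub>R X z \<partial>\<nu>) = (\<integral>z. (b u \<bullet> X z)\<^sup>2 \<partial>\<nu>) + b u \<bullet> ?w" for u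
  proof -
    have "b u \<bullet> (\<integral>z. ?k (u, z) *\<^sub>R X z \<partial>\<nu>) = (\<integral>z. b u \<bullet> (?k (u, z) *\<^sub>R X z) \<partial>\<nu>)"
      by (rule integral_inner_right[symmetric], simp) (intro integrable2 bd e)
    also have "\<dots> = (\<integral>z. a u * (b u \<bullet> X z) + (b u \<bullet> X z)\<^sup>2 + b u \<bullet> (e z *\<^sub>R X z) \<partial>\<nu>)"
      by (simp add: algebra_simps power2_eq_square)
    also have "\<dots> = (\<integral>z. a u * (b u \<bullet> X z) \<partial>\<nu>) + (\<integral>z. (b u \<bullet> X z)\<^sup>2 \<partial>\<nu>) + (\<integral>z. b u \<bullet> (e z *\<^sub>R X z) \<partial>\<nu>)"
      by (subst Bochner_Integration.integral_add, (intro integrable2 bd e)+)+ simp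
    also have "(\<integral>z. a u * (b u \<bullet> X z) \<partial>\<nu>) = 0"
      using integrable2[OF bdmeas_X] by (simp add: X_mean)
    also have "(\<integral>z. b u \<bullet> (e z *\<^sub>R X z) \<partial>\<nu>) = b u \<bullet> ?w"
      by (rule integral_inner_right) (intro integrable2 bd e)
    finally show ?thesis by simp
  qed
  have Q: "bdmeas \<mu> (\<lambda>u. \<integral>z. (b u \<bullet> X z)\<^sup>2 \<partial>\<nu>)"
    using bdmeas_integral_snd[of "\<lambda>p. (b (fst p) \<bullet> X (snd p))\<^sup>2"] by (simp add: bd b)
  have "(\<integral>p. (?k p)\<^sup>2 \<partial>(\<mu> \<Otimes>\<^sub>M \<nu>)) = (\<integral>p. ?k p * ?k p \<partial>(\<mu> \<Otimes>\<^sub>M \<nu>))"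
    by (simp add: power2_eq_square)
  also have "\<dots> = (\<integral>u. a u * (a u + (\<integral>z. e z \<partial>\<nu>)) \<partial>\<mu>) + (\<integral>u. (\<integral>z. (b u \<bullet> X z)\<^sup>2 \<partial>\<nu>) + b u \<bullet> ?w \<partial>\<mu>) + (\<integral>z. e z * e z \<partial>\<nu>)"
    by (subst integral_linear_mult[OF a(1) b(1) e k]) (simp only: kz kX ku)
  also have "(\<integral>u. a u * (a u + (\<integral>z. e z \<partial>\<nu>)) \<partial>\<mu>) = (\<integral>u. (a u)\<^sup>2 \<partial>\<mu>)"
    using integrable1[OF a(1)] integrable1[OF bdmeas_power2[OF a(1)]]
    by (simp add: distrib_left a flip: power2_eq_square)
  also have "(\<integral>u. (\<integral>z. (b u \<bullet> X z)\<^sup>2 \<partial>\<nu>) + b u \<bullet> ?w \<partial>\<mu>) = (\<integral>u. (\<integral>z. (b u \<bullet> X z)\<^sup>2 \<partial>\<nu>) \<partial>\<mu>)"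
    using integrable1[OF Q] integrable1[OF b(1)] by (simp add: b)
  finally have "(\<integral>p. (?k p)\<^sup>2 \<partial>(\<mu> \<Otimes>\<^sub>M \<nu>)) =
    (\<integral>u. (a u)\<^sup>2 \<partial>\<mu>) + (\<integral>u. (\<integral>z. (b u \<bullet> X z)\<^sup>2 \<partial>\<nu>) \<partial>\<mu>) + (\<integral>z. (e z)\<^sup>2 \<partial>\<nu>)"
    by (simp add: power2_eq_square)
  moreover have "(\<integral>u. lam * (norm (b u))\<^sup>2 \<partial>\<mu>) \<le> (\<integral>u. (\<integral>z. (b u \<bullet> X z)\<^sup>2 \<partial>\<nu>) \<partial>\<mu>)"
    by (intro integral_mono integrable1 bd b Q X_coercive)
  ultimately show ?thesis by simp
qed

text \<open>This makes recentring free: the exponent does not change, \<open>a\<close> cancels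
  between the two integrals, and b . X integrates to zero.\<close>

lemma J_shift:
  assumes "bdmeas \<mu> f" "bdmeas \<mu> g" "bdmeas \<nu> h"
  shows "J (\<lambda>u. f u - a) (\<lambda>u. g u - b) (\<lambda>z. h z + a + b \<bullet> X z) = J f g h"
proof -
  have "K (\<lambda>u. f u - a) (\<lambda>u. g u - b) (\<lambda>z. h z + a + b \<bullet> X z) = K f g h"
    by (auto simp: K_def \<phi>_def fun_eq_iff algebra_simps)
  then show ?thesis
    using integrable1[OF assms(1)] integrable2[OF assms(3)] integrable2[OF bdmeas_X]
    by (simp add: J_def X_mean M1.prob_space M2.prob_space)
qed

lemma \<phi>_shift: "\<phi> (\<lambda>u. f u - a) (\<lambda>u. g u - b) (\<lambda>z. h z + a + b \<bullet> X z) = \<phi> f g h"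
  by (auto simp: \<phi>_def fun_eq_iff algebra_simps)

text \<open>Hoeffding's lemma under the law with density \<open>k\<close> is what makes every step size below
  \<open>2 / M\<^sup>2\<close> admissible.\<close>

lemma exp_moment_le:
  assumes "bdmeas \<nu> k" "\<And>z. z \<in> space \<nu> \<Longrightarrow> k z \<ge> 0" "(\<integral>z. k z \<partial>\<nu>) = 1" "s > 0"
    and d: "d = (\<integral>z. k z *\<^sub>R X z \<partial>\<nu>)"
  shows "(\<integral>z. k z * exp (- s * (d \<bullet> X z)) \<partial>\<nu>) \<le> exp (- (s * (1 - s * M\<^sup>2 / 2)) * (norm d)\<^sup>2)"
proof -
  define D where "D = density \<nu> k"
  have [measurable]: "k \<in> borel_measurable \<nu>" "X \<in> borel_measurable \<nu>"
    using assms(1) X_measurable by (auto dest: bdmeas_measurable)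
  have nn: "AE z in \<nu>. 0 \<le> k z" using assms(2) by auto
  have "emeasure D (space D) = (\<integral>\<^sup>+z. k z \<partial>\<nu>)"
    by (simp add: D_def emeasure_density cong: nn_integral_cong)
  also have "\<dots> = 1"
    using nn assms(3) by (subst nn_integral_eq_integral) (auto intro: integrable2 assms(1))
  finally interpret D: prob_space D by (rule prob_spaceI)
  let ?f = "\<lambda>z. - (d \<bullet> X z)"
  have bf: "norm (?f z) \<le> norm d * M" if "z \<in> space \<nu>" for z
  proof -
    have "\<bar>d \<bullet> X z\<bar> \<le> norm d * norm (X z)" by (rule Cauchy_Schwarz_ineq2)
    also have "\<dots> \<le> norm d * M" using X_bound[OF that] by (intro mult_left_mono) auto
    finally show ?thesis by simp
  qed
  interpret D: interval_bounded_random_variable D ?f "- (norm d * M)" "norm d * M"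
  proof
    show "?f \<in> borel_measurable D" by (simp add: D_def)
    show "AE z in D. ?f z \<in> {- (norm d * M)..norm d * M}"
      using bf by (intro AE_I2) (auto simp: D_def abs_le_iff)
  qed
  have f: "bdmeas \<nu> ?f" by (intro bd)
  have Ef: "D.expectation ?f = - (norm d)\<^sup>2"
  proof -
    have "D.expectation ?f = (\<integral>z. k z * ?f z \<partial>\<nu>)"
      unfolding D_def by (rule integral_real_density[OF _ nn]) auto
    also have "\<dots> = (\<integral>z. - (d \<bullet> (k z *\<^sub>R X z)) \<partial>\<nu>)" by simp
    also have "\<dots> = - (d \<bullet> d)"
      unfolding d using integrable2[OF bdmeas_scaleR[OF assms(1) bdmeas_X]] 
      by (subst integral_minus, subst integral_inner_right) auto
    finally show ?thesis by (simp add: dot_square_norm)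
  qed
  \<comment> \<open>Hoeffding is applied to the deviation from the mean - |d|^2. The range has
    length 2 |d| M, so its exponent s^2 (2 |d| M)^2 / 8 equals s^2 M^2 |d|^2 / 2; undoing the
    centring contributes - s |d|^2.\<close>
  let ?F = "\<lambda>z. exp (s * (?f z - - (norm d)\<^sup>2))"
  have "(\<integral>\<^sup>+z. ?F z \<partial>D) \<le> ennreal (exp (s\<^sup>2 * (norm d * M - - (norm d * M))\<^sup>2 / 8))"
    using D.Hoeffdings_lemma_nn_integral[OF assms(4)] unfolding Ef .
  moreover have "(\<integral>\<^sup>+z. ?F z \<partial>D) = ennreal (\<integral>z. k z * ?F z \<partial>\<nu>)"
  proof -
    have "(\<integral>\<^sup>+z. ?F z \<partial>D) = (\<integral>\<^sup>+z. ennreal (k z * ?F z) \<partial>\<nu>)"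
      unfolding D_def using nn by (subst nn_integral_density) (auto intro!: nn_integral_cong simp: ennreal_mult' assms(2))
    also have "\<dots> = ennreal (\<integral>z. k z * ?F z \<partial>\<nu>)"
      using nn by (intro nn_integral_eq_integral integrable2 bd f assms) auto
    finally show ?thesis .
  qed
  ultimately have "(\<integral>z. k z * ?F z \<partial>\<nu>) \<le> exp (s\<^sup>2 * (norm d * M - - (norm d * M))\<^sup>2 / 8)"
    by simp
  also have "(\<integral>z. k z * ?F z \<partial>\<nu>) = (\<integral>z. exp (s * (norm d)\<^sup>2) * (k z * exp (- s * (d \<bullet> X z))) \<partial>\<nu>)"
    by (intro Bochner_Integration.integral_cong refl) (simp add: algebra_simps exp_diff exp_minus divide_simps)
  also have "\<dots> = exp (s * (norm d)\<^sup>2) * (\<integral>z. k z * exp (- s * (d \<bullet> X z)) \<partial>\<nu>)" by simp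
  finally have "exp (- s * (norm d)\<^sup>2) * (exp (s * (norm d)\<^sup>2) * (\<integral>z. k z * exp (- s * (d \<bullet> X z)) \<partial>\<nu>))
     \<le> exp (- s * (norm d)\<^sup>2) * exp (s\<^sup>2 * (norm d * M - - (norm d * M))\<^sup>2 / 8)"
    by (intro mult_left_mono) auto
  also have "\<dots> = exp (- (s * (1 - s * M\<^sup>2 / 2)) * (norm d)\<^sup>2)"
    by (simp add: power2_eq_square algebra_simps flip: exp_add)
  finally show ?thesis
    by (simp add: mult.assoc[symmetric] flip: exp_add)
qed

lemma norm_conditional_mean_le:
  assumes "bdmeas \<nu> k" "\<And>z. z \<in> space \<nu> \<Longrightarrow> k z \<ge> 0" "(\<integral>z. k z \<partial>\<nu>) = 1"
  shows "norm (\<integral>z. k z *\<^sub>R X z \<partial>\<nu>) \<le> M"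
proof -
  have "norm (\<integral>z. k z *\<^sub>R X z \<partial>\<nu>) \<le> (\<integral>z. norm (k z *\<^sub>R X z) \<partial>\<nu>)" by (rule integral_norm_bound)
  also have "\<dots> \<le> (\<integral>z. k z * M \<partial>\<nu>)"
    using assms(2) X_bound by (intro integral_mono integrable2 bd assms(1)) (auto intro!: mult_left_mono)
  finally show ?thesis using assms(3) by simp
qed

text \<open>Moving \<open>g\<close> alone changes only the mass term of \<open>J\<close>, and over
  each \<open>u\<close> the new mass is the exponential moment of \<open>exp_moment_le\<close>, at
  most exp (- \<kappa> |d u|^2). For positive \<open>s\<close>, the condition
  \<open>s * M\<^sup>2 < 2\<close> says exactly that \<kappa> is positive.\<close>

lemma gradient_step_gain:
  assumes bm: "bdmeas \<mu> f" "bdmeas \<mu> g" "bdmeas \<nu> h"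
    and one: "\<And>u. u \<in> space \<mu> \<Longrightarrow> (\<integral>z. K f g h (u, z) \<partial>\<nu>) = 1"
    and s: "0 < s" "s * M\<^sup>2 < 2" and \<kappa>: "\<kappa> = s * (1 - s * M\<^sup>2 / 2)"
    and d: "bdmeas \<mu> d" "\<And>u. u \<in> space \<mu> \<Longrightarrow> d u = (\<integral>z. K f g h (u, z) *\<^sub>R X z \<partial>\<nu>)"
  shows "J f (\<lambda>u. g u - s *\<^sub>R d u) h - J f g h \<ge> \<kappa> / (1 + \<kappa> * M\<^sup>2) * (\<integral>u. (norm (d u))\<^sup>2 \<partial>\<mu>)"
proof -
  have \<kappa>_pos: "\<kappa> > 0" using s unfolding \<kappa> by (intro mult_pos_pos) auto
  note K = bdmeas_K[OF bm]
  let ?g = "\<lambda>u. g u - s *\<^sub>R d u"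
  have gm: "bdmeas \<mu> ?g" by (intro bd bm d)
  have Kg: "K f ?g h (u, z) = K f g h (u, z) * exp (- s * (d u \<bullet> X z))" for u z
    by (simp add: K_def \<phi>_def algebra_simps flip: exp_add)
  have "\<kappa> / (1 + \<kappa> * M\<^sup>2) * (norm (d u))\<^sup>2 \<le> (\<integral>z. K f g h (u, z) \<partial>\<nu>) - (\<integral>z. K f ?g h (u, z) \<partial>\<nu>)" if u: "u \<in> space \<mu>" for u
  proof -
    let ?y = "\<kappa> * (norm (d u))\<^sup>2"
    \<comment> \<open>The function 1 - exp (- y) has a linear lower bound only on bounded sets; the
      bound on \<open>d u\<close> allows y / (1 + y) to be replaced by y / (1 + \<kappa>
      M^2).\<close>
    have "norm (d u) \<le> M"
      unfolding d(2)[OF u] using u by (intro norm_conditional_mean_le bdmeas_section_snd[OF K] one) (auto simp: K_def)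
    then have "?y \<le> \<kappa> * M\<^sup>2" using \<kappa>_pos by (intro mult_left_mono power_mono) auto
    then have "?y / (1 + \<kappa> * M\<^sup>2) \<le> ?y / (1 + ?y)"
      using \<kappa>_pos by (intro divide_left_mono mult_pos_pos add_pos_nonneg) auto
    also have "?y / (1 + ?y) = 1 - inverse (1 + ?y)"
      using \<kappa>_pos by (simp add: field_simps add_nonneg_eq_0_iff)
    also have "\<dots> \<le> 1 - inverse (exp ?y)"
      using \<kappa>_pos by (intro diff_mono order_refl le_imp_inverse_le exp_ge_add_one_self add_pos_nonneg) auto
    also have "\<dots> = 1 - exp (- ?y)" by (simp add: exp_minus)
    also have "\<dots> \<le> 1 - (\<integral>z. K f ?g h (u, z) \<partial>\<nu>)"
      using exp_moment_le[OF bdmeas_section_snd[OF K u] _ one[OF u] s(1) d(2)[OF u]]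
      unfolding Kg \<kappa> by (auto simp: K_def)
    finally show ?thesis using one[OF u] by simp
  qed
  then have "(\<integral>u. \<kappa> / (1 + \<kappa> * M\<^sup>2) * (norm (d u))\<^sup>2 \<partial>\<mu>) \<le> (\<integral>u. (\<integral>z. K f g h (u, z) \<partial>\<nu>) - (\<integral>z. K f ?g h (u, z) \<partial>\<nu>) \<partial>\<mu>)"
    by (intro integral_mono integrable1 bd d bdmeas_integral_snd bdmeas_K bm gm) auto
  also have "\<dots> = (\<integral>u. (\<integral>z. K f g h (u, z) \<partial>\<nu>) \<partial>\<mu>) - (\<integral>u. (\<integral>z. K f ?g h (u, z) \<partial>\<nu>) \<partial>\<mu>)"
    by (intro Bochner_Integration.integral_diff integrable1 bdmeas_integral_snd bdmeas_K bm gm)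
  also have "\<dots> = J f ?g h - J f g h"
    unfolding J_def by (subst (1 2) integral_pair_fst) (auto intro!: bdmeas_K bm gm)
  finally show ?thesis by simp
qed

end

section \<open>Gains of the updates and the optimality gap\<close>

lemma (in prob_space) expectation_exp_bounds:
  fixes w :: "'a \<Rightarrow> real"
  assumes "bdmeas M w"
  shows "(\<And>x. x \<in> space M \<Longrightarrow> a \<le> w x) \<Longrightarrow> exp a \<le> expectation (\<lambda>x. exp (w x))"
    and "(\<And>x. x \<in> space M \<Longrightarrow> w x \<le> b) \<Longrightarrow> expectation (\<lambda>x. exp (w x)) \<le> exp b"
proof -
  assume "\<And>x. x \<in> space M \<Longrightarrow> a \<le> w x"
  then have "expectation (\<lambda>_. exp a) \<le> expectation (\<lambda>x. exp (w x))"
    by (intro integral_mono bdmeas_integrable finite_measure_axioms bdmeas_intros assms) auto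
  then show "exp a \<le> expectation (\<lambda>x. exp (w x))" by (simp add: prob_space)
next
  assume "\<And>x. x \<in> space M \<Longrightarrow> w x \<le> b"
  then have "expectation (\<lambda>x. exp (w x)) \<le> expectation (\<lambda>_. exp b)"
    by (intro integral_mono bdmeas_integrable finite_measure_axioms bdmeas_intros assms) auto
  then show "expectation (\<lambda>x. exp (w x)) \<le> exp b" by (simp add: prob_space)
qed

lemma (in prob_space) expectation_exp_pos:
  fixes w :: "'a \<Rightarrow> real"
  assumes "bdmeas M w"
  shows "expectation (\<lambda>x. exp (w x)) > 0"
  using exp_expectation_le[OF assms] by (rule less_le_trans[OF exp_gt_zero])

context pair_prob_space
begin

lemma bdmeas_ln_integral_exp_snd:
  fixes w :: "_ \<Rightarrow> real"
  assumes w: "bdmeas (M1 \<Otimes>\<^sub>M M2) w"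
  shows "bdmeas M1 (\<lambda>u. ln (\<integral>z. exp (w (u, z)) \<partial>M2))"
proof -
  obtain B where B: "B \<ge> 0" "\<And>p. p \<in> space (M1 \<Otimes>\<^sub>M M2) \<Longrightarrow> norm (w p) \<le> B"
    using bdmeas_bound[OF w] by blast
  show ?thesis
  proof (rule bdmeas_ln[where \<delta>="exp (- B)"])
    show "bdmeas M1 (\<lambda>u. \<integral>z. exp (w (u, z)) \<partial>M2)"
      by (rule bdmeas_integral_snd) (intro bdmeas_intros w)
    show "exp (- B) \<le> (\<integral>z. exp (w (u, z)) \<partial>M2)" if "u \<in> space M1" for u
    proof (rule M2.expectation_exp_bounds(1)[OF bdmeas_section_snd[OF w that]])
      show "- B \<le> w (u, z)" if "z \<in> space M2" for z
        using B(2)[of "(u, z)"] \<open>u \<in> space M1\<close> that by (simp add: space_pair_measure abs_le_iff)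
    qed
  qed simp
qed

lemma bdmeas_ln_integral_exp_fst:
  fixes w :: "_ \<Rightarrow> real"
  assumes w: "bdmeas (M1 \<Otimes>\<^sub>M M2) w"
  shows "bdmeas M2 (\<lambda>z. ln (\<integral>u. exp (w (u, z)) \<partial>M1))"
proof -
  obtain B where B: "B \<ge> 0" "\<And>p. p \<in> space (M1 \<Otimes>\<^sub>M M2) \<Longrightarrow> norm (w p) \<le> B"
    using bdmeas_bound[OF w] by blast
  show ?thesis
  proof (rule bdmeas_ln[where \<delta>="exp (- B)"])
    show "bdmeas M2 (\<lambda>z. \<integral>u. exp (w (u, z)) \<partial>M1)"
      by (rule bdmeas_integral_fst) (intro bdmeas_intros w)
    show "exp (- B) \<le> (\<integral>u. exp (w (u, z)) \<partial>M1)" if "z \<in> space M2" for z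
    proof (rule M1.expectation_exp_bounds(1)[OF bdmeas_section_fst[OF w that]])
      show "- B \<le> w (u, z)" if "u \<in> space M1" for u
        using B(2)[of "(u, z)"] \<open>z \<in> space M2\<close> that by (simp add: space_pair_measure abs_le_iff)
    qed
  qed simp
qed

end

context vector_sinkhorn
begin

text \<open>Minus the logarithm of a partition function: the value of \<open>h\<close> that gives
  the coupling mass one over \<open>z\<close>. Likewise \<open>fup\<close> over \<open>u\<close>.
  Both solve the first-order condition of \<open>J\<close> in their own potential.\<close>

definition "hup f g z = - ln (\<integral>u. exp (f u + g u \<bullet> X z - c (u, z)) \<partial>\<mu>)"

definition "fup g h u = - ln (\<integral>z. exp (g u \<bullet> X z + h z - c (u, z)) \<partial>\<nu>)"

text \<open>Minus the gradient of \<open>J\<close> in \<open>g\<close>, taken after the update of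
  \<open>f\<close>: there the mass over each \<open>u\<close> is one, so this is a conditional mean
  of \<open>X\<close> (see \<open>dg_eq\<close>).\<close>

definition "dg g h u = exp (fup g h u) *\<^sub>R (\<integral>z. exp (g u \<bullet> X z + h z - c (u, z)) *\<^sub>R X z \<partial>\<nu>)"

lemma bdmeas_hup_exponent:
  "bdmeas \<mu> f \<Longrightarrow> bdmeas \<mu> g \<Longrightarrow> bdmeas (\<mu> \<Otimes>\<^sub>M \<nu>) (\<lambda>p. f (fst p) + g (fst p) \<bullet> X (snd p) - c p)"
  by (intro bd)

lemma bdmeas_fup_exponent:
  "bdmeas \<mu> g \<Longrightarrow> bdmeas \<nu> h \<Longrightarrow> bdmeas (\<mu> \<Otimes>\<^sub>M \<nu>) (\<lambda>p. g (fst p) \<bullet> X (snd p) + h (snd p) - c p)"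
  by (intro bd)

lemma bdmeas_hup: "bdmeas \<mu> f \<Longrightarrow> bdmeas \<mu> g \<Longrightarrow> bdmeas \<nu> (hup f g)"
  using bdmeas_uminus[OF bdmeas_ln_integral_exp_fst[OF bdmeas_hup_exponent]]
  by (simp add: hup_def[abs_def])

lemma bdmeas_fup: "bdmeas \<mu> g \<Longrightarrow> bdmeas \<nu> h \<Longrightarrow> bdmeas \<mu> (fup g h)"
  using bdmeas_uminus[OF bdmeas_ln_integral_exp_snd[OF bdmeas_fup_exponent]]
  by (simp add: fup_def[abs_def])

lemma hup_marginal:
  assumes "bdmeas \<mu> f" "bdmeas \<mu> g" "z \<in> space \<nu>"
  shows "(\<integral>u. K f g (hup f g) (u, z) \<partial>\<mu>) = 1"
proof -
  have "bdmeas \<mu> (\<lambda>u. f u + g u \<bullet> X z - c (u, z))"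
    using bdmeas_section_fst[OF bdmeas_hup_exponent[OF assms(1,2)] assms(3)] by simp
  then have "exp (hup f g z) * (\<integral>u. exp (f u + g u \<bullet> X z - c (u, z)) \<partial>\<mu>) = 1"
    using M1.expectation_exp_pos by (fastforce simp: hup_def exp_minus)
  moreover have "K f g (hup f g) (u, z) = exp (hup f g z) * exp (f u + g u \<bullet> X z - c (u, z))" for u
    by (simp add: K_def \<phi>_def algebra_simps flip: exp_add)
  ultimately show ?thesis by simp
qed

lemma fup_marginal:
  assumes "bdmeas \<mu> g" "bdmeas \<nu> h" "u \<in> space \<mu>"
  shows "(\<integral>z. K (fup g h) g h (u, z) \<partial>\<nu>) = 1"
proof -
  have "bdmeas \<nu> (\<lambda>z. g u \<bullet> X z + h z - c (u, z))"
    using bdmeas_section_snd[OF bdmeas_fup_exponent[OF assms(1,2)] assms(3)] by simp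
  then have "exp (fup g h u) * (\<integral>z. exp (g u \<bullet> X z + h z - c (u, z)) \<partial>\<nu>) = 1"
    using M2.expectation_exp_pos by (fastforce simp: fup_def exp_minus)
  moreover have "K (fup g h) g h (u, z) = exp (fup g h u) * exp (g u \<bullet> X z + h z - c (u, z))" for z
    by (simp add: K_def \<phi>_def algebra_simps flip: exp_add)
  ultimately show ?thesis by simp
qed

lemma dg_eq: "dg g h u = (\<integral>z. K (fup g h) g h (u, z) *\<^sub>R X z \<partial>\<nu>)"
proof -
  have "K (fup g h) g h (u, z) *\<^sub>R X z = exp (fup g h u) *\<^sub>R (exp (g u \<bullet> X z + h z - c (u, z)) *\<^sub>R X z)" for z
    by (simp add: K_def \<phi>_def algebra_simps flip: exp_add)
  then show ?thesis by (simp only: dg_def integral_scaleR_right)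
qed

lemma bdmeas_dg: "bdmeas \<mu> g \<Longrightarrow> bdmeas \<nu> h \<Longrightarrow> bdmeas \<mu> (dg g h)"
  unfolding dg_eq[abs_def]
  using bdmeas_integral_snd[of "\<lambda>p. K (fup g h) g h p *\<^sub>R X (snd p)"]
  by (simp add: bd bdmeas_K bdmeas_fup)

lemma norm_dg_le: "bdmeas \<mu> g \<Longrightarrow> bdmeas \<nu> h \<Longrightarrow> u \<in> space \<mu> \<Longrightarrow> norm (dg g h u) \<le> M"
  unfolding dg_eq
  by (intro norm_conditional_mean_le fup_marginal bdmeas_section_snd[OF bdmeas_K] bdmeas_fup) (auto simp: K_def)

text \<open>Strong concavity is based at the updated triple, whose gradient in \<open>h\<close>
  vanishes by \<open>hup_marginal\<close>, while \<open>f\<close> and \<open>g\<close> do not move.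
  The exponent bounds may depend on the functions, because only the sign of the quadratic term
  matters.\<close>

lemma J_hup_ge:
  assumes bm: "bdmeas \<mu> f" "bdmeas \<mu> g" "bdmeas \<nu> h"
  shows "J f g h \<le> J f g (hup f g)"
proof -
  have hm: "bdmeas \<nu> (hup f g)" by (intro bdmeas_hup bm)
  obtain B0 where B0: "\<And>p. p \<in> space (\<mu> \<Otimes>\<^sub>M \<nu>) \<Longrightarrow> norm (\<phi> f g (hup f g) p) \<le> B0"
    using bdmeas_bound[OF bdmeas_\<phi>[OF bm(1,2) hm]] by blast
  obtain B1 where B1: "\<And>p. p \<in> space (\<mu> \<Otimes>\<^sub>M \<nu>) \<Longrightarrow> norm (\<phi> f g h p) \<le> B1"
    using bdmeas_bound[OF bdmeas_\<phi>[OF bm]] by blast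
  have z: "(\<integral>z. (h z - hup f g z) * (1 - (\<integral>u. K f g (hup f g) (u, z) \<partial>\<mu>)) \<partial>\<nu>) = (\<integral>z. 0 \<partial>\<nu>)"
    by (intro Bochner_Integration.integral_cong refl) (simp add: hup_marginal bm)
  have sq: "0 \<le> exp (- max B0 B1) / 2 * (\<integral>p. (\<phi> f g h p - \<phi> f g (hup f g) p)\<^sup>2 \<partial>(\<mu> \<Otimes>\<^sub>M \<nu>))"
    by (intro mult_nonneg_nonneg integral_nonneg) auto
  have "J f g h - J f g (hup f g) \<le> - (exp (- max B0 B1) / 2 * (\<integral>p. (\<phi> f g h p - \<phi> f g (hup f g) p)\<^sup>2 \<partial>(\<mu> \<Otimes>\<^sub>M \<nu>)))"
    using J_strongly_concave[OF bm(1,2) hm bm, of "max B0 B1"] B0 B1 unfolding z by (auto simp: le_max_iff_disj)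
  then show ?thesis using sq by linarith
qed

text \<open>The base point is again the updated one, but now the quadratic loss is kept: the
  exponents differ by the change of \<open>f\<close> alone, so the loss is the gain. Here
  \<open>B\<close> enters the constant, and a rate requires it to be uniform.\<close>

lemma J_fup_gain:
  assumes bm: "bdmeas \<mu> f" "bdmeas \<mu> g" "bdmeas \<nu> h"
    and B0: "\<And>p. p \<in> space (\<mu> \<Otimes>\<^sub>M \<nu>) \<Longrightarrow> \<bar>\<phi> (fup g h) g h p\<bar> \<le> B"
    and B1: "\<And>p. p \<in> space (\<mu> \<Otimes>\<^sub>M \<nu>) \<Longrightarrow> \<bar>\<phi> f g h p\<bar> \<le> B"
  shows "J (fup g h) g h - J f g h \<ge> exp (- B) / 2 * (\<integral>u. (fup g h u - f u)\<^sup>2 \<partial>\<mu>)"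
proof -
  have fm: "bdmeas \<mu> (fup g h)" by (intro bdmeas_fup bm)
  have z: "(\<integral>u. (f u - fup g h u) * (1 - (\<integral>z. K (fup g h) g h (u, z) \<partial>\<nu>)) \<partial>\<mu>) = (\<integral>u. 0 \<partial>\<mu>)"
    by (intro Bochner_Integration.integral_cong refl) (simp add: fup_marginal bm)
  have "(\<integral>p. (\<phi> f g h p - \<phi> (fup g h) g h p)\<^sup>2 \<partial>(\<mu> \<Otimes>\<^sub>M \<nu>)) = (\<integral>p. (fup g h (fst p) - f (fst p))\<^sup>2 \<partial>(\<mu> \<Otimes>\<^sub>M \<nu>))"
    by (simp add: \<phi>_diff power2_commute)
  also have "\<dots> = (\<integral>u. (fup g h u - f u)\<^sup>2 \<partial>\<mu>)"
    by (subst integral_pair_fst) (auto intro!: bd bm fm simp: M2.prob_space)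
  finally show ?thesis
    using J_strongly_concave[OF fm bm(2,3) bm B0 B1] unfolding z by simp
qed

lemma J_fup_ge:
  assumes bm: "bdmeas \<mu> f" "bdmeas \<mu> g" "bdmeas \<nu> h"
  shows "J f g h \<le> J (fup g h) g h"
proof -
  have fm: "bdmeas \<mu> (fup g h)" by (intro bdmeas_fup bm)
  obtain B0 where B0: "\<And>p. p \<in> space (\<mu> \<Otimes>\<^sub>M \<nu>) \<Longrightarrow> norm (\<phi> (fup g h) g h p) \<le> B0"
    using bdmeas_bound[OF bdmeas_\<phi>[OF fm bm(2,3)]] by blast
  obtain B1 where B1: "\<And>p. p \<in> space (\<mu> \<Otimes>\<^sub>M \<nu>) \<Longrightarrow> norm (\<phi> f g h p) \<le> B1"
    using bdmeas_bound[OF bdmeas_\<phi>[OF bm]] by blast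
  have "0 \<le> exp (- max B0 B1) / 2 * (\<integral>u. (fup g h u - f u)\<^sup>2 \<partial>\<mu>)"
    by (intro mult_nonneg_nonneg integral_nonneg) auto
  also have "\<dots> \<le> J (fup g h) g h - J f g h"
    using B0 B1 by (intro J_fup_gain bm) (auto simp: le_max_iff_disj)
  finally show ?thesis by simp
qed

text \<open>With \<open>f\<close> in place of \<open>f'\<close> the mass over \<open>z\<close> is
  one, so the defect is a \<open>K\<close>-weighted integral of 1 - exp (f' - f). Exponents within
  \<open>B\<close> give |f' - f| <= 2 B; in the factor 6, the square of \<open>K\<close> contributes
  2 and \<open>exp_minus_one_sq_le\<close> contributes 4.\<close>

lemma hup_mass_defect:
  assumes bm: "bdmeas \<mu> f" "bdmeas \<mu> g" "bdmeas \<mu> f'" and z: "z \<in> space \<nu>"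
    and B0: "\<And>p. p \<in> space (\<mu> \<Otimes>\<^sub>M \<nu>) \<Longrightarrow> \<bar>\<phi> f' g (hup f g) p\<bar> \<le> B"
    and B1: "\<And>p. p \<in> space (\<mu> \<Otimes>\<^sub>M \<nu>) \<Longrightarrow> \<bar>\<phi> f g (hup f g) p\<bar> \<le> B"
  shows "(1 - (\<integral>u. K f' g (hup f g) (u, z) \<partial>\<mu>))\<^sup>2 \<le> exp (6 * B) * (\<integral>u. (f' u - f u)\<^sup>2 \<partial>\<mu>)"
proof -
  let ?h = "hup f g"
  have hm: "bdmeas \<nu> ?h" by (intro bdmeas_hup bm)
  note sect = bdmeas_section_fst[OF bdmeas_K z]
  let ?w = "\<lambda>u. K f g ?h (u, z) * (1 - exp (f' u - f u))"
  have w: "bdmeas \<mu> ?w" by (intro bd sect[OF bm(1,2) hm] bm)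
  have "?w u = K f g ?h (u, z) - K f' g ?h (u, z)" for u
    by (simp add: K_def \<phi>_def algebra_simps flip: exp_add)
  then have "1 - (\<integral>u. K f' g ?h (u, z) \<partial>\<mu>) = (\<integral>u. ?w u \<partial>\<mu>)"
    using integrable1[OF sect[OF bm(1,2) hm]] integrable1[OF sect[OF bm(3,2) hm]] hup_marginal[OF bm(1,2) z]
    by simp
  then have "(1 - (\<integral>u. K f' g ?h (u, z) \<partial>\<mu>))\<^sup>2 \<le> (\<integral>u. (?w u)\<^sup>2 \<partial>\<mu>)"
    using M1.expectation_square_le[OF w] by simp
  also have "\<dots> \<le> (\<integral>u. exp (6 * B) * (f' u - f u)\<^sup>2 \<partial>\<mu>)"
  proof (intro integral_mono integrable1 bd sect[OF bm(1,2) hm] bm)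
    fix u assume u: "u \<in> space \<mu>"
    then have p: "(u, z) \<in> space (\<mu> \<Otimes>\<^sub>M \<nu>)" using z by (simp add: space_pair_measure)
    have "K f g ?h (u, z) \<le> exp B"
      using B1[OF p] by (simp add: K_def)
    then have "(K f g ?h (u, z))\<^sup>2 \<le> (exp B)\<^sup>2" by (intro power_mono) (auto simp: K_def)
    moreover have "(exp (f' u - f u) - 1)\<^sup>2 \<le> exp (2 * (2 * B)) * (f' u - f u)\<^sup>2"
      using B0[OF p] B1[OF p] \<phi>_diff[of f' g ?h "(u, z)" f g ?h] by (intro exp_minus_one_sq_le) auto
    ultimately have "(K f g ?h (u, z))\<^sup>2 * (exp (f' u - f u) - 1)\<^sup>2 \<le> (exp B)\<^sup>2 * (exp (2 * (2 * B)) * (f' u - f u)\<^sup>2)"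
      by (intro mult_mono) auto
    then show "(?w u)\<^sup>2 \<le> exp (6 * B) * (f' u - f u)\<^sup>2"
      by (simp add: power_mult_distrib power2_commute[of 1] mult.assoc[symmetric] flip: exp_double exp_add)
  qed
  finally show ?thesis by simp
qed

text \<open>Strong concavity from \<open>(f', g, h)\<close> towards the optimum. There the gradient
  in \<open>f\<close> vanishes, the one in \<open>g\<close> is \<open>dg\<close> up to sign, and the
  one in \<open>h\<close> is the mass defect; \<open>young_inner\<close> trades the last two against
  the quadratic losses in \<open>g\<close> and \<open>h\<close>. With \<alpha> = exp (- B) / 2, the
  factors 1 / (4 \<alpha> lam) and exp (6 B) / (4 \<alpha>) become the stated constants.\<close>

lemma gap_le_gains:
  assumes bm: "bdmeas \<mu> f" "bdmeas \<mu> g" and bar: "bdmeas \<mu> fb" "bdmeas \<mu> gb" "bdmeas \<nu> hb"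
    and centred: "(\<integral>u. g u \<partial>\<mu>) = 0" "(\<integral>u. fb u \<partial>\<mu>) = 0" "(\<integral>u. gb u \<partial>\<mu>) = 0"
    and h: "h = hup f g" and f': "f' = fup g h"
    and B0: "\<And>p. p \<in> space (\<mu> \<Otimes>\<^sub>M \<nu>) \<Longrightarrow> \<bar>\<phi> f' g h p\<bar> \<le> B"
    and B1: "\<And>p. p \<in> space (\<mu> \<Otimes>\<^sub>M \<nu>) \<Longrightarrow> \<bar>\<phi> f g h p\<bar> \<le> B"
    and B2: "\<And>p. p \<in> space (\<mu> \<Otimes>\<^sub>M \<nu>) \<Longrightarrow> \<bar>\<phi> fb gb hb p\<bar> \<le> B"
  shows "J fb gb hb - J f' g h \<le> exp B / (2 * lam) * (\<integral>u. (norm (dg g h u))\<^sup>2 \<partial>\<mu>)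
     + exp (7 * B) / 2 * (\<integral>u. (f' u - f u)\<^sup>2 \<partial>\<mu>)"
proof -
  define \<alpha> where "\<alpha> = exp (- B) / 2"
  have \<alpha>: "\<alpha> > 0" by (simp add: \<alpha>_def)
  have hm: "bdmeas \<nu> h" unfolding h by (intro bdmeas_hup bm)
  have fm: "bdmeas \<mu> f'" unfolding f' by (intro bdmeas_fup bm hm)
  note dm = bdmeas_dg[OF bm(2) hm]
  \<comment> \<open>Orthogonality needs a centred difference, but \<open>f'\<close> is not centred.
    Its mean is moved into \<open>h\<close>, which changes neither the exponent nor
    \<open>J\<close>.\<close>
  define a where "a = (\<integral>u. f' u \<partial>\<mu>)"
  define f0 where "f0 = (\<lambda>u. f' u - a)"
  define h0 where "h0 = (\<lambda>z. h z + a)"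
  have f0m: "bdmeas \<mu> f0" and h0m: "bdmeas \<nu> h0" unfolding f0_def h0_def by (intro bd fm hm)+
  have J0: "J f0 g h0 = J f' g h" and \<phi>0: "\<phi> f0 g h0 = \<phi> f' g h"
    using J_shift[OF fm bm(2) hm, of a 0] \<phi>_shift[of f' a g 0 h] by (simp_all add: f0_def h0_def)
  have K0: "K f0 g h0 = K f' g h" by (simp add: K_def[abs_def] \<phi>0)
  define m where "m z = 1 - (\<integral>u. K f' g h (u, z) \<partial>\<mu>)" for z
  have mm: "bdmeas \<nu> m" unfolding m_def by (intro bd bdmeas_integral_fst bdmeas_K fm bm hm)
  have m_le: "(m z)\<^sup>2 \<le> exp (6 * B) * (\<integral>u. (f' u - f u)\<^sup>2 \<partial>\<mu>)" if "z \<in> space \<nu>" for z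
    unfolding m_def h using that B0 B1 by (intro hup_mass_defect bm fm) (auto simp: h)
  have z: "(\<integral>u. (fb u - f0 u) * (1 - (\<integral>z. K f' g h (u, z) \<partial>\<nu>)) \<partial>\<mu>) = (\<integral>u. 0 \<partial>\<mu>)"
    unfolding f' by (intro Bochner_Integration.integral_cong refl) (simp add: fup_marginal bm hm)
  have f0c: "(\<integral>u. fb u - f0 u \<partial>\<mu>) = 0" "(\<integral>u. gb u - g u \<partial>\<mu>) = 0"
    using integrable1[OF fm] integrable1[OF bm(2)] integrable1[OF bar(1)] integrable1[OF bar(2)] centred
    by (simp_all add: f0_def a_def M1.prob_space)
  have "J fb gb hb - J f' g h \<le>
     - (\<integral>u. (gb u - g u) \<bullet> dg g h u \<partial>\<mu>) + (\<integral>z. (hb z - h0 z) * m z \<partial>\<nu>)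
     - \<alpha> * (\<integral>p. (\<phi> fb gb hb p - \<phi> f' g h p)\<^sup>2 \<partial>(\<mu> \<Otimes>\<^sub>M \<nu>))"
    using J_strongly_concave[OF f0m bm(2) h0m bar, of B] B0 B2
    unfolding J0 \<phi>0 K0 z dg_eq f'[symmetric] m_def[symmetric] \<alpha>_def by simp
  moreover have "\<alpha> * (\<integral>p. (\<phi> fb gb hb p - \<phi> f' g h p)\<^sup>2 \<partial>(\<mu> \<Otimes>\<^sub>M \<nu>)) \<ge> \<alpha> * (0 + lam * (\<integral>u. (norm (gb u - g u))\<^sup>2 \<partial>\<mu>) + (\<integral>z. (hb z - h0 z)\<^sup>2 \<partial>\<nu>))"
  proof (rule mult_left_mono)
    \<comment> \<open>The loss in \<open>f\<close> is given away, as there is no first-order term in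
      \<open>f\<close> to absorb.\<close>
    have "0 \<le> (\<integral>u. (fb u - f0 u)\<^sup>2 \<partial>\<mu>)" by simp
    then show "0 + lam * (\<integral>u. (norm (gb u - g u))\<^sup>2 \<partial>\<mu>) + (\<integral>z. (hb z - h0 z)\<^sup>2 \<partial>\<nu>) \<le> (\<integral>p. (\<phi> fb gb hb p - \<phi> f' g h p)\<^sup>2 \<partial>(\<mu> \<Otimes>\<^sub>M \<nu>))"
      using integral_linear_square_ge[OF bdmeas_diff[OF bar(1) f0m] f0c(1) bdmeas_diff[OF bar(2) bm(2)] f0c(2) bdmeas_diff[OF bar(3) h0m]]
      unfolding \<phi>0[symmetric] \<phi>_diff by linarith
  qed (use \<alpha> in simp)
  moreover have "- (\<integral>u. (gb u - g u) \<bullet> dg g h u \<partial>\<mu>) - \<alpha> * lam * (\<integral>u. (norm (gb u - g u))\<^sup>2 \<partial>\<mu>) \<le> (\<integral>u. (norm (dg g h u))\<^sup>2 \<partial>\<mu>) / (4 * (\<alpha> * lam))"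
  proof -
    have i1: "integrable \<mu> (\<lambda>u. (gb u - g u) \<bullet> dg g h u)" and i2: "integrable \<mu> (\<lambda>u. (norm (gb u - g u))\<^sup>2)"
      by (intro integrable1 bd bar bm dm)+
    have "- (\<integral>u. (gb u - g u) \<bullet> dg g h u \<partial>\<mu>) - \<alpha> * lam * (\<integral>u. (norm (gb u - g u))\<^sup>2 \<partial>\<mu>)
        = (\<integral>u. - ((gb u - g u) \<bullet> dg g h u) - \<alpha> * lam * (norm (gb u - g u))\<^sup>2 \<partial>\<mu>)"
      using i1 i2 by simp
    also have "\<dots> \<le> (\<integral>u. (norm (dg g h u))\<^sup>2 / (4 * (\<alpha> * lam)) \<partial>\<mu>)"
      using bdmeas_mult[OF bdmeas_const[of _ "1 / (4 * (\<alpha> * lam))"] bdmeas_power2[OF bdmeas_norm[OF dm]]]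
      by (intro integral_mono young_inner integrable1 bd bar bm dm) (use \<alpha> lam_pos in auto)
    finally show ?thesis by simp
  qed
  moreover have "(\<integral>z. (hb z - h0 z) * m z \<partial>\<nu>) - \<alpha> * (\<integral>z. (hb z - h0 z)\<^sup>2 \<partial>\<nu>) \<le> exp (6 * B) * (\<integral>u. (f' u - f u)\<^sup>2 \<partial>\<mu>) / (4 * \<alpha>)"
  proof -
    have i1: "integrable \<nu> (\<lambda>z. (hb z - h0 z) * m z)" and i2: "integrable \<nu> (\<lambda>z. (hb z - h0 z)\<^sup>2)"
      by (intro integrable2 bd bar h0m mm)+
    have "(\<integral>z. (hb z - h0 z) * m z \<partial>\<nu>) - \<alpha> * (\<integral>z. (hb z - h0 z)\<^sup>2 \<partial>\<nu>)
        = (\<integral>z. (hb z - h0 z) * m z - \<alpha> * (hb z - h0 z)\<^sup>2 \<partial>\<nu>)"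
      using i1 i2 by simp
    also have "\<dots> \<le> (\<integral>z. exp (6 * B) * (\<integral>u. (f' u - f u)\<^sup>2 \<partial>\<mu>) / (4 * \<alpha>) \<partial>\<nu>)"
    proof (intro integral_mono integrable2 bd bar h0m mm)
      fix z assume z: "z \<in> space \<nu>"
      have "(hb z - h0 z) * m z - \<alpha> * (hb z - h0 z)\<^sup>2 \<le> (m z)\<^sup>2 / (4 * \<alpha>)"
        using young_inner[OF \<alpha>, of "hb z - h0 z" "- m z"] by simp
      also have "\<dots> \<le> exp (6 * B) * (\<integral>u. (f' u - f u)\<^sup>2 \<partial>\<mu>) / (4 * \<alpha>)"
        using m_le[OF z] \<alpha> by (intro divide_right_mono) auto
      finally show "(hb z - h0 z) * m z - \<alpha> * (hb z - h0 z)\<^sup>2 \<le> exp (6 * B) * (\<integral>u. (f' u - f u)\<^sup>2 \<partial>\<mu>) / (4 * \<alpha>)" .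
    qed
    finally show ?thesis by (simp add: M2.prob_space)
  qed
  ultimately have "J fb gb hb - J f' g h \<le> (\<integral>u. (norm (dg g h u))\<^sup>2 \<partial>\<mu>) / (4 * (\<alpha> * lam)) + exp (6 * B) * (\<integral>u. (f' u - f u)\<^sup>2 \<partial>\<mu>) / (4 * \<alpha>)"
    by (simp add: algebra_simps)
  also have "\<dots> = exp B / (2 * lam) * (\<integral>u. (norm (dg g h u))\<^sup>2 \<partial>\<mu>) + exp (7 * B) / 2 * (\<integral>u. (f' u - f u)\<^sup>2 \<partial>\<mu>)"
  proof -
    have "exp (7 * B) = exp (6 * B) * exp B" by (simp flip: exp_add)
    then show ?thesis unfolding \<alpha>_def by (simp add: exp_minus field_simps)
  qed
  finally show ?thesis .
qed

text \<open>All three gradients vanish at the base point \<open>(fb, gb, hb)\<close>, so only the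
  quadratic loss is left. It serves twice: its sign gives \<open>Jt_le_Jb\<close>, its size gives
  convergence in mean square.\<close>

lemma J_potentials_gap:
  assumes bm: "bdmeas \<mu> f" "bdmeas \<mu> g" "bdmeas \<nu> h" and bar: "bdmeas \<mu> fb" "bdmeas \<mu> gb" "bdmeas \<nu> hb"
    and centred: "(\<integral>u. f u \<partial>\<mu>) = 0" "(\<integral>u. g u \<partial>\<mu>) = 0" "(\<integral>u. fb u \<partial>\<mu>) = 0" "(\<integral>u. gb u \<partial>\<mu>) = 0"
    and fb: "\<And>u. u \<in> space \<mu> \<Longrightarrow> (\<integral>z. K fb gb hb (u, z) \<partial>\<nu>) = 1"
    and gb: "\<And>u. u \<in> space \<mu> \<Longrightarrow> (\<integral>z. K fb gb hb (u, z) *\<^sub>R X z \<partial>\<nu>) = 0"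
    and hb: "\<And>z. z \<in> space \<nu> \<Longrightarrow> (\<integral>u. K fb gb hb (u, z) \<partial>\<mu>) = 1"
    and B1: "\<And>p. p \<in> space (\<mu> \<Otimes>\<^sub>M \<nu>) \<Longrightarrow> \<bar>\<phi> f g h p\<bar> \<le> B"
    and B2: "\<And>p. p \<in> space (\<mu> \<Otimes>\<^sub>M \<nu>) \<Longrightarrow> \<bar>\<phi> fb gb hb p\<bar> \<le> B"
  shows "exp (- B) / 2 * ((\<integral>u. (f u - fb u)\<^sup>2 \<partial>\<mu>) + lam * (\<integral>u. (norm (g u - gb u))\<^sup>2 \<partial>\<mu>) + (\<integral>z. (h z - hb z)\<^sup>2 \<partial>\<nu>))
    \<le> J fb gb hb - J f g h"
proof -
  have z: "(\<integral>u. (f u - fb u) * (1 - (\<integral>z. K fb gb hb (u, z) \<partial>\<nu>)) \<partial>\<mu>) = (\<integral>u. 0 \<partial>\<mu>)"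
    "(\<integral>u. (g u - gb u) \<bullet> (\<integral>z. K fb gb hb (u, z) *\<^sub>R X z \<partial>\<nu>) \<partial>\<mu>) = (\<integral>u. 0 \<partial>\<mu>)"
    "(\<integral>z. (h z - hb z) * (1 - (\<integral>u. K fb gb hb (u, z) \<partial>\<mu>)) \<partial>\<nu>) = (\<integral>z. 0 \<partial>\<nu>)"
    by (intro Bochner_Integration.integral_cong refl; simp add: fb gb hb)+
  have c0: "(\<integral>u. f u - fb u \<partial>\<mu>) = 0" "(\<integral>u. g u - gb u \<partial>\<mu>) = 0"
    using bm bar centred by (simp_all add: integrable1)
  have "exp (- B) / 2 * ((\<integral>u. (f u - fb u)\<^sup>2 \<partial>\<mu>) + lam * (\<integral>u. (norm (g u - gb u))\<^sup>2 \<partial>\<mu>) + (\<integral>z. (h z - hb z)\<^sup>2 \<partial>\<nu>))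
     \<le> exp (- B) / 2 * (\<integral>p. (\<phi> f g h p - \<phi> fb gb hb p)\<^sup>2 \<partial>(\<mu> \<Otimes>\<^sub>M \<nu>))"
    unfolding \<phi>_diff by (intro mult_left_mono integral_linear_square_ge bd bm bar c0) auto
  also have "\<dots> \<le> J fb gb hb - J f g h"
    using J_strongly_concave[OF bar bm B2 B1] unfolding z by simp
  finally show ?thesis .
qed

end

section \<open>Boundedness and convergence of the iterates\<close>

context vector_sinkhorn
begin

text \<open>Jensen: since \<open>f\<close> and \<open>g\<close> are centred, the mean of the
  exponent over \<open>u\<close> is that of \<open>- c\<close>. The bound is free of the size of
  \<open>f\<close> and \<open>g\<close>, hence usable before \<open>g\<close> is controlled.\<close>

lemma hup_le:
  assumes bm: "bdmeas \<mu> f" "bdmeas \<mu> g" and centred: "(\<integral>u. f u \<partial>\<mu>) = 0" "(\<integral>u. g u \<partial>\<mu>) = 0"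
    and z: "z \<in> space \<nu>"
  shows "hup f g z \<le> C"
proof -
  have w: "bdmeas \<mu> (\<lambda>u. f u + g u \<bullet> X z - c (u, z))"
    using bdmeas_section_fst[OF bdmeas_hup_exponent[OF bm] z] by simp
  have cm: "bdmeas \<mu> (\<lambda>u. c (u, z))" by (rule bdmeas_section_fst[OF bdmeas_c z])
  have "(\<integral>u. c (u, z) \<partial>\<mu>) \<le> (\<integral>u. C \<partial>\<mu>)"
    using c_bound z by (intro integral_mono integrable1 cm bd) (auto simp: abs_le_iff space_pair_measure)
  then have "- C \<le> - (\<integral>u. c (u, z) \<partial>\<mu>)" by (simp add: M1.prob_space)
  also have "\<dots> = (\<integral>u. f u + g u \<bullet> X z - c (u, z) \<partial>\<mu>)"
    using integrable1[OF bm(1)] integrable1[OF bm(2)] integrable1[OF cm] by (simp add: centred)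
  also have "\<dots> \<le> ln (\<integral>u. exp (f u + g u \<bullet> X z - c (u, z)) \<partial>\<mu>)"
    using M1.exp_expectation_le[OF w] M1.expectation_exp_pos[OF w] by (simp add: ln_ge_iff)
  finally show ?thesis by (simp add: hup_def)
qed

text \<open>Jensen, where the mean zero of \<open>X\<close> removes \<open>g\<close>. Only the
  integral of \<open>h\<close> enters, and this is what monotonicity of the objective
  controls.\<close>

lemma fup_le:
  assumes bm: "bdmeas \<mu> g" "bdmeas \<nu> h" and u: "u \<in> space \<mu>"
  shows "fup g h u \<le> C - (\<integral>z. h z \<partial>\<nu>)"
proof -
  have w: "bdmeas \<nu> (\<lambda>z. g u \<bullet> X z + h z - c (u, z))"
    using bdmeas_section_snd[OF bdmeas_fup_exponent[OF bm] u] by simp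
  have cm: "bdmeas \<nu> (\<lambda>z. c (u, z))" by (rule bdmeas_section_snd[OF bdmeas_c u])
  have "(\<integral>z. c (u, z) \<partial>\<nu>) \<le> (\<integral>z. C \<partial>\<nu>)"
    using c_bound u by (intro integral_mono integrable2 cm bd) (auto simp: abs_le_iff space_pair_measure)
  then have "(\<integral>z. h z \<partial>\<nu>) - C \<le> (\<integral>z. h z \<partial>\<nu>) - (\<integral>z. c (u, z) \<partial>\<nu>)" by (simp add: M2.prob_space)
  also have "\<dots> = (\<integral>z. g u \<bullet> X z + h z - c (u, z) \<partial>\<nu>)"
    using integrable2[OF bdmeas_X] integrable2[OF bm(2)] integrable2[OF cm] by (simp add: X_mean)
  also have "\<dots> \<le> ln (\<integral>z. exp (g u \<bullet> X z + h z - c (u, z)) \<partial>\<nu>)"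
    using M2.exp_expectation_le[OF w] M2.expectation_exp_pos[OF w] by (simp add: ln_ge_iff)
  finally show ?thesis by (simp add: fup_def)
qed

lemma fup_ge:
  assumes bm: "bdmeas \<mu> g" "bdmeas \<nu> h" and u: "u \<in> space \<mu>"
    and G: "norm (g u) \<le> G" and h: "\<And>z. z \<in> space \<nu> \<Longrightarrow> h z \<le> H"
  shows "- (G * M + H + C) \<le> fup g h u"
proof -
  have w: "bdmeas \<nu> (\<lambda>z. g u \<bullet> X z + h z - c (u, z))"
    using bdmeas_section_snd[OF bdmeas_fup_exponent[OF bm] u] by simp
  have "g u \<bullet> X z + h z - c (u, z) \<le> G * M + H + C" if z: "z \<in> space \<nu>" for z
  proof -
    have "g u \<bullet> X z \<le> norm (g u) * norm (X z)" by (rule norm_cauchy_schwarz)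
    also have "\<dots> \<le> G * M" using G X_bound[OF z] M_pos by (intro mult_mono') auto
    finally show ?thesis using h[OF z] c_bound[of "(u, z)"] u z by (auto simp: space_pair_measure)
  qed
  then have "(\<integral>z. exp (g u \<bullet> X z + h z - c (u, z)) \<partial>\<nu>) \<le> exp (G * M + H + C)"
    by (rule M2.expectation_exp_bounds(2)[OF w])
  then have "ln (\<integral>z. exp (g u \<bullet> X z + h z - c (u, z)) \<partial>\<nu>) \<le> G * M + H + C"
    using M2.expectation_exp_pos[OF w] by (metis ln_exp ln_le_cancel_iff exp_gt_zero)
  then show ?thesis by (simp add: fup_def)
qed

lemma hup_ge:
  assumes bm: "bdmeas \<mu> f" "bdmeas \<mu> g" and z: "z \<in> space \<nu>"
    and G: "\<And>u. u \<in> space \<mu> \<Longrightarrow> norm (g u) \<le> G" and F: "\<And>u. u \<in> space \<mu> \<Longrightarrow> f u \<le> F"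
  shows "- (F + G * M + C) \<le> hup f g z"
proof -
  have w: "bdmeas \<mu> (\<lambda>u. f u + g u \<bullet> X z - c (u, z))"
    using bdmeas_section_fst[OF bdmeas_hup_exponent[OF bm] z] by simp
  have "f u + g u \<bullet> X z - c (u, z) \<le> F + G * M + C" if u: "u \<in> space \<mu>" for u
  proof -
    have "g u \<bullet> X z \<le> norm (g u) * norm (X z)" by (rule norm_cauchy_schwarz)
    also have "\<dots> \<le> G * M" using G[OF u] X_bound[OF z] M_pos by (intro mult_mono') auto
    finally show ?thesis using F[OF u] c_bound[of "(u, z)"] u z by (auto simp: space_pair_measure)
  qed
  then have "(\<integral>u. exp (f u + g u \<bullet> X z - c (u, z)) \<partial>\<mu>) \<le> exp (F + G * M + C)"
    by (rule M1.expectation_exp_bounds(2)[OF w])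
  then have "ln (\<integral>u. exp (f u + g u \<bullet> X z - c (u, z)) \<partial>\<mu>) \<le> F + G * M + C"
    using M1.expectation_exp_pos[OF w] by (metis ln_exp ln_le_cancel_iff exp_gt_zero)
  then show ?thesis by (simp add: hup_def)
qed

text \<open>Mass one over every \<open>z\<close> cancels the penalty, so lower bounds on the
  objective become lower bounds on the integral of \<open>h\<close> (see
  \<open>integral_h'_ge\<close>).\<close>

lemma J_hup_eq:
  assumes bm: "bdmeas \<mu> f" "bdmeas \<mu> g"
  shows "J f g (hup f g) = (\<integral>u. f u \<partial>\<mu>) + (\<integral>z. hup f g z \<partial>\<nu>)"
proof -
  have "(\<integral>p. K f g (hup f g) p \<partial>(\<mu> \<Otimes>\<^sub>M \<nu>)) = (\<integral>z. (\<integral>u. K f g (hup f g) (u, z) \<partial>\<mu>) \<partial>\<nu>)"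
    by (intro integral_pair_snd bdmeas_K bm bdmeas_hup)
  also have "\<dots> = (\<integral>z. 1 \<partial>\<nu>)"
    by (intro Bochner_Integration.integral_cong refl) (simp add: hup_marginal bm)
  finally show ?thesis by (simp add: J_def M2.prob_space)
qed

text \<open>The inequality 1 + x <= exp x, applied to the exponent, bounds the positive part of g u
  . X by a function of controlled integral, since \<open>K\<close> has mass one. A variable of mean
  zero has absolute mean twice that of its positive part. By coercivity lam |g u|^2 is at most the
  second moment, hence at most |g u| M times the absolute mean; dividing by |g u| leaves lam / (2
  M).\<close>

lemma norm_le_neg_fup:
  assumes bm: "bdmeas \<mu> g" "bdmeas \<nu> h" and u: "u \<in> space \<mu>"
    and h: "\<And>z. z \<in> space \<nu> \<Longrightarrow> h z \<le> C" and L: "L \<le> (\<integral>z. h z \<partial>\<nu>)"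
  shows "lam / (2 * M) * norm (g u) \<le> 1 + 3 * C - L + max (- fup g h u) 0"
proof -
  let ?k = "\<lambda>z. K (fup g h) g h (u, z)"
  have km: "bdmeas \<nu> ?k" by (intro bdmeas_section_snd[OF bdmeas_K] bm bdmeas_fup u)
  have one: "(\<integral>z. ?k z \<partial>\<nu>) = 1" by (rule fup_marginal[OF bm u])
  let ?m = "max (- fup g h u) 0"
  \<comment> \<open>This is |x| = 2 max x 0 - x, whose last term will integrate to zero. The
    truncation \<open>?m\<close> and the summand \<open>2 * C - h z\<close> keep the bound on the
    positive part nonnegative.\<close>
  have pt: "\<bar>g u \<bullet> X z\<bar> \<le> 2 * (?k z + ?m + (2 * C - h z) + C) - g u \<bullet> X z" if z: "z \<in> space \<nu>" for z
  proof -
    have cb: "c (u, z) \<le> C" "- C \<le> c (u, z)"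
      using c_bound[of "(u, z)"] u z by (auto simp: space_pair_measure abs_le_iff)
    have "fup g h u + g u \<bullet> X z + h z - c (u, z) \<le> ?k z"
      using exp_ge_add_one_self[of "fup g h u + g u \<bullet> X z + h z - c (u, z)"]
      unfolding K_def \<phi>_def fst_conv snd_conv by linarith
    moreover have "0 \<le> ?k z" by (simp add: K_def)
    moreover have "- fup g h u \<le> ?m" "0 \<le> ?m" by simp_all
    moreover have "2 * (?k z + ?m + (2 * C - h z) + C) = 2 * ?k z + 2 * ?m + 6 * C - 2 * h z" by simp
    ultimately show ?thesis using h[OF z] cb C_nonneg by linarith
  qed
  have "(\<integral>z. \<bar>g u \<bullet> X z\<bar> \<partial>\<nu>) \<le> (\<integral>z. 2 * (?k z + ?m + (2 * C - h z) + C) - g u \<bullet> X z \<partial>\<nu>)"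
    by (intro integral_mono integrable2 bd km bm pt)
  also have "\<dots> = 2 * (1 + ?m + (2 * C - (\<integral>z. h z \<partial>\<nu>)) + C)"
    using integrable2[OF km] integrable2[OF bm(2)] integrable2[OF bdmeas_X]
    by (simp add: one X_mean M2.prob_space)
  also have "\<dots> \<le> 2 * (1 + 3 * C - L + ?m)" using L by simp
  finally have *: "(\<integral>z. \<bar>g u \<bullet> X z\<bar> \<partial>\<nu>) \<le> 2 * (1 + 3 * C - L + ?m)" .
  have "lam * (norm (g u))\<^sup>2 \<le> (\<integral>z. (g u \<bullet> X z)\<^sup>2 \<partial>\<nu>)" by (rule X_coercive)
  also have "\<dots> \<le> (\<integral>z. norm (g u) * M * \<bar>g u \<bullet> X z\<bar> \<partial>\<nu>)"
  proof (intro integral_mono integrable2 bd)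
    fix z assume z: "z \<in> space \<nu>"
    have "\<bar>g u \<bullet> X z\<bar> \<le> norm (g u) * norm (X z)" by (rule Cauchy_Schwarz_ineq2)
    also have "\<dots> \<le> norm (g u) * M" using X_bound[OF z] by (intro mult_left_mono) auto
    finally have "\<bar>g u \<bullet> X z\<bar> * \<bar>g u \<bullet> X z\<bar> \<le> norm (g u) * M * \<bar>g u \<bullet> X z\<bar>"
      by (intro mult_right_mono) auto
    then show "(g u \<bullet> X z)\<^sup>2 \<le> norm (g u) * M * \<bar>g u \<bullet> X z\<bar>" by (simp add: power2_eq_square)
  qed
  also have "\<dots> = norm (g u) * M * (\<integral>z. \<bar>g u \<bullet> X z\<bar> \<partial>\<nu>)" by simp
  also have "\<dots> \<le> norm (g u) * M * (2 * (1 + 3 * C - L + ?m))"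
    using * M_pos by (intro mult_left_mono) auto
  finally have **: "norm (g u) * (lam * norm (g u)) \<le> norm (g u) * (2 * M * (1 + 3 * C - L + ?m))"
    by (simp add: power2_eq_square mult_ac)
  have "0 \<le> 2 * (1 + 3 * C - L + ?m)"
    by (rule order_trans[OF Bochner_Integration.integral_nonneg *]) simp
  then have nn: "0 \<le> 2 * M * (1 + 3 * C - L + ?m)"
    using M_pos by (simp add: zero_le_mult_iff)
  have "lam * norm (g u) \<le> 2 * M * (1 + 3 * C - L + ?m)"
  proof (cases "g u = 0")
    case True
    then show ?thesis using nn by simp
  next
    case False
    then show ?thesis using mult_left_le_imp_le[OF **] by simp
  qed
  then show ?thesis using M_pos by (simp add: field_simps)
qed

text \<open>Jensen for t -> exp (- t) under the density \<open>K\<close> at \<open>u\<close>, for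
  which g u . X has mean \<open>g u \<bullet> dg g h u\<close>. Multiplying \<open>K\<close> by exp
  (- g u . X) removes \<open>g\<close> except through \<open>fup\<close>, and h - c <= 2 C bounds
  the rest.\<close>

lemma inner_dg_ge:
  assumes bm: "bdmeas \<mu> g" "bdmeas \<nu> h" and u: "u \<in> space \<mu>"
    and h: "\<And>z. z \<in> space \<nu> \<Longrightarrow> h z \<le> C"
  shows "- fup g h u - 2 * C \<le> g u \<bullet> dg g h u"
proof -
  let ?k = "\<lambda>z. K (fup g h) g h (u, z)" and ?d = "dg g h u"
  have km: "bdmeas \<nu> ?k" by (intro bdmeas_section_snd[OF bdmeas_K] bm bdmeas_fup u)
  have one: "(\<integral>z. ?k z \<partial>\<nu>) = 1" by (rule fup_marginal[OF bm u])
  have cm: "bdmeas \<nu> (\<lambda>z. c (u, z))" by (rule bdmeas_section_snd[OF bdmeas_c u])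
  have gd: "(\<integral>z. ?k z * (g u \<bullet> X z) \<partial>\<nu>) = g u \<bullet> ?d"
  proof -
    have "(\<integral>z. g u \<bullet> (?k z *\<^sub>R X z) \<partial>\<nu>) = g u \<bullet> (\<integral>z. ?k z *\<^sub>R X z \<partial>\<nu>)"
      by (rule integral_inner_right) (intro integrable2 bd km)
    then show ?thesis unfolding dg_eq by simp
  qed
  \<comment> \<open>The tangent line at the mean, written so that its integral is the value at the
    mean.\<close>
  have "exp (- (g u \<bullet> ?d)) = exp (- (g u \<bullet> ?d)) * ((1 + g u \<bullet> ?d) * (\<integral>z. ?k z \<partial>\<nu>) - (\<integral>z. ?k z * (g u \<bullet> X z) \<partial>\<nu>))"
    unfolding one gd by simp
  also have "\<dots> = (\<integral>z. exp (- (g u \<bullet> ?d)) * ((1 + g u \<bullet> ?d) * ?k z - ?k z * (g u \<bullet> X z)) \<partial>\<nu>)"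
    using integrable2[OF km] integrable2[OF bdmeas_mult[OF km bdmeas_inner[OF bdmeas_const bdmeas_X]]] by simp
  also have "\<dots> \<le> (\<integral>z. exp (fup g h u) * exp (h z - c (u, z)) \<partial>\<nu>)"
  proof (intro integral_mono integrable2 bd km bm cm)
    fix z
    have "exp (- (g u \<bullet> ?d)) * ?k z * (1 + (g u \<bullet> ?d - g u \<bullet> X z)) \<le> exp (- (g u \<bullet> ?d)) * ?k z * exp (g u \<bullet> ?d - g u \<bullet> X z)"
      by (intro mult_left_mono exp_ge_add_one_self mult_nonneg_nonneg) (auto simp: K_def)
    also have "\<dots> = exp (fup g h u) * exp (h z - c (u, z))"
      by (simp add: K_def \<phi>_def flip: exp_add)
    finally show "exp (- (g u \<bullet> ?d)) * ((1 + g u \<bullet> ?d) * ?k z - ?k z * (g u \<bullet> X z)) \<le> exp (fup g h u) * exp (h z - c (u, z))"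
      by (simp add: algebra_simps)
  qed
  also have "\<dots> = exp (fup g h u) * (\<integral>z. exp (h z - c (u, z)) \<partial>\<nu>)" by simp
  also have "\<dots> \<le> exp (fup g h u) * exp (2 * C)"
  proof (intro mult_left_mono M2.expectation_exp_bounds(2) bd bm cm)
    show "h z - c (u, z) \<le> 2 * C" if "z \<in> space \<nu>" for z
      using h[OF that] c_bound[of "(u, z)"] u that by (auto simp: space_pair_measure)
  qed simp
  finally have "- (g u \<bullet> ?d) \<le> fup g h u + 2 * C" by (simp flip: exp_add)
  then show ?thesis by simp
qed

text \<open>Within radius \<open>R\<close> a step adds at most s M. Beyond it,
  \<open>norm_le_neg_fup\<close> and \<open>inner_dg_ge\<close> give g . d >= \<rho> |g| - (1 + 5 C
  - L), with 3 C from the first and 2 C from the second, so the leading change of the squared norm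
  is - 2 s \<rho> |g|. The first summand of \<open>R\<close> lets half of this pay for the constants
  and for s^2 |d|^2; the second keeps |g| - s \<rho> / 2 nonnegative, so that square roots can be
  taken.\<close>

lemma norm_gradient_step_le:
  assumes bm: "bdmeas \<mu> g" "bdmeas \<nu> h" and u: "u \<in> space \<mu>"
    and h: "\<And>z. z \<in> space \<nu> \<Longrightarrow> h z \<le> C" and L: "L \<le> (\<integral>z. h z \<partial>\<nu>)" and s: "s > 0"
    and \<rho>: "\<rho> = lam / (2 * M)"
    and R: "R = (2 * (1 + 5 * C - L) + s * M\<^sup>2) / \<rho> + s * \<rho>"
  shows "norm (g u - s *\<^sub>R dg g h u) \<le> max (norm (g u)) (R + s * M + s * \<rho> / 2) - s * \<rho> / 2"
proof (cases "norm (g u) \<le> R")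
  case True
  have "norm (g u - s *\<^sub>R dg g h u) \<le> norm (g u) + norm (s *\<^sub>R dg g h u)" by (rule norm_triangle_ineq4)
  also have "\<dots> \<le> R + s * M"
    using True norm_dg_le[OF bm u] s by (intro add_mono) (auto intro!: mult_left_mono)
  finally show ?thesis by simp
next
  case False
  let ?n = "norm (g u)" and ?d = "dg g h u"
  have \<rho>_pos: "\<rho> > 0" using lam_pos M_pos by (simp add: \<rho>)
  have "L \<le> (\<integral>z. C \<partial>\<nu>)"
    by (rule order_trans[OF L]) (intro integral_mono integrable2 bm bd h)
  then have LC: "L \<le> C" by (simp add: M2.prob_space)
  have n: "s * \<rho> \<le> ?n" "2 * (1 + 5 * C - L) + s * M\<^sup>2 \<le> \<rho> * ?n"
  proof -
    have "0 \<le> (2 * (1 + 5 * C - L) + s * M\<^sup>2) / \<rho>"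
      using \<rho>_pos s LC C_nonneg by (intro divide_nonneg_pos add_nonneg_nonneg) auto
    then show "s * \<rho> \<le> ?n" using False by (simp add: R)
    have "(2 * (1 + 5 * C - L) + s * M\<^sup>2) / \<rho> \<le> ?n"
      using False mult_pos_pos[OF s \<rho>_pos] unfolding R by linarith
    then show "2 * (1 + 5 * C - L) + s * M\<^sup>2 \<le> \<rho> * ?n"
      using \<rho>_pos by (simp add: pos_divide_le_eq mult.commute)
  qed
  have "\<rho> * ?n \<le> 1 + 3 * C - L + max (- fup g h u) 0"
    unfolding \<rho> by (rule norm_le_neg_fup[OF bm u h L])
  \<comment> \<open>This excludes the value 0 of the maximum, so \<open>- fup g h u\<close> itself
    carries the linear growth.\<close>
  moreover have "1 + 3 * C - L < \<rho> * ?n"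
  proof -
    have "0 \<le> s * M\<^sup>2" using s by simp
    moreover have "2 * (1 + 5 * C - L) = 2 + 10 * C - 2 * L" by simp
    ultimately show ?thesis using n(2) LC C_nonneg by linarith
  qed
  ultimately have "\<rho> * ?n \<le> 1 + 3 * C - L - fup g h u" by (auto simp: max_def split: if_splits)
  then have gd: "g u \<bullet> ?d \<ge> \<rho> * ?n - (1 + 5 * C - L)"
    using inner_dg_ge[OF bm u h] by linarith
  have "(norm (g u - s *\<^sub>R ?d))\<^sup>2 = ?n\<^sup>2 - 2 * s * (g u \<bullet> ?d) + s\<^sup>2 * (norm ?d)\<^sup>2"
    unfolding power2_norm_eq_inner by (simp add: algebra_simps inner_commute power2_eq_square)
  also have "\<dots> \<le> ?n\<^sup>2 - 2 * s * (\<rho> * ?n - (1 + 5 * C - L)) + s\<^sup>2 * M\<^sup>2"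
    using gd s norm_dg_le[OF bm u] by (intro add_mono diff_mono mult_left_mono power_mono) auto
  also have "\<dots> = ?n\<^sup>2 - 2 * s * (\<rho> * ?n) + s * (2 * (1 + 5 * C - L) + s * M\<^sup>2)"
    by (simp add: algebra_simps power2_eq_square)
  also have "\<dots> \<le> ?n\<^sup>2 - 2 * s * (\<rho> * ?n) + s * (\<rho> * ?n)"
    using n(2) s by (intro add_left_mono mult_left_mono) auto
  also have "\<dots> \<le> (?n - s * \<rho> / 2)\<^sup>2"
  proof -
    have "(?n - s * \<rho> / 2)\<^sup>2 = ?n\<^sup>2 - s * (\<rho> * ?n) + (s * \<rho> / 2)\<^sup>2" by (simp add: power2_diff mult_ac)
    then show ?thesis using zero_le_power2[of "s * \<rho> / 2"] by linarith
  qed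
  finally have "norm (g u - s *\<^sub>R ?d) \<le> ?n - s * \<rho> / 2"
  proof (rule power2_le_imp_le)
    show "0 \<le> ?n - s * \<rho> / 2" using n(1) mult_pos_pos[OF s \<rho>_pos] by linarith
  qed
  then show ?thesis by simp
qed

end

section \<open>The iteration with recentring\<close>

locale vector_sinkhorn_iteration = vector_sinkhorn \<mu> \<nu> X c M lam C
  for \<mu> :: "'u measure" and \<nu> :: "'z measure" and X :: "'z \<Rightarrow> 'x::euclidean_space" and c M lam C +
  fixes s :: real and f :: "nat \<Rightarrow> 'u \<Rightarrow> real" and g :: "nat \<Rightarrow> 'u \<Rightarrow> 'x" and h :: "nat \<Rightarrow> 'z \<Rightarrow> real"
    and fb :: "'u \<Rightarrow> real" and gb :: "'u \<Rightarrow> 'x" and hb :: "'z \<Rightarrow> real"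
  assumes s_pos: "0 < s" and s_less: "s * M\<^sup>2 < 2"
    and init: "bdmeas \<mu> (f 0)" "bdmeas \<mu> (g 0)" "bdmeas \<nu> (h 0)"
    and init_centred: "(\<integral>u. f 0 u \<partial>\<mu>) = 0" "(\<integral>u. g 0 u \<partial>\<mu>) = 0"
    and f_Suc: "\<And>t u. f (Suc t) u = fup (g t) (hup (f t) (g t)) u - (\<integral>u. fup (g t) (hup (f t) (g t)) u \<partial>\<mu>)"
    and g_Suc: "\<And>t u. g (Suc t) u = g t u - s *\<^sub>R dg (g t) (hup (f t) (g t)) u
       - (\<integral>u. g t u - s *\<^sub>R dg (g t) (hup (f t) (g t)) u \<partial>\<mu>)"
    and h_Suc: "\<And>t z. h (Suc t) z = hup (f t) (g t) z + (\<integral>u. fup (g t) (hup (f t) (g t)) u \<partial>\<mu>)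
       + (\<integral>u. g t u - s *\<^sub>R dg (g t) (hup (f t) (g t)) u \<partial>\<mu>) \<bullet> X z"
    and bar: "bdmeas \<mu> fb" "bdmeas \<mu> gb" "bdmeas \<nu> hb"
    and bar_centred: "(\<integral>u. fb u \<partial>\<mu>) = 0" "(\<integral>u. gb u \<partial>\<mu>) = 0"
    and bar_fup: "\<And>u. u \<in> space \<mu> \<Longrightarrow> fb u = fup gb hb u"
    and bar_dg: "\<And>u. u \<in> space \<mu> \<Longrightarrow> dg gb hb u = 0"
    and bar_hup: "\<And>z. z \<in> space \<nu> \<Longrightarrow> hb z = hup fb gb z"
begin

text \<open>Primes mark updates before recentring: at index \<open>t\<close> they are what the
  algorithm writes with a tilde and index t + 1, and recentring turns them into the iterate
  \<open>Suc t\<close>.\<close>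

abbreviation "h' t \<equiv> hup (f t) (g t)"
abbreviation "f' t \<equiv> fup (g t) (h' t)"
abbreviation "d t \<equiv> dg (g t) (h' t)"
abbreviation "g' t \<equiv> (\<lambda>u. g t u - s *\<^sub>R d t u)"
abbreviation "Jt t \<equiv> J (f t) (g t) (h t)"
abbreviation "Jb \<equiv> J fb gb hb"

lemma iterates_bdmeas: "bdmeas \<mu> (f t) \<and> bdmeas \<mu> (g t) \<and> bdmeas \<nu> (h t)"
proof (induction t)
  case (Suc t)
  then have f: "bdmeas \<mu> (f t)" and g: "bdmeas \<mu> (g t)" by auto
  show ?case
    unfolding f_Suc[abs_def] g_Suc[abs_def] h_Suc[abs_def]
    by (intro conjI bd bdmeas_fup bdmeas_hup bdmeas_dg f g)
qed (use init in auto)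

lemmas fm = iterates_bdmeas[THEN conjunct1]
  and gm = iterates_bdmeas[THEN conjunct2, THEN conjunct1]
  and hm = iterates_bdmeas[THEN conjunct2, THEN conjunct2]

lemma hm': "bdmeas \<nu> (h' t)" by (intro bdmeas_hup fm gm)
lemma fm': "bdmeas \<mu> (f' t)" by (intro bdmeas_fup hm' gm)
lemma dm: "bdmeas \<mu> (d t)" by (intro bdmeas_dg hm' gm)
lemma gm': "bdmeas \<mu> (g' t)" by (intro bd gm dm)

lemma iterates_centred: "(\<integral>u. f t u \<partial>\<mu>) = 0" "(\<integral>u. g t u \<partial>\<mu>) = 0"
  using init_centred integrable1[OF fm'] integrable1[OF gm']
  by (cases t; simp add: f_Suc[abs_def] g_Suc[abs_def] M1.prob_space)+

lemma Jt_Suc: "Jt (Suc t) = J (f' t) (g' t) (h' t)"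
  unfolding f_Suc[abs_def] g_Suc[abs_def] h_Suc[abs_def] by (rule J_shift[OF fm' gm' hm'])

lemma \<phi>_Suc: "\<phi> (f (Suc t)) (g (Suc t)) (h (Suc t)) = \<phi> (f' t) (g' t) (h' t)"
  unfolding f_Suc[abs_def] g_Suc[abs_def] h_Suc[abs_def] by (rule \<phi>_shift)

text \<open>The gain per unit of squared gradient in \<open>gradient_step_gain\<close>, for \<kappa>
  = s (1 - s M^2 / 2).\<close>

definition "\<gamma> = s * (1 - s * M\<^sup>2 / 2) / (1 + s * (1 - s * M\<^sup>2 / 2) * M\<^sup>2)"

lemma \<gamma>_pos: "\<gamma> > 0"
proof -
  have "s * (1 - s * M\<^sup>2 / 2) > 0" using s_pos s_less by (intro mult_pos_pos) auto
  then show ?thesis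
    unfolding \<gamma>_def using s_pos s_less by (intro divide_pos_pos add_pos_nonneg mult_nonneg_nonneg) auto
qed

lemma gain_d: "\<gamma> * (\<integral>u. (norm (d t u))\<^sup>2 \<partial>\<mu>) \<le> Jt (Suc t) - J (f' t) (g t) (h' t)"
  unfolding Jt_Suc \<gamma>_def
  by (rule gradient_step_gain[OF fm' gm hm' _ s_pos s_less refl dm dg_eq]) (rule fup_marginal[OF gm hm'])

lemma Jt_le_h': "Jt t \<le> J (f t) (g t) (h' t)" by (rule J_hup_ge[OF fm gm hm])

lemma Jt_h'_le_f': "J (f t) (g t) (h' t) \<le> J (f' t) (g t) (h' t)" by (rule J_fup_ge[OF fm gm hm'])

lemma gain_d_total: "\<gamma> * (\<integral>u. (norm (d t u))\<^sup>2 \<partial>\<mu>) \<le> Jt (Suc t) - Jt t"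
  using gain_d[of t] Jt_le_h'[of t] Jt_h'_le_f'[of t] by linarith

lemma incseq_Jt: "incseq Jt"
proof (rule incseq_SucI)
  fix t
  have "0 \<le> \<gamma> * (\<integral>u. (norm (d t u))\<^sup>2 \<partial>\<mu>)" using \<gamma>_pos by (intro mult_nonneg_nonneg) auto
  then show "Jt t \<le> Jt (Suc t)" using gain_d_total[of t] by linarith
qed

lemma bar_marginals:
  "u \<in> space \<mu> \<Longrightarrow> (\<integral>z. K fb gb hb (u, z) \<partial>\<nu>) = 1"
  "u \<in> space \<mu> \<Longrightarrow> (\<integral>z. K fb gb hb (u, z) *\<^sub>R X z \<partial>\<nu>) = 0"
  "z \<in> space \<nu> \<Longrightarrow> (\<integral>u. K fb gb hb (u, z) \<partial>\<mu>) = 1"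
proof -
  have K1: "K fb gb hb (u, z) = K (fup gb hb) gb hb (u, z)" if "u \<in> space \<mu>" for u z
    using that by (simp add: K_def \<phi>_def bar_fup)
  have K2: "K fb gb hb (u, z) = K fb gb (hup fb gb) (u, z)" if "z \<in> space \<nu>" for u z
    using that by (simp add: K_def \<phi>_def bar_hup)
  show "u \<in> space \<mu> \<Longrightarrow> (\<integral>z. K fb gb hb (u, z) \<partial>\<nu>) = 1"
    using fup_marginal[OF bar(2,3)] by (simp add: K1)
  show "u \<in> space \<mu> \<Longrightarrow> (\<integral>z. K fb gb hb (u, z) *\<^sub>R X z \<partial>\<nu>) = 0"
    using bar_dg by (simp add: K1 dg_eq)
  show "z \<in> space \<nu> \<Longrightarrow> (\<integral>u. K fb gb hb (u, z) \<partial>\<mu>) = 1"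
    using hup_marginal[OF bar(1,2)] by (simp add: K2)
qed

lemma gap_ge:
  assumes "\<And>p. p \<in> space (\<mu> \<Otimes>\<^sub>M \<nu>) \<Longrightarrow> \<bar>\<phi> (f t) (g t) (h t) p\<bar> \<le> B"
    and "\<And>p. p \<in> space (\<mu> \<Otimes>\<^sub>M \<nu>) \<Longrightarrow> \<bar>\<phi> fb gb hb p\<bar> \<le> B"
  shows "exp (- B) / 2 * ((\<integral>u. (f t u - fb u)\<^sup>2 \<partial>\<mu>) + lam * (\<integral>u. (norm (g t u - gb u))\<^sup>2 \<partial>\<mu>)
     + (\<integral>z. (h t z - hb z)\<^sup>2 \<partial>\<nu>)) \<le> Jb - Jt t"
  by (intro J_potentials_gap fm gm hm bar iterates_centred bar_centred bar_marginals assms)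

text \<open>The exponent bound may depend on \<open>t\<close>, since only a sign is needed. This
  matters because the boundedness of \<open>g\<close> rests on this inequality.\<close>

lemma Jt_le_Jb: "Jt t \<le> Jb"
proof -
  obtain B0 where B0: "\<And>p. p \<in> space (\<mu> \<Otimes>\<^sub>M \<nu>) \<Longrightarrow> norm (\<phi> (f t) (g t) (h t) p) \<le> B0"
    using bdmeas_bound[OF bdmeas_\<phi>[OF fm gm hm]] by blast
  obtain B1 where B1: "\<And>p. p \<in> space (\<mu> \<Otimes>\<^sub>M \<nu>) \<Longrightarrow> norm (\<phi> fb gb hb p) \<le> B1"
    using bdmeas_bound[OF bdmeas_\<phi>[OF bar]] by blast
  have "0 \<le> exp (- max B0 B1) / 2 * ((\<integral>u. (f t u - fb u)\<^sup>2 \<partial>\<mu>) + lam * (\<integral>u. (norm (g t u - gb u))\<^sup>2 \<partial>\<mu>)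
     + (\<integral>z. (h t z - hb z)\<^sup>2 \<partial>\<nu>))"
    using lam_pos by (intro mult_nonneg_nonneg add_nonneg_nonneg) auto
  also have "\<dots> \<le> Jb - Jt t"
    using B0 B1 by (intro gap_ge) (auto simp: le_max_iff_disj)
  finally show ?thesis by simp
qed

text \<open>\<open>Jt\<close> is monotone and bounded by \<open>Jb\<close>, so its increments
  vanish, and by \<open>gain_d_total\<close> they dominate the squared gradient.\<close>

lemma d_tendsto_0: "(\<lambda>t. \<integral>u. (norm (d t u))\<^sup>2 \<partial>\<mu>) \<longlonglongrightarrow> 0"
proof -
  obtain l where l: "Jt \<longlonglongrightarrow> l"
    using incseq_convergent[OF incseq_Jt, of Jb] Jt_le_Jb by blast
  have "(\<lambda>t. (Jt (Suc t) - Jt t) / \<gamma>) \<longlonglongrightarrow> (l - l) / \<gamma>"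
    using \<gamma>_pos by (intro tendsto_intros l LIMSEQ_Suc) auto
  then have "(\<lambda>t. (Jt (Suc t) - Jt t) / \<gamma>) \<longlonglongrightarrow> 0" by simp
  then show ?thesis
  proof (rule tendsto_sandwich[OF _ _ tendsto_const, rotated 2])
    show "\<forall>\<^sub>F t in sequentially. (\<integral>u. (norm (d t u))\<^sup>2 \<partial>\<mu>) \<le> (Jt (Suc t) - Jt t) / \<gamma>"
      using gain_d_total \<gamma>_pos by (intro always_eventually allI) (simp add: field_simps)
  qed simp
qed

text \<open>As \<open>g t\<close> is centred, the recentring vector is - s times the mean of the
  gradient.\<close>

lemma norm_mean_g'_le: "(norm (\<integral>u. g' t u \<partial>\<mu>))\<^sup>2 \<le> s\<^sup>2 * (\<integral>u. (norm (d t u))\<^sup>2 \<partial>\<mu>)"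
proof -
  have "(\<integral>u. g' t u \<partial>\<mu>) = - (s *\<^sub>R (\<integral>u. d t u \<partial>\<mu>))"
    using integrable1[OF gm] integrable1[OF dm] by (simp add: iterates_centred)
  then have "(norm (\<integral>u. g' t u \<partial>\<mu>))\<^sup>2 = s\<^sup>2 * (norm (\<integral>u. d t u \<partial>\<mu>))\<^sup>2"
    by (simp add: power_mult_distrib)
  also have "(norm (\<integral>u. d t u \<partial>\<mu>))\<^sup>2 \<le> (\<integral>u. norm (d t u) \<partial>\<mu>)\<^sup>2"
    by (intro power_mono integral_norm_bound) auto
  also have "\<dots> \<le> (\<integral>u. (norm (d t u))\<^sup>2 \<partial>\<mu>)"
    by (intro M1.expectation_square_le bd dm)
  finally show ?thesis by (simp add: mult_left_mono)
qed

lemma h'_le: "z \<in> space \<nu> \<Longrightarrow> h' t z \<le> C"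
  by (intro hup_le fm gm iterates_centred)

text \<open>The objective never decreases, and after the update of \<open>h\<close> it is the
  integral of \<open>h' t\<close> alone because \<open>f t\<close> is centred. This supplies
  \<open>L\<close> in \<open>norm_le_neg_fup\<close> and
  \<open>norm_gradient_step_le\<close>.\<close>

lemma integral_h'_ge: "Jt 0 \<le> (\<integral>z. h' t z \<partial>\<nu>)"
  using incseqD[OF incseq_Jt, of 0 t] Jt_le_h'[of t] J_hup_eq[OF fm[of t] gm[of t]]
  by (simp add: iterates_centred)

text \<open>Only finitely many iterates need the crude bound, so the recentring is harmless even
  though its norms need not be summable.\<close>

lemma g_bounded: "\<exists>G. \<forall>t. \<forall>u\<in>space \<mu>. norm (g t u) \<le> G"
proof -
  define \<rho> where "\<rho> = lam / (2 * M)"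
  define R where "R = (2 * (1 + 5 * C - Jt 0) + s * M\<^sup>2) / \<rho> + s * \<rho>"
  have \<rho>: "\<rho> > 0" using lam_pos M_pos by (simp add: \<rho>_def)
  \<comment> \<open>The threshold makes the recentring vector at most s \<rho> / 2 long, the amount
    by which a gradient step shortens a long vector.\<close>
  have "(s * \<rho> / 2)\<^sup>2 / s\<^sup>2 > 0" using s_pos \<rho> by simp
  from order_tendstoD(2)[OF d_tendsto_0 this]
  obtain T where T: "\<And>t. t \<ge> T \<Longrightarrow> (\<integral>u. (norm (d t u))\<^sup>2 \<partial>\<mu>) < (s * \<rho> / 2)\<^sup>2 / s\<^sup>2"
    by (auto simp: eventually_sequentially)
  have mean: "norm (\<integral>u. g' t u \<partial>\<mu>) \<le> s * \<rho> / 2" if "t \<ge> T" for t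
  proof (rule power2_le_imp_le)
    have "s\<^sup>2 * (\<integral>u. (norm (d t u))\<^sup>2 \<partial>\<mu>) \<le> s\<^sup>2 * ((s * \<rho> / 2)\<^sup>2 / s\<^sup>2)"
      using T[OF that] by (intro mult_left_mono) auto
    also have "\<dots> = (s * \<rho> / 2)\<^sup>2" using s_pos by simp
    finally show "(norm (\<integral>u. g' t u \<partial>\<mu>))\<^sup>2 \<le> (s * \<rho> / 2)\<^sup>2"
      using norm_mean_g'_le[of t] by linarith
  qed (use s_pos \<rho> in simp)
  have step: "norm (g (Suc t) u) \<le> max (norm (g t u)) (R + s * M + s * \<rho> / 2)"
    if "t \<ge> T" "u \<in> space \<mu>" for t u
  proof -
    have "norm (g (Suc t) u) \<le> norm (g' t u) + norm (\<integral>u. g' t u \<partial>\<mu>)"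
      unfolding g_Suc by (rule norm_triangle_ineq4)
    also have "\<dots> \<le> (max (norm (g t u)) (R + s * M + s * \<rho> / 2) - s * \<rho> / 2) + s * \<rho> / 2"
      by (intro add_mono mean that norm_gradient_step_le[OF gm hm' _ h'_le integral_h'_ge s_pos \<rho>_def R_def])
    finally show ?thesis by simp
  qed
  have "\<exists>G. \<forall>t\<le>n. \<forall>u\<in>space \<mu>. norm (g t u) \<le> G" for n
  proof (induction n)
    case 0
    obtain G where "\<And>u. u \<in> space \<mu> \<Longrightarrow> norm (g 0 u) \<le> G"
      using bdmeas_bound[OF gm[of 0]] by blast
    then show ?case by auto
  next
    case (Suc n)
    then obtain G where "\<forall>t\<le>n. \<forall>u\<in>space \<mu>. norm (g t u) \<le> G" by blast
    moreover obtain G' where "\<And>u. u \<in> space \<mu> \<Longrightarrow> norm (g (Suc n) u) \<le> G'"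
      using bdmeas_bound[OF gm[of "Suc n"]] by blast
    ultimately show ?case by (intro exI[of _ "max G G'"]) (auto simp: le_Suc_eq le_max_iff_disj)
  qed
  then obtain G where G: "\<And>t u. t \<le> T \<Longrightarrow> u \<in> space \<mu> \<Longrightarrow> norm (g t u) \<le> G" by blast
  have "norm (g (T + k) u) \<le> max G (R + s * M + s * \<rho> / 2)" if "u \<in> space \<mu>" for k u
  proof (induction k)
    case 0
    show ?case using G[of T u] that by simp
  next
    case (Suc k)
    then show ?case using step[of "T + k" u] that by (auto simp: max_def split: if_splits)
  qed
  then have "norm (g t u) \<le> max G (R + s * M + s * \<rho> / 2)" if "u \<in> space \<mu>" for t u
  proof (cases "t \<le> T")
    case True
    then show ?thesis using G[of t u] that by (simp add: le_max_iff_disj)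
  next
    case False
    then have "T + (t - T) = t" by simp
    then show ?thesis using \<open>\<And>k u. u \<in> space \<mu> \<Longrightarrow> norm (g (T + k) u) \<le> max G (R + s * M + s * \<rho> / 2)\<close>[of u "t - T"] that
      by simp
  qed
  then show ?thesis by blast
qed

lemma \<phi>_abs_le:
  assumes "u \<in> space \<mu>" "z \<in> space \<nu>" "\<bar>f0 u\<bar> \<le> F" "norm (g0 u) \<le> G" "\<bar>h0 z\<bar> \<le> H"
  shows "\<bar>\<phi> f0 g0 h0 (u, z)\<bar> \<le> F + G * M + H + C"
proof -
  have "\<bar>g0 u \<bullet> X z\<bar> \<le> norm (g0 u) * norm (X z)" by (rule Cauchy_Schwarz_ineq2)
  also have "\<dots> \<le> G * M" using assms X_bound[OF assms(2)] M_pos by (intro mult_mono') auto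
  finally show ?thesis
    using assms c_bound[of "(u, z)"] by (simp add: \<phi>_def space_pair_measure)
qed

text \<open>The bound on \<open>g\<close> passes to \<open>f'\<close> by \<open>fup_le\<close> and
  \<open>fup_ge\<close>, to \<open>f\<close> by centring, and to \<open>h'\<close> by
  \<open>h'_le\<close> and \<open>hup_ge\<close>. The later \<open>h t\<close> need no bound of
  their own, since by \<open>\<phi>_Suc\<close> recentring preserves the exponent.\<close>

lemma exponents_bounded:
  obtains B where
    "\<And>t p. p \<in> space (\<mu> \<Otimes>\<^sub>M \<nu>) \<Longrightarrow> \<bar>\<phi> (f t) (g t) (h t) p\<bar> \<le> B"
    "\<And>t p. p \<in> space (\<mu> \<Otimes>\<^sub>M \<nu>) \<Longrightarrow> \<bar>\<phi> (f t) (g t) (h' t) p\<bar> \<le> B"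
    "\<And>t p. p \<in> space (\<mu> \<Otimes>\<^sub>M \<nu>) \<Longrightarrow> \<bar>\<phi> (f' t) (g t) (h' t) p\<bar> \<le> B"
    "\<And>p. p \<in> space (\<mu> \<Otimes>\<^sub>M \<nu>) \<Longrightarrow> \<bar>\<phi> fb gb hb p\<bar> \<le> B"
proof -
  obtain G where G: "\<And>t u. u \<in> space \<mu> \<Longrightarrow> norm (g t u) \<le> G" using g_bounded by blast
  define F where "F = \<bar>C - Jt 0\<bar> + \<bar>G * M + C + C\<bar>"
  have f': "\<bar>f' t u\<bar> \<le> F" if "u \<in> space \<mu>" for t u
    using fup_le[OF gm hm' that, of t t] integral_h'_ge[of t] fup_ge[OF gm hm' that G[OF that] h'_le, of t t]
    unfolding F_def by (auto simp: abs_le_iff abs_if)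
  have mean_f': "\<bar>\<integral>u. f' t u \<partial>\<mu>\<bar> \<le> F" for t
  proof -
    have "\<bar>\<integral>u. f' t u \<partial>\<mu>\<bar> \<le> (\<integral>u. \<bar>f' t u\<bar> \<partial>\<mu>)" by (rule integral_abs_bound)
    also have "\<dots> \<le> (\<integral>u. F \<partial>\<mu>)" by (intro integral_mono integrable1 bd fm' f')
    finally show ?thesis by (simp add: M1.prob_space)
  qed
  \<comment> \<open>The initial potential gets its own bound; every later \<open>f t\<close> is some
    \<open>f'\<close> minus its mean, hence the 2 F.\<close>
  obtain F0 where F0: "\<And>u. u \<in> space \<mu> \<Longrightarrow> norm (f 0 u) \<le> F0"
    using bdmeas_bound[OF fm[of 0]] by blast
  have F: "\<bar>f t u\<bar> \<le> max F0 (2 * F)" if "u \<in> space \<mu>" for t u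
    using F0[OF that] f'[OF that, of "t - 1"] mean_f'[of "t - 1"] by (cases t) (auto simp: f_Suc)
  define H where "H = \<bar>C\<bar> + \<bar>max F0 (2 * F) + G * M + C\<bar>"
  have h': "\<bar>h' t z\<bar> \<le> H" if "z \<in> space \<nu>" for t z
  proof -
    have "- (max F0 (2 * F) + G * M + C) \<le> h' t z"
      using F by (intro hup_ge fm gm that G) (auto simp: abs_le_iff)
    then show ?thesis using h'_le[OF that, of t] unfolding H_def by (auto simp: abs_le_iff abs_if)
  qed
  have g': "norm (g' t u) \<le> G + s * M" if "u \<in> space \<mu>" for t u
  proof -
    have "norm (g' t u) \<le> norm (g t u) + norm (s *\<^sub>R d t u)" by (rule norm_triangle_ineq4)
    also have "\<dots> \<le> G + s * M"
      using G[OF that] norm_dg_le[OF gm hm' that, of t t] s_pos by (intro add_mono) (auto intro!: mult_left_mono)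
    finally show ?thesis .
  qed
  obtain B0 where B0: "\<And>p. p \<in> space (\<mu> \<Otimes>\<^sub>M \<nu>) \<Longrightarrow> norm (\<phi> (f 0) (g 0) (h 0) p) \<le> B0"
    using bdmeas_bound[OF bdmeas_\<phi>[OF fm gm hm]] by blast
  obtain B1 where B1: "\<And>p. p \<in> space (\<mu> \<Otimes>\<^sub>M \<nu>) \<Longrightarrow> norm (\<phi> fb gb hb p) \<le> B1"
    using bdmeas_bound[OF bdmeas_\<phi>[OF bar]] by blast
  define B2 where "B2 = F + (G + s * M) * M + H + C"
  define B3 where "B3 = max F0 (2 * F) + G * M + H + C"
  define B4 where "B4 = F + G * M + H + C"
  show ?thesis
  proof (rule that[of "max (max B0 B1) (max B2 (max B3 B4))"])
    fix t p assume p: "p \<in> space (\<mu> \<Otimes>\<^sub>M \<nu>)"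
    then obtain u z where uz: "p = (u, z)" "u \<in> space \<mu>" "z \<in> space \<nu>" by (auto simp: space_pair_measure)
    show "\<bar>\<phi> (f t) (g t) (h t) p\<bar> \<le> max (max B0 B1) (max B2 (max B3 B4))"
    proof (cases t)
      case 0
      then show ?thesis using B0[OF p] by (auto simp: le_max_iff_disj)
    next
      case (Suc n)
      have "\<bar>\<phi> (f t) (g t) (h t) p\<bar> \<le> B2"
        unfolding Suc \<phi>_Suc B2_def uz(1) by (intro \<phi>_abs_le uz f' g' h')
      then show ?thesis by (auto simp: le_max_iff_disj)
    qed
    have "\<bar>\<phi> (f t) (g t) (h' t) p\<bar> \<le> B3" unfolding B3_def uz(1) by (intro \<phi>_abs_le uz F G h')
    then show "\<bar>\<phi> (f t) (g t) (h' t) p\<bar> \<le> max (max B0 B1) (max B2 (max B3 B4))"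
      by (auto simp: le_max_iff_disj)
    have "\<bar>\<phi> (f' t) (g t) (h' t) p\<bar> \<le> B4" unfolding B4_def uz(1) by (intro \<phi>_abs_le uz f' G h')
    then show "\<bar>\<phi> (f' t) (g t) (h' t) p\<bar> \<le> max (max B0 B1) (max B2 (max B3 B4))"
      by (auto simp: le_max_iff_disj)
  next
    fix p assume "p \<in> space (\<mu> \<Otimes>\<^sub>M \<nu>)"
    from B1[OF this] show "\<bar>\<phi> fb gb hb p\<bar> \<le> max (max B0 B1) (max B2 (max B3 B4))"
      by (auto simp: le_max_iff_disj)
  qed
qed

text \<open>The gap after a step is at most \<theta> times the gain of that step, so with \<tau> = 1
  / \<theta> each step divides the gap by at least 1 + \<tau>. In \<theta>, c1 / \<gamma> prices the
  gradient term and c2 / \<alpha> the change of \<open>f\<close>; each is charged to the whole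
  increment, as all partial gains are nonnegative.\<close>

lemma linear_convergence:
  obtains \<tau> A where "\<tau> > 0"
    "\<And>t. Jb - Jt t \<le> (1 + \<tau>) powr (- real t) * (Jb - Jt 0)"
    "\<And>t. (\<integral>u. (f t u - fb u)\<^sup>2 \<partial>\<mu>) + (\<integral>u. (norm (g t u - gb u))\<^sup>2 \<partial>\<mu>) + (\<integral>z. (h t z - hb z)\<^sup>2 \<partial>\<nu>)
      \<le> A * (1 + \<tau>) powr (- real t)"
proof -
  obtain B where B:
    "\<And>t p. p \<in> space (\<mu> \<Otimes>\<^sub>M \<nu>) \<Longrightarrow> \<bar>\<phi> (f t) (g t) (h t) p\<bar> \<le> B"
    "\<And>t p. p \<in> space (\<mu> \<Otimes>\<^sub>M \<nu>) \<Longrightarrow> \<bar>\<phi> (f t) (g t) (h' t) p\<bar> \<le> B"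
    "\<And>t p. p \<in> space (\<mu> \<Otimes>\<^sub>M \<nu>) \<Longrightarrow> \<bar>\<phi> (f' t) (g t) (h' t) p\<bar> \<le> B"
    "\<And>p. p \<in> space (\<mu> \<Otimes>\<^sub>M \<nu>) \<Longrightarrow> \<bar>\<phi> fb gb hb p\<bar> \<le> B"
    using exponents_bounded by blast
  define \<alpha> where "\<alpha> = exp (- B) / 2"
  define c1 where "c1 = exp B / (2 * lam)"
  define c2 where "c2 = exp (7 * B) / 2"
  define \<theta> where "\<theta> = c1 / \<gamma> + c2 / \<alpha>"
  have pos: "\<alpha> > 0" "c1 > 0" "c2 > 0" using lam_pos by (simp_all add: \<alpha>_def c1_def c2_def)
  then have \<theta>: "\<theta> > 0" using \<gamma>_pos by (simp add: \<theta>_def add_pos_pos)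
  have gap: "Jb - Jt (Suc t) \<le> \<theta> * (Jt (Suc t) - Jt t)" for t
  proof -
    let ?D = "\<integral>u. (norm (d t u))\<^sup>2 \<partial>\<mu>" and ?E = "\<integral>u. (f' t u - f t u)\<^sup>2 \<partial>\<mu>"
    have D: "\<gamma> * ?D \<le> Jt (Suc t) - J (f' t) (g t) (h' t)" by (rule gain_d)
    have E: "\<alpha> * ?E \<le> J (f' t) (g t) (h' t) - J (f t) (g t) (h' t)"
      unfolding \<alpha>_def by (intro J_fup_gain fm gm hm' B)
    have nn: "0 \<le> \<gamma> * ?D" "0 \<le> \<alpha> * ?E" using pos \<gamma>_pos by simp_all
    have DE: "\<gamma> * ?D \<le> Jt (Suc t) - Jt t" "\<alpha> * ?E \<le> Jt (Suc t) - Jt t"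
      using D E nn Jt_le_h'[of t] by linarith+
    \<comment> \<open>The gap is estimated before the gradient step, which can only raise the
      objective.\<close>
    have "Jb - Jt (Suc t) \<le> Jb - J (f' t) (g t) (h' t)" using D nn by linarith
    also have "\<dots> \<le> c1 * ?D + c2 * ?E"
      unfolding c1_def c2_def
      by (rule gap_le_gains[OF fm gm bar iterates_centred(2) bar_centred refl refl B(3,2,4)])
    also have "\<dots> = c1 / \<gamma> * (\<gamma> * ?D) + c2 / \<alpha> * (\<alpha> * ?E)" using pos \<gamma>_pos by simp
    also have "\<dots> \<le> c1 / \<gamma> * (Jt (Suc t) - Jt t) + c2 / \<alpha> * (Jt (Suc t) - Jt t)"
      using DE pos \<gamma>_pos by (intro add_mono mult_left_mono) auto
    finally show ?thesis by (simp add: \<theta>_def algebra_simps)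
  qed
  define \<tau> where "\<tau> = 1 / \<theta>"
  have \<tau>: "\<tau> > 0" using \<theta> by (simp add: \<tau>_def)
  have contract: "Jb - Jt (Suc t) \<le> (Jb - Jt t) / (1 + \<tau>)" for t
  proof -
    have "\<tau> * (Jb - Jt (Suc t)) \<le> Jt (Suc t) - Jt t"
      using gap[of t] \<theta> by (simp add: \<tau>_def field_simps)
    then have "(1 + \<tau>) * (Jb - Jt (Suc t)) \<le> Jb - Jt t" by (simp add: algebra_simps)
    then show ?thesis using \<tau> by (simp add: field_simps)
  qed
  have rate: "Jb - Jt t \<le> (1 + \<tau>) powr (- real t) * (Jb - Jt 0)" for t
  proof (induction t)
    case (Suc t)
    have e: "- real (Suc t) = - real t - 1" by simp
    have "Jb - Jt (Suc t) \<le> (Jb - Jt t) / (1 + \<tau>)" by (rule contract)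
    also have "\<dots> \<le> (1 + \<tau>) powr (- real t) * (Jb - Jt 0) / (1 + \<tau>)"
      using Suc \<tau> by (intro divide_right_mono) auto
    also have "\<dots> = (1 + \<tau>) powr (- real (Suc t)) * (Jb - Jt 0)"
      unfolding e powr_diff using \<tau> by simp
    finally show ?case .
  qed (use \<tau> in simp)
  \<comment> \<open>\<open>gap_ge\<close> weights the part in \<open>g\<close> by
    \<open>lam\<close>; the unweighted sum costs the factor min 1 lam.\<close>
  define l where "l = min 1 lam"
  have l: "0 < l" "l \<le> 1" "l \<le> lam" using lam_pos by (auto simp: l_def)
  show ?thesis
  proof (rule that[OF \<tau> rate])
    fix t
    let ?x = "\<integral>u. (f t u - fb u)\<^sup>2 \<partial>\<mu>" and ?y = "\<integral>u. (norm (g t u - gb u))\<^sup>2 \<partial>\<mu>"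
      and ?z = "\<integral>z. (h t z - hb z)\<^sup>2 \<partial>\<nu>"
    have "l * ?x \<le> 1 * ?x" "l * ?y \<le> lam * ?y" "l * ?z \<le> 1 * ?z"
      using l by (intro mult_right_mono; simp)+
    then have "l * (?x + ?y + ?z) \<le> ?x + lam * ?y + ?z" by (simp add: algebra_simps)
    then have "\<alpha> * (l * (?x + ?y + ?z)) \<le> \<alpha> * (?x + lam * ?y + ?z)"
      using pos by (intro mult_left_mono) auto
    also have "\<dots> \<le> Jb - Jt t" unfolding \<alpha>_def by (intro gap_ge B)
    also have "\<dots> \<le> (1 + \<tau>) powr (- real t) * (Jb - Jt 0)" by (rule rate)
    finally show "?x + ?y + ?z \<le> (Jb - Jt 0) / (\<alpha> * l) * (1 + \<tau>) powr (- real t)"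
      using pos l by (simp add: field_simps)
  qed
qed

end

section \<open>Supports and rescaling\<close>

lemma open_Compl_msupport: "open (- msupport M)"
proof -
  have "- msupport M = \<Union>{S. open S \<and> emeasure M S = 0}"
    by (auto simp: msupport_def)
  then show ?thesis by (auto simp del: Union_iff)
qed

text \<open>The complement of the support is a union of open null sets, and by the Lindelof property
  countably many of them cover it.\<close>

lemma AE_in_msupport:
  fixes M :: "'a::second_countable_topology measure"
  assumes "sets M = sets borel"
  shows "AE x in M. x \<in> msupport M"
proof -
  let ?F = "{S. open S \<and> emeasure M S = 0}"
  obtain F where F: "F \<subseteq> ?F" "countable F" "\<Union>F = \<Union>?F"
    using Lindelof[of ?F] by auto
  have "(\<Union>S\<in>F. S) \<in> null_sets M"
    using F(1,2) assms by (intro null_sets_UN') (auto simp: null_sets_def)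
  moreover have "{x \<in> space M. x \<notin> msupport M} \<subseteq> \<Union>F"
    unfolding F(3) by (auto simp: msupport_def)
  ultimately show ?thesis by (auto intro: AE_I')
qed

lemma closed_suppX: "closed (suppX \<nu>)" and closed_suppY: "closed (suppY \<nu>)"
  by (simp_all add: suppX_def suppY_def closed_def open_Compl_msupport)

lemma AE_in_suppXY:
  fixes \<nu> :: "((real^'m) \<times> (real^'n)) measure"
  assumes "sets \<nu> = sets borel"
  shows "AE z in \<nu>. z \<in> suppXY \<nu>"
proof -
  have m: "fst \<in> \<nu> \<rightarrow>\<^sub>M borel" "snd \<in> \<nu> \<rightarrow>\<^sub>M borel"
    unfolding measurable_cong_sets[OF assms refl]
    by (auto intro!: borel_measurable_continuous_onI continuous_intros)
  have s: "{x \<in> space borel. x \<in> suppX \<nu>} \<in> sets borel" "{x \<in> space borel. x \<in> suppY \<nu>} \<in> sets borel"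
    using closed_suppX[of \<nu>] closed_suppY[of \<nu>] by auto
  have "AE z in \<nu>. fst z \<in> suppX \<nu>"
    using AE_in_msupport[of "distr \<nu> borel fst"] AE_distr_iff[OF m(1) s(1)] by (simp add: suppX_def)
  moreover have "AE z in \<nu>. snd z \<in> suppY \<nu>"
    using AE_in_msupport[of "distr \<nu> borel snd"] AE_distr_iff[OF m(2) s(2)] by (simp add: suppY_def)
  ultimately show ?thesis by eventually_elim (auto simp: suppXY_def mem_Times_iff)
qed

lemma integral_restrict_AE:
  fixes f :: "'a \<Rightarrow> 'b::euclidean_space"
  assumes A: "A \<in> sets M" "AE x in M. x \<in> A" and f: "f \<in> borel_measurable M"
  shows "(\<integral>x. f x \<partial>restrict_space M A) = (\<integral>x. f x \<partial>M)"
proof -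
  have "(\<integral>x. f x \<partial>restrict_space M A) = (\<integral>x. indicator A x *\<^sub>R f x \<partial>M)"
    using A(1) by (intro integral_restrict_space) auto
  also have "\<dots> = (\<integral>x. f x \<partial>M)"
    using A f by (intro integral_cong_AE) auto
  finally show ?thesis .
qed

lemma bdmeas_continuous_on:
  fixes f :: "'a::topological_space \<Rightarrow> 'b::euclidean_space"
  assumes "compact A" "continuous_on A f" "sets M = sets borel"
  shows "bdmeas (restrict_space M A) f"
proof -
  have "bounded (f ` A)" using assms by (intro compact_imp_bounded compact_continuous_image)
  then obtain B where "\<And>x. x \<in> A \<Longrightarrow> norm (f x) \<le> B" by (auto simp: bounded_iff)
  moreover have "f \<in> borel_measurable (restrict_space M A)"
    using borel_measurable_continuous_on_restrict[OF assms(2)]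
      measurable_cong_sets[OF sets_restrict_space_cong[OF assms(3)] refl] by blast
  ultimately show ?thesis by (intro bdmeasI) (auto simp: space_restrict_space)
qed

text \<open>No eigenvalues are involved: an inverse of \<open>A\<close> with operator bound
  \<open>L\<close> gives |v| <= L |A v|, and pairing A v with itself through the quadratic form
  gives |A v| <= M E|v . X|. Squaring, with Jensen, yields lam = 1 / (L^2 M^2).\<close>

lemma second_moment_coercive:
  fixes N :: "((real^'m) \<times> (real^'n)) measure" and A :: "real^'m^'m"
  assumes N: "prob_space N" and bd: "bdmeas N fst" "\<And>z. z \<in> space N \<Longrightarrow> norm (fst z) \<le> M"
    and M: "M > 0" and A: "A = (\<chi> i j. LINT z|N. fst z $ i * fst z $ j)" and inv: "invertible A"
  obtains lam where "lam > 0" "\<And>v. lam * (norm v)\<^sup>2 \<le> (LINT z|N. (v \<bullet> fst z)\<^sup>2)"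
proof -
  interpret prob_space N by fact
  note int = bdmeas_integrable[OF finite_measure_axioms]
  have comp: "bdmeas N (\<lambda>z. fst z $ i)" for i
    using bdmeas_inner[OF bd(1) bdmeas_const[of _ "axis i 1"]] by (simp add: inner_axis)
  have quad: "w \<bullet> (A *v v) = (LINT z|N. (w \<bullet> fst z) * (v \<bullet> fst z))" for w v
  proof -
    have "(LINT z|N. (w \<bullet> fst z) * (v \<bullet> fst z)) =
        (LINT z|N. (\<Sum>i\<in>UNIV. \<Sum>j\<in>UNIV. w $ i * v $ j * (fst z $ i * fst z $ j)))"
      by (simp only: inner_vec_def sum_product) (simp add: mult_ac)
    also have "\<dots> = (\<Sum>i\<in>UNIV. \<Sum>j\<in>UNIV. w $ i * v $ j * A $ i $ j)"
      unfolding A by (simp add: Bochner_Integration.integral_sum int bdmeas_intros comp)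
    also have "\<dots> = w \<bullet> (A *v v)"
      by (simp add: inner_vec_def matrix_vector_mult_def sum_distrib_left mult_ac)
    finally show ?thesis by simp
  qed
  obtain A' where A': "A' ** A = mat 1" using inv by (auto simp: invertible_def)
  obtain L where L: "L > 0" "\<And>w. norm (A' *v w) \<le> norm w * L"
    using bounded_linear.pos_bounded[OF matrix_vector_mul_bounded_linear[of A']] by blast
  have Av: "(norm (A *v v))\<^sup>2 \<le> M\<^sup>2 * (LINT z|N. (v \<bullet> fst z)\<^sup>2)" for v
  proof -
    let ?w = "A *v v"
    have "(norm ?w)\<^sup>2 = (LINT z|N. (?w \<bullet> fst z) * (v \<bullet> fst z))"
      using quad[of ?w v] by (simp add: power2_norm_eq_inner)
    also have "\<dots> \<le> (LINT z|N. norm ?w * M * \<bar>v \<bullet> fst z\<bar>)"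
    proof (intro integral_mono int bdmeas_intros bd)
      fix z assume "z \<in> space N"
      have "(?w \<bullet> fst z) * (v \<bullet> fst z) \<le> \<bar>?w \<bullet> fst z\<bar> * \<bar>v \<bullet> fst z\<bar>"
        by (metis abs_ge_self abs_mult)
      also have "\<dots> \<le> (norm ?w * norm (fst z)) * \<bar>v \<bullet> fst z\<bar>"
        by (intro mult_right_mono Cauchy_Schwarz_ineq2) auto
      also have "\<dots> \<le> norm ?w * M * \<bar>v \<bullet> fst z\<bar>"
        using bd(2)[OF \<open>z \<in> space N\<close>] by (intro mult_right_mono mult_left_mono) auto
      finally show "(?w \<bullet> fst z) * (v \<bullet> fst z) \<le> norm ?w * M * \<bar>v \<bullet> fst z\<bar>" .
    qed
    also have "\<dots> = norm ?w * (M * (LINT z|N. \<bar>v \<bullet> fst z\<bar>))" by simp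
    finally have *: "norm ?w * norm ?w \<le> norm ?w * (M * (LINT z|N. \<bar>v \<bullet> fst z\<bar>))"
      by (simp add: power2_eq_square)
    have nn: "0 \<le> M * (LINT z|N. \<bar>v \<bullet> fst z\<bar>)" using M by simp
    have "norm ?w \<le> M * (LINT z|N. \<bar>v \<bullet> fst z\<bar>)"
    proof (cases "?w = 0")
      case True
      then show ?thesis using nn by simp
    next
      case False
      then show ?thesis using mult_left_le_imp_le[OF *] by simp
    qed
    then have "(norm ?w)\<^sup>2 \<le> (M * (LINT z|N. \<bar>v \<bullet> fst z\<bar>))\<^sup>2" by (rule power_mono) simp
    also have "\<dots> = M\<^sup>2 * (LINT z|N. \<bar>v \<bullet> fst z\<bar>)\<^sup>2" by (simp add: power_mult_distrib)
    also have "\<dots> \<le> M\<^sup>2 * (LINT z|N. \<bar>v \<bullet> fst z\<bar>\<^sup>2)"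
      by (intro mult_left_mono expectation_square_le bdmeas_intros bd) auto
    finally show ?thesis by simp
  qed
  show ?thesis
  proof (rule that[of "1 / (L\<^sup>2 * M\<^sup>2)"])
    fix v
    have "norm v = norm (A' *v (A *v v))" by (simp add: matrix_vector_mul_assoc A')
    also have "\<dots> \<le> norm (A *v v) * L" by (rule L)
    finally have "(norm v)\<^sup>2 \<le> (norm (A *v v) * L)\<^sup>2" by (rule power_mono) simp
    also have "\<dots> = L\<^sup>2 * (norm (A *v v))\<^sup>2" by (simp add: power_mult_distrib)
    also have "\<dots> \<le> L\<^sup>2 * (M\<^sup>2 * (LINT z|N. (v \<bullet> fst z)\<^sup>2))"
      by (intro mult_left_mono Av) auto
    finally have "(norm v)\<^sup>2 \<le> L\<^sup>2 * M\<^sup>2 * (LINT z|N. (v \<bullet> fst z)\<^sup>2)" by (simp add: mult_ac)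
    then show "1 / (L\<^sup>2 * M\<^sup>2) * (norm v)\<^sup>2 \<le> (LINT z|N. (v \<bullet> fst z)\<^sup>2)"
      using L(1) M by (simp add: pos_divide_le_eq mult_ac)
  qed (use L(1) M in simp)
qed

text \<open>The potentials are arbitrary off the supports. Restricting the measures makes the
  supports the whole spaces, so that boundedness and the Schroedinger system hold at every point of
  the space.\<close>

locale vqr = vector_sinkhorn "restrict_space \<mu> (msupport \<mu>)" "restrict_space \<nu> (suppXY \<nu>)" fst
    "\<lambda>p. cost (fst p) (snd (snd p)) / \<epsilon>" M lam C
  for \<mu> :: "(real^'n) measure" and \<nu> :: "((real^'m) \<times> (real^'n)) measure" and \<epsilon> M lam C :: real +
  assumes \<epsilon>_pos: "\<epsilon> > 0"
    and prob_\<mu>: "prob_space \<mu>" and prob_\<nu>: "prob_space \<nu>"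
    and sets_\<mu>: "sets \<mu> = sets borel" and sets_\<nu>: "sets \<nu> = sets borel"
begin

abbreviation "\<mu>' \<equiv> restrict_space \<mu> (msupport \<mu>)"
abbreviation "\<nu>' \<equiv> restrict_space \<nu> (suppXY \<nu>)"

lemma msupport_sets: "msupport \<mu> \<in> sets \<mu>"
  using open_Compl_msupport[of \<mu>] by (simp add: sets_\<mu> closed_def[symmetric])

lemma suppXY_sets: "suppXY \<nu> \<in> sets \<nu>"
  using closed_Times[OF closed_suppX[of \<nu>] closed_suppY[of \<nu>]] by (simp add: sets_\<nu> suppXY_def)

lemma set_integral_\<mu>:
  fixes k :: "real^'n \<Rightarrow> 'b::euclidean_space"
  shows "(LINT u:msupport \<mu>|\<mu>. k u) = (\<integral>u. k u \<partial>\<mu>')"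
  unfolding set_lebesgue_integral_def using msupport_sets by (subst integral_restrict_space) auto

lemma set_integral_\<nu>:
  fixes k :: "(real^'m) \<times> (real^'n) \<Rightarrow> 'b::euclidean_space"
  shows "(LINT z:suppXY \<nu>|\<nu>. k z) = (\<integral>z. k z \<partial>\<nu>')"
  unfolding set_lebesgue_integral_def using suppXY_sets by (subst integral_restrict_space) auto

lemma h_update_eq:
  assumes "\<And>u. f u = \<epsilon> * F u" "\<And>u. g u = \<epsilon> *\<^sub>R G u"
  shows "h_update \<mu> \<epsilon> f g z = \<epsilon> * hup F G z"
  using \<epsilon>_pos
  by (simp add: h_update_def hup_def set_integral_\<mu> assms case_prod_beta add_divide_distrib diff_divide_distrib)

lemma f_update_eq:
  assumes "g u = \<epsilon> *\<^sub>R G u" "\<And>z. z \<in> suppXY \<nu> \<Longrightarrow> h z = \<epsilon> * H z"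
  shows "f_update \<nu> \<epsilon> g h u = \<epsilon> * fup G H u"
proof -
  have "(\<integral>z. exp ((g u \<bullet> fst z + h z - cost u (snd z)) / \<epsilon>) \<partial>\<nu>') = (\<integral>z. exp (G u \<bullet> fst z + H z - cost u (snd z) / \<epsilon>) \<partial>\<nu>')"
    using \<epsilon>_pos by (intro Bochner_Integration.integral_cong)
      (auto simp: space_restrict_space assms add_divide_distrib diff_divide_distrib)
  then show ?thesis
    by (simp add: f_update_def fup_def set_integral_\<nu> case_prod_beta)
qed

lemma x_moment_eq:
  assumes "g u = \<epsilon> *\<^sub>R G u" "\<And>z. z \<in> suppXY \<nu> \<Longrightarrow> h z = \<epsilon> * H z"
  shows "x_moment \<nu> \<epsilon> g h u = (\<integral>z. exp (G u \<bullet> fst z + H z - cost u (snd z) / \<epsilon>) *\<^sub>R fst z \<partial>\<nu>')"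
proof -
  have "(\<integral>z. exp ((g u \<bullet> fst z + h z - cost u (snd z)) / \<epsilon>) *\<^sub>R fst z \<partial>\<nu>') = (\<integral>z. exp (G u \<bullet> fst z + H z - cost u (snd z) / \<epsilon>) *\<^sub>R fst z \<partial>\<nu>')"
    using \<epsilon>_pos by (intro Bochner_Integration.integral_cong)
      (auto simp: space_restrict_space assms add_divide_distrib diff_divide_distrib)
  then show ?thesis
    by (simp add: x_moment_def set_integral_\<nu> case_prod_beta)
qed

text \<open>Tonelli on both products reduces this to restricting one variable at a time.\<close>

lemma nn_integral_restrict_pair:
  assumes k: "k \<in> borel_measurable (\<mu>' \<Otimes>\<^sub>M \<nu>')"
    and k': "(\<lambda>p. k p * indicator (msupport \<mu> \<times> suppXY \<nu>) p) \<in> borel_measurable (\<mu> \<Otimes>\<^sub>M \<nu>)"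
  shows "(\<integral>\<^sup>+p. k p * indicator (msupport \<mu> \<times> suppXY \<nu>) p \<partial>(\<mu> \<Otimes>\<^sub>M \<nu>)) = (\<integral>\<^sup>+p. k p \<partial>(\<mu>' \<Otimes>\<^sub>M \<nu>'))"
proof -
  interpret \<nu>: prob_space \<nu> by (rule prob_\<nu>)
  have "(\<integral>\<^sup>+p. k p * indicator (msupport \<mu> \<times> suppXY \<nu>) p \<partial>(\<mu> \<Otimes>\<^sub>M \<nu>)) =
      (\<integral>\<^sup>+u. (\<integral>\<^sup>+z. k (u, z) * indicator (msupport \<mu> \<times> suppXY \<nu>) (u, z) \<partial>\<nu>) \<partial>\<mu>)"
    by (rule \<nu>.nn_integral_fst[symmetric]) (rule k')
  also have "\<dots> = (\<integral>\<^sup>+u. (\<integral>\<^sup>+z. k (u, z) * indicator (suppXY \<nu>) z \<partial>\<nu>) * indicator (msupport \<mu>) u \<partial>\<mu>)"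
    by (intro nn_integral_cong) (auto simp: indicator_def)
  also have "\<dots> = (\<integral>\<^sup>+u. (\<integral>\<^sup>+z. k (u, z) \<partial>\<nu>') \<partial>\<mu>')"
    using msupport_sets suppXY_sets by (simp add: nn_integral_restrict_space)
  also have "\<dots> = (\<integral>\<^sup>+p. k p \<partial>(\<mu>' \<Otimes>\<^sub>M \<nu>'))"
    by (rule M2.nn_integral_fst) (rule k)
  finally show ?thesis .
qed

text \<open>Bounded potentials make the exponential integrable, so the extended-real objective is
  finite and the Bochner integral in \<open>J\<close> computes it.\<close>

lemma dual_objective_eq:
  assumes F: "bdmeas \<mu>' F" "bdmeas \<mu>' G" "bdmeas \<nu>' H"
    and f: "\<And>u. f u = \<epsilon> * F u" "\<And>u. g u = \<epsilon> *\<^sub>R G u" "\<And>z. h z = \<epsilon> * H z"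
  shows "dual_objective \<mu> \<nu> \<epsilon> f g h = ereal (\<epsilon> * J F G H)"
proof -
  let ?U = "msupport \<mu>" and ?S = "suppXY \<nu>"
  have U: "?U \<inter> space \<mu> \<in> sets \<mu>" and S: "?S \<inter> space \<nu> \<in> sets \<nu>"
    using msupport_sets suppXY_sets by auto
  \<comment> \<open>Measurability is known on the supports only. Extension by zero gives it on the
    full product, and the indicator hides the change.\<close>
  define F0 where "F0 = (\<lambda>u. indicator ?U u *\<^sub>R F u)"
  define G0 where "G0 = (\<lambda>u. indicator ?U u *\<^sub>R G u)"
  define H0 where "H0 = (\<lambda>z. indicator ?S z *\<^sub>R H z)"
  have [measurable]: "F0 \<in> borel_measurable \<mu>" "G0 \<in> borel_measurable \<mu>" "H0 \<in> borel_measurable \<nu>"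
    using F[THEN bdmeas_measurable] borel_measurable_restrict_space_iff[OF U] borel_measurable_restrict_space_iff[OF S]
    unfolding F0_def G0_def H0_def by blast+
  have [measurable]: "(\<lambda>u. u) \<in> borel_measurable \<mu>" "(\<lambda>z. fst z) \<in> borel_measurable \<nu>" "(\<lambda>z. snd z) \<in> borel_measurable \<nu>"
    unfolding measurable_cong_sets[OF sets_\<nu> refl] measurable_cong_sets[OF sets_\<mu> refl]
    by (auto intro!: borel_measurable_continuous_onI continuous_intros)
  have [measurable]: "?U \<in> sets \<mu>" "?S \<in> sets \<nu>" by (rule msupport_sets suppXY_sets)+
  have UV: "?U \<times> ?S \<in> sets (\<mu> \<Otimes>\<^sub>M \<nu>)" by measurable
  let ?k = "\<lambda>p. ennreal (K F G H p)"
  have k: "?k \<in> borel_measurable (\<mu>' \<Otimes>\<^sub>M \<nu>')"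
    using bdmeas_measurable[OF bdmeas_K[OF F]] by measurable
  have "(\<lambda>p. ennreal (exp (F0 (fst p) + G0 (fst p) \<bullet> fst (snd p) + H0 (snd p) - (norm (fst p - snd (snd p)))\<^sup>2 / 2 / \<epsilon>)) * indicator (?U \<times> ?S) p)
     \<in> borel_measurable (\<mu> \<Otimes>\<^sub>M \<nu>)"
    using UV by measurable
  moreover have "ennreal (exp (F0 (fst p) + G0 (fst p) \<bullet> fst (snd p) + H0 (snd p) - (norm (fst p - snd (snd p)))\<^sup>2 / 2 / \<epsilon>)) * indicator (?U \<times> ?S) p
     = ?k p * indicator (?U \<times> ?S) p" for p
    unfolding K_def \<phi>_def by (cases p) (auto simp: indicator_def F0_def G0_def H0_def cost_def)
  ultimately have k': "(\<lambda>p. ?k p * indicator (?U \<times> ?S) p) \<in> borel_measurable (\<mu> \<Otimes>\<^sub>M \<nu>)" by (simp only:)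
  have "(\<integral>\<^sup>+p. ?k p * indicator (?U \<times> ?S) p \<partial>(\<mu> \<Otimes>\<^sub>M \<nu>)) = (\<integral>\<^sup>+p. ?k p \<partial>(\<mu>' \<Otimes>\<^sub>M \<nu>'))"
    by (rule nn_integral_restrict_pair[OF k k'])
  also have "\<dots> = ennreal (\<integral>p. K F G H p \<partial>(\<mu>' \<Otimes>\<^sub>M \<nu>'))"
    by (intro nn_integral_eq_integral integrable12 bdmeas_K F) (simp add: K_def)
  finally have "(\<integral>\<^sup>+p. ?k p * indicator (?U \<times> ?S) p \<partial>(\<mu> \<Otimes>\<^sub>M \<nu>)) = ennreal (\<integral>p. K F G H p \<partial>(\<mu>' \<Otimes>\<^sub>M \<nu>'))" .
  moreover have "(\<integral>\<^sup>+(u, x, y)\<in>?U \<times> ?S. ennreal (exp ((f u + g u \<bullet> x + h (x, y) - cost u y) / \<epsilon>)) \<partial>(\<mu> \<Otimes>\<^sub>M \<nu>))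
     = (\<integral>\<^sup>+p. ?k p * indicator (?U \<times> ?S) p \<partial>(\<mu> \<Otimes>\<^sub>M \<nu>))"
    using \<epsilon>_pos by (intro nn_integral_cong)
      (simp add: case_prod_beta f K_def \<phi>_def add_divide_distrib diff_divide_distrib)
  moreover have "0 \<le> (\<integral>p. K F G H p \<partial>(\<mu>' \<Otimes>\<^sub>M \<nu>'))" by (simp add: K_def)
  moreover have "(LINT u:?U|\<mu>. f u) = \<epsilon> * (\<integral>u. F u \<partial>\<mu>')" "(LINT (x, y):?S|\<nu>. h (x, y)) = \<epsilon> * (\<integral>z. H z \<partial>\<nu>')"
    by (simp_all add: set_integral_\<mu> set_integral_\<nu> f case_prod_beta)
  ultimately show ?thesis
    unfolding dual_objective_def J_def
    by (simp add: one_ereal_def algebra_simps)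
qed

end

section \<open>Return to the original potentials\<close>

theorem theorem4p1:
  fixes \<mu> :: "(real^'n) measure" and \<nu> :: "((real^'m) \<times> (real^'n)) measure"
    and \<epsilon> \<eta> :: real
    and f :: "nat \<Rightarrow> real^'n \<Rightarrow> real" and g :: "nat \<Rightarrow> real^'n \<Rightarrow> real^'m"
    and h :: "nat \<Rightarrow> (real^'m) \<times> (real^'n) \<Rightarrow> real"
    and fb :: "real^'n \<Rightarrow> real" and gb :: "real^'n \<Rightarrow> real^'m"
    and hb :: "(real^'m) \<times> (real^'n) \<Rightarrow> real"
  assumes "prob_space \<mu>" and "sets \<mu> = sets borel"
    and "prob_space \<nu>" and "sets \<nu> = sets borel"
    and "compact (msupport \<mu>)" and "compact (suppX \<nu>)" and "compact (suppY \<nu>)"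
    and "(LINT z|\<nu>. fst z) = 0" and "invertible (second_moment_X \<nu>)"
    and "\<epsilon> > 0"
    and "0 < \<eta>" and "\<eta> < 2 * \<epsilon> / (M_X \<nu>)\<^sup>2"
    and "admissible \<mu> \<nu> (f 0) (g 0) (h 0)"
    and "\<And>t. (f (Suc t), g (Suc t), h (Suc t)) = sinkhorn_step \<mu> \<nu> \<epsilon> \<eta> (f t, g t, h t)"
    and "dual_potentials \<mu> \<nu> \<epsilon> fb gb hb"
  shows "\<exists>\<tau>>0.
    (\<forall>t. dual_objective \<mu> \<nu> \<epsilon> fb gb hb - dual_objective \<mu> \<nu> \<epsilon> (f t) (g t) (h t)
       \<le> ereal ((1 + \<tau>) powr (- real t)) *
          (dual_objective \<mu> \<nu> \<epsilon> fb gb hb - dual_objective \<mu> \<nu> \<epsilon> (f 0) (g 0) (h 0))) \<and>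
    (\<lambda>t. L2_norm_sq \<mu> (msupport \<mu>) (\<lambda>u. f t u - fb u)
        + L2_norm_sq \<mu> (msupport \<mu>) (\<lambda>u. g t u - gb u)
        + L2_norm_sq \<nu> (suppXY \<nu>) (\<lambda>z. h t z - hb z))
      \<in> O(\<lambda>t. (1 + \<tau>) powr (- real t))"
proof -
  note \<mu> = assms(1,2) and \<nu> = assms(3,4)
  let ?U = "msupport \<mu>" and ?S = "suppXY \<nu>"
  let ?\<mu> = "restrict_space \<mu> ?U" and ?\<nu> = "restrict_space \<nu> ?S"
  let ?c = "\<lambda>p :: (real^'n) \<times> (real^'m) \<times> (real^'n). cost (fst p) (snd (snd p)) / \<epsilon>"
  have S: "compact ?S" unfolding suppXY_def by (intro compact_Times assms)
  have sets: "?U \<in> sets \<mu>" "?S \<in> sets \<nu>"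
    using compact_imp_closed[OF assms(5)] compact_imp_closed[OF S] \<mu> \<nu> by auto
  have AE: "AE u in \<mu>. u \<in> ?U" "AE z in \<nu>. z \<in> ?S"
    by (rule AE_in_msupport[OF \<mu>(2)] AE_in_suppXY[OF \<nu>(2)])+
  have p: "prob_space ?\<mu>" "prob_space ?\<nu>"
    using sets AE \<mu>(1) \<nu>(1) by (auto intro!: prob_space_restrict_space prob_space.emeasure_eq_1_AE)
  have space: "space ?\<mu> = ?U" "space ?\<nu> = ?S"
    using sets.sets_into_space[OF sets(1)] sets.sets_into_space[OF sets(2)] by (auto simp: space_restrict_space)
  have fst_bd: "bdmeas ?\<nu> fst" by (intro bdmeas_continuous_on S \<nu>(2) continuous_intros)
  have fst_le: "norm (fst z) \<le> M_X \<nu>" if "z \<in> ?S" for z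
  proof -
    have "compact (norm ` suppX \<nu>)" by (intro compact_continuous_image continuous_intros assms)
    then have "bdd_above (norm ` suppX \<nu>)" by (intro bounded_imp_bdd_above compact_imp_bounded)
    then show ?thesis using that unfolding M_X_def by (auto simp: suppXY_def intro: cSUP_upper)
  qed
  have M_pos: "M_X \<nu> > 0"
  proof -
    obtain z where "z \<in> ?S" using prob_space.not_empty[OF p(2)] space by auto
    then have "0 \<le> M_X \<nu>" using fst_le norm_ge_zero order_trans by blast
    \<comment> \<open>If \<open>M_X \<nu>\<close> were 0, the upper bound on \<eta> would be a
      division by zero, which is 0, contradicting \<open>0 < \<eta>\<close>.\<close>
    moreover have "M_X \<nu> \<noteq> 0" using assms(11,12) by auto
    ultimately show ?thesis by simp
  qed
  have int_\<nu>: "(\<integral>z. k z \<partial>?\<nu>) = (\<integral>z. k z \<partial>\<nu>)" if "continuous_on UNIV k" for k :: "(real^'m) \<times> (real^'n) \<Rightarrow> 'b::euclidean_space"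
    using that measurable_cong_sets[OF \<nu>(2) refl] by (intro integral_restrict_AE sets AE) (auto intro: borel_measurable_continuous_onI)
  have "second_moment_X \<nu> = (\<chi> i j. LINT z|?\<nu>. fst z $ i * fst z $ j)"
    unfolding second_moment_X_def by (subst int_\<nu>) (auto intro!: continuous_intros)
  from second_moment_coercive[OF p(2) fst_bd _ M_pos this assms(9)]
  obtain lam where lam: "lam > 0" "\<And>v. lam * (norm v)\<^sup>2 \<le> (LINT z|?\<nu>. (v \<bullet> fst z)\<^sup>2)"
    using fst_le space by metis
  have c_meas: "?c \<in> borel_measurable (?\<mu> \<Otimes>\<^sub>M ?\<nu>)"
  proof -
    have "(\<lambda>u. u) \<in> borel_measurable \<mu>" "snd \<in> borel_measurable \<nu>"
      unfolding measurable_cong_sets[OF \<mu>(2) refl] measurable_cong_sets[OF \<nu>(2) refl]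
      by (auto intro!: borel_measurable_continuous_onI continuous_intros)
    then have [measurable]: "(\<lambda>u. u) \<in> borel_measurable ?\<mu>" "snd \<in> borel_measurable ?\<nu>"
      by (auto intro: measurable_restrict_space1)
    show ?thesis unfolding cost_def by measurable
  qed
  have "bounded (?c ` (?U \<times> ?S))"
    unfolding cost_def by (intro compact_imp_bounded compact_continuous_image continuous_intros compact_Times S assms) (use assms(10) in auto)
  then obtain C where "\<forall>y\<in>?c ` (?U \<times> ?S). norm y \<le> C"
    unfolding bounded_iff by blast
  then have C: "\<bar>?c p\<bar> \<le> C" if "p \<in> ?U \<times> ?S" for p
    using imageI[OF that, of ?c] unfolding real_norm_def by blast
  interpret vqr \<mu> \<nu> \<epsilon> "M_X \<nu>" lam C
  proof (intro vqr.intro vector_sinkhorn.intro)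
    show "pair_prob_space ?\<mu> ?\<nu>"
      using p by (simp add: pair_prob_space_def pair_sigma_finite_def prob_space_imp_sigma_finite)
    show "vector_sinkhorn_axioms ?\<mu> ?\<nu> fst ?c (M_X \<nu>) lam C"
      using fst_le M_pos lam c_meas C bdmeas_measurable[OF fst_bd] assms(8)
      by unfold_locales (auto simp: space space_pair_measure int_\<nu> continuous_intros)
    show "vqr_axioms \<mu> \<nu> \<epsilon>" by (intro vqr_axioms.intro assms)
  qed
  define F where "F t u = f t u / \<epsilon>" for t u
  define G where "G t u = (1 / \<epsilon>) *\<^sub>R g t u" for t u
  define H where "H t z = h t z / \<epsilon>" for t z
  define Fb where "Fb u = fb u / \<epsilon>" for u
  define Gb where "Gb u = (1 / \<epsilon>) *\<^sub>R gb u" for u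
  define Hb where "Hb z = hb z / \<epsilon>" for z
  have eqs: "f t u = \<epsilon> * F t u" "g t u = \<epsilon> *\<^sub>R G t u" "h t z = \<epsilon> * H t z"
    "fb u = \<epsilon> * Fb u" "gb u = \<epsilon> *\<^sub>R Gb u" "hb z = \<epsilon> * Hb z" for t u z
    using \<epsilon>_pos by (simp_all add: F_def G_def H_def Fb_def Gb_def Hb_def)
  define FU where "FU t = f_update \<nu> \<epsilon> (g t) (h_update \<mu> \<epsilon> (f t) (g t))" for t
  define XM where "XM t = x_moment \<nu> \<epsilon> (g t) (h_update \<mu> \<epsilon> (f t) (g t))" for t
  have hup_eq: "h_update \<mu> \<epsilon> (f t) (g t) z = \<epsilon> * hup (F t) (G t) z" for t z
    by (rule h_update_eq) (rule eqs)+
  have FU: "FU t = (\<lambda>u. \<epsilon> * fup (G t) (hup (F t) (G t)) u)" for t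
    unfolding FU_def by (intro ext f_update_eq eqs hup_eq)
  \<comment> \<open>\<open>dg\<close> is not rescaled, so a step \<eta> for \<open>g\<close> is a
    step \<eta> / \<epsilon> for \<open>G\<close>, and the assumed bound on \<eta> becomes s M^2 <
    2.\<close>
  have grad: "g t u - \<eta> *\<^sub>R (exp (FU t u / \<epsilon>) *\<^sub>R XM t u)
      = \<epsilon> *\<^sub>R (G t u - (\<eta> / \<epsilon>) *\<^sub>R dg (G t) (hup (F t) (G t)) u)" for t u
    using \<epsilon>_pos x_moment_eq[of "g t" u "G t" "h_update \<mu> \<epsilon> (f t) (g t)" "hup (F t) (G t)", OF eqs(2) hup_eq]
    by (simp add: XM_def FU dg_def eqs(2) scaleR_diff_right)
  have raw: "f (Suc t) = (\<lambda>u. FU t u - (LINT u:?U|\<mu>. FU t u))"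
    "g (Suc t) = (\<lambda>u. g t u - \<eta> *\<^sub>R (exp (FU t u / \<epsilon>) *\<^sub>R XM t u)
       - (LINT u:?U|\<mu>. g t u - \<eta> *\<^sub>R (exp (FU t u / \<epsilon>) *\<^sub>R XM t u)))"
    "h (Suc t) = (\<lambda>z. h_update \<mu> \<epsilon> (f t) (g t) z + (LINT u:?U|\<mu>. FU t u)
       + (LINT u:?U|\<mu>. g t u - \<eta> *\<^sub>R (exp (FU t u / \<epsilon>) *\<^sub>R XM t u)) \<bullet> fst z)" for t
    using assms(14)[of t] by (simp_all add: sinkhorn_step_def Let_def FU_def XM_def case_prod_beta')
  have rec: "f (Suc t) u = \<epsilon> * fup (G t) (hup (F t) (G t)) u - (\<integral>u. \<epsilon> * fup (G t) (hup (F t) (G t)) u \<partial>?\<mu>)"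
    "g (Suc t) u = \<epsilon> *\<^sub>R (G t u - (\<eta> / \<epsilon>) *\<^sub>R dg (G t) (hup (F t) (G t)) u)
       - (\<integral>u. \<epsilon> *\<^sub>R (G t u - (\<eta> / \<epsilon>) *\<^sub>R dg (G t) (hup (F t) (G t)) u) \<partial>?\<mu>)"
    "h (Suc t) z = \<epsilon> * hup (F t) (G t) z + (\<integral>u. \<epsilon> * fup (G t) (hup (F t) (G t)) u \<partial>?\<mu>)
       + (\<integral>u. \<epsilon> *\<^sub>R (G t u - (\<eta> / \<epsilon>) *\<^sub>R dg (G t) (hup (F t) (G t)) u) \<partial>?\<mu>) \<bullet> fst z" for t u z
    unfolding raw grad unfolding set_integral_\<mu> hup_eq FU by (rule refl)+
  have bm: "bdmeas ?\<mu> (\<lambda>u. k u / \<epsilon>)" "bdmeas ?\<mu> (\<lambda>u. (1 / \<epsilon>) *\<^sub>R k' u)" "bdmeas ?\<nu> (\<lambda>z. k'' z / \<epsilon>)"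
    "(\<integral>u. k u / \<epsilon> \<partial>?\<mu>) = 0" "(\<integral>u. (1 / \<epsilon>) *\<^sub>R k' u \<partial>?\<mu>) = 0"
    if "admissible \<mu> \<nu> k k' k''" for k :: "real^'n \<Rightarrow> real" and k' :: "real^'n \<Rightarrow> real^'m" and k''
    using that \<epsilon>_pos unfolding admissible_def continuous_centred_def set_integral_\<mu>
    by (auto intro!: bdmeas_continuous_on assms S continuous_intros)
  have pot: "admissible \<mu> \<nu> fb gb hb" "\<And>u. u \<in> ?U \<Longrightarrow> fb u = f_update \<nu> \<epsilon> gb hb u"
    "\<And>u. u \<in> ?U \<Longrightarrow> x_moment \<nu> \<epsilon> gb hb u = 0" "\<And>z. z \<in> ?S \<Longrightarrow> hb z = h_update \<mu> \<epsilon> fb gb z"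
    using assms(15) by (auto simp: dual_potentials_def)
  interpret vector_sinkhorn_iteration ?\<mu> ?\<nu> fst ?c "M_X \<nu>" lam C "\<eta> / \<epsilon>" F G H Fb Gb Hb
  proof unfold_locales
    show "0 < \<eta> / \<epsilon>" using assms(10,11) by simp
    show "\<eta> / \<epsilon> * (M_X \<nu>)\<^sup>2 < 2" using assms(10,12) M_pos by (simp add: field_simps)
    show "bdmeas ?\<mu> (F 0)" "bdmeas ?\<mu> (G 0)" "bdmeas ?\<nu> (H 0)" "(\<integral>u. F 0 u \<partial>?\<mu>) = 0" "(\<integral>u. G 0 u \<partial>?\<mu>) = 0"
      unfolding F_def[abs_def] G_def[abs_def] H_def[abs_def] by (rule bm[OF assms(13)])+
    show "bdmeas ?\<mu> Fb" "bdmeas ?\<mu> Gb" "bdmeas ?\<nu> Hb" "(\<integral>u. Fb u \<partial>?\<mu>) = 0" "(\<integral>u. Gb u \<partial>?\<mu>) = 0"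
      unfolding Fb_def[abs_def] Gb_def[abs_def] Hb_def[abs_def] by (rule bm[OF pot(1)])+
    fix t u z
    show "F (Suc t) u = fup (G t) (hup (F t) (G t)) u - (\<integral>u. fup (G t) (hup (F t) (G t)) u \<partial>?\<mu>)"
      unfolding F_def[of "Suc t"] rec using \<epsilon>_pos by (simp add: diff_divide_distrib)
    show "G (Suc t) u = G t u - (\<eta> / \<epsilon>) *\<^sub>R dg (G t) (hup (F t) (G t)) u
       - (\<integral>u. G t u - (\<eta> / \<epsilon>) *\<^sub>R dg (G t) (hup (F t) (G t)) u \<partial>?\<mu>)"
      unfolding G_def[of "Suc t"] rec integral_scaleR_right scaleR_diff_right[symmetric] using \<epsilon>_pos by simp
    show "H (Suc t) z = hup (F t) (G t) z + (\<integral>u. fup (G t) (hup (F t) (G t)) u \<partial>?\<mu>)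
       + (\<integral>u. G t u - (\<eta> / \<epsilon>) *\<^sub>R dg (G t) (hup (F t) (G t)) u \<partial>?\<mu>) \<bullet> fst z"
      unfolding H_def[of "Suc t"] rec integral_scaleR_right using \<epsilon>_pos by (simp add: add_divide_distrib)
  next
    fix u assume "u \<in> space ?\<mu>"
    then have u: "u \<in> ?U" using space by simp
    show "Fb u = fup Gb Hb u"
      using pot(2)[OF u] f_update_eq[of gb u Gb hb Hb, OF eqs(5,6)] \<epsilon>_pos by (simp add: Fb_def)
    show "dg Gb Hb u = 0"
      using pot(3)[OF u] x_moment_eq[of gb u Gb hb Hb, OF eqs(5,6)] by (simp add: dg_def)
  next
    fix z assume "z \<in> space ?\<nu>"
    then have z: "z \<in> ?S" using space by simp
    show "Hb z = hup Fb Gb z"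
      using pot(4)[OF z] h_update_eq[of fb Fb gb Gb z, OF eqs(4,5)] \<epsilon>_pos by (simp add: Hb_def)
  qed
  obtain \<tau> A where \<tau>: "\<tau> > 0" and rate: "\<And>t. Jb - Jt t \<le> (1 + \<tau>) powr (- real t) * (Jb - Jt 0)"
    and L2: "\<And>t. (\<integral>u. (F t u - Fb u)\<^sup>2 \<partial>?\<mu>) + (\<integral>u. (norm (G t u - Gb u))\<^sup>2 \<partial>?\<mu>) + (\<integral>z. (H t z - Hb z)\<^sup>2 \<partial>?\<nu>)
      \<le> A * (1 + \<tau>) powr (- real t)"
    using linear_convergence by blast
  have Dt: "dual_objective \<mu> \<nu> \<epsilon> (f t) (g t) (h t) = ereal (\<epsilon> * Jt t)" for t
    by (intro dual_objective_eq fm gm hm eqs)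
  have Db: "dual_objective \<mu> \<nu> \<epsilon> fb gb hb = ereal (\<epsilon> * Jb)"
    by (intro dual_objective_eq bar eqs)
  \<comment> \<open>Squared norms scale with \<epsilon>^2 and the objective with \<epsilon>; neither
    affects the rate.\<close>
  have norms: "L2_norm_sq \<mu> ?U (\<lambda>u. f t u - fb u) + L2_norm_sq \<mu> ?U (\<lambda>u. g t u - gb u) + L2_norm_sq \<nu> ?S (\<lambda>z. h t z - hb z)
     = \<epsilon>\<^sup>2 * ((\<integral>u. (F t u - Fb u)\<^sup>2 \<partial>?\<mu>) + (\<integral>u. (norm (G t u - Gb u))\<^sup>2 \<partial>?\<mu>) + (\<integral>z. (H t z - Hb z)\<^sup>2 \<partial>?\<nu>))" for t
    unfolding L2_norm_sq_def set_integral_\<mu> set_integral_\<nu> eqs scaleR_diff_right[symmetric] right_diff_distrib[symmetric]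
    by (simp add: power_mult_distrib distrib_left)
  show ?thesis
  proof (intro exI[of _ \<tau>] conjI allI \<tau>)
    fix t
    have "\<epsilon> * (Jb - Jt t) \<le> \<epsilon> * ((1 + \<tau>) powr (- real t) * (Jb - Jt 0))"
      using rate \<epsilon>_pos by (intro mult_left_mono) auto
    then show "dual_objective \<mu> \<nu> \<epsilon> fb gb hb - dual_objective \<mu> \<nu> \<epsilon> (f t) (g t) (h t)
       \<le> ereal ((1 + \<tau>) powr (- real t)) *
          (dual_objective \<mu> \<nu> \<epsilon> fb gb hb - dual_objective \<mu> \<nu> \<epsilon> (f 0) (g 0) (h 0))"
      unfolding Dt Db by (simp add: algebra_simps)
  next
    show "(\<lambda>t. L2_norm_sq \<mu> ?U (\<lambda>u. f t u - fb u) + L2_norm_sq \<mu> ?U (\<lambda>u. g t u - gb u) + L2_norm_sq \<nu> ?S (\<lambda>z. h t z - hb z))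
      \<in> O(\<lambda>t. (1 + \<tau>) powr (- real t))"
    proof (rule bigoI[where c = "\<epsilon>\<^sup>2 * A"], intro always_eventually allI)
      fix t
      let ?s = "(\<integral>u. (F t u - Fb u)\<^sup>2 \<partial>?\<mu>) + (\<integral>u. (norm (G t u - Gb u))\<^sup>2 \<partial>?\<mu>) + (\<integral>z. (H t z - Hb z)\<^sup>2 \<partial>?\<nu>)"
      have "0 \<le> ?s" by (intro add_nonneg_nonneg) auto
      moreover have "\<epsilon>\<^sup>2 * ?s \<le> \<epsilon>\<^sup>2 * (A * (1 + \<tau>) powr (- real t))" by (intro mult_left_mono L2) auto
      ultimately show "norm (L2_norm_sq \<mu> ?U (\<lambda>u. f t u - fb u) + L2_norm_sq \<mu> ?U (\<lambda>u. g t u - gb u) + L2_norm_sq \<nu> ?S (\<lambda>z. h t z - hb z))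
        \<le> \<epsilon>\<^sup>2 * A * norm ((1 + \<tau>) powr (- real t))"
        unfolding norms by (simp add: mult.assoc)
    qed
  qed
qed

end
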